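(* $$(n+1)T(n)=4(3n-1)T(n-1)+4\sum_{\substack{i+j=n-2\\ i,j\geq 0}}(3i+2)(3j+2)\,T(i)\,T(j),$$ where $T(n)$ counts the number of planar cubic maps with $3n$ edges.
   Context: A map is a connected multigraph (loops and multiple edges allowed) embedded in a compact connected oriented surface so that the complement of the graph is homeomorphic to a collection of disks (the faces), considered up to homeomorphism; equivalently, it is a connected multigraph together with a rotation system describing the clockwise cyclic order of the half-edges around each vertex. The genus of the map is the genus of the surface. A corner is an angular sector between two consecutive half-edges around a vertex, and a rooted map is a map with a distinguished corner. A planar map is a rooted map of genus $0$. A cubic map is a map all of whose vertices have degree $3$. The formula is the planar (genus $0$) case of the Goulden–Jackson recurrence for rooted cubic maps (equivalently, triangulations with loops and multiple edges allowed).
   Formalization: The recurrence is stated for n ≥ 1 (n = 0 would involve the undefined T(−1)), with the convention T(0) = 1: no cubic map has 0 edges, so the literal count T(0) = 0 would make the formula false at n = 1, where T(1) = 4. *)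

theory Defs
  imports "HOL-Combinatorics.Permutations" "HOL-Combinatorics.Orbits"
begin

text \<open>
  A rooted map is encoded by its rotation system. The carrier \<open>half_edges\<close> is the set of
  half-edges, \<open>rot\<close> sends a half-edge to the next one in clockwise order around its vertex, and
  \<open>opp\<close> exchanges the two halves of an edge. A corner is identified with the half-edge that starts
  it in clockwise order, so the distinguished corner is a half-edge \<open>root\<close>. A vertex is identified
  with the set of half-edges around it. The single-vertex map without edges has no such encoding.
\<close>

record 'a rmap =
  half_edges :: "'a set"
  rot :: "'a \<Rightarrow> 'a"
  opp :: "'a \<Rightarrow> 'a"
  root :: 'a

definition vertices :: "'a rmap \<Rightarrow> 'a set set" where
  "vertices M = orbit (rot M) ` half_edges M"

definition edges :: "'a rmap \<Rightarrow> 'a set set" where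
  "edges M = orbit (opp M) ` half_edges M"

text \<open>
  The boundary of a face is followed by crossing to the other end of the current edge and then
  turning to the next half-edge around the vertex reached.
\<close>

definition faces :: "'a rmap \<Rightarrow> 'a set set" where
  "faces M = orbit (rot M \<circ> opp M) ` half_edges M"

definition adjacency :: "'a rmap \<Rightarrow> ('a set \<times> 'a set) set" where
  "adjacency M = {(orbit (rot M) d, orbit (rot M) (opp M d)) | d. d \<in> half_edges M}"

definition connected_map :: "'a rmap \<Rightarrow> bool" where
  "connected_map M \<longleftrightarrow> (\<forall>u\<in>vertices M. \<forall>v\<in>vertices M. (u, v) \<in> (adjacency M)\<^sup>*)"

definition rooted_map :: "'a rmap \<Rightarrow> bool" where
  "rooted_map M \<longleftrightarrow>
     finite (half_edges M) \<and>
     rot M permutes half_edges M \<and>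
     opp M permutes half_edges M \<and>
     (\<forall>d\<in>half_edges M. opp M d \<noteq> d \<and> opp M (opp M d) = d) \<and>
     root M \<in> half_edges M \<and>
     connected_map M"

text \<open>
  Gluing a disk along each face gives the surface of the map, whose genus \<open>g\<close> is determined by
  its Euler characteristic \<open>2 - 2 * g\<close>.
\<close>

definition has_genus :: "'a rmap \<Rightarrow> nat \<Rightarrow> bool" where
  "has_genus M g \<longleftrightarrow>
     int (card (vertices M)) - int (card (edges M)) + int (card (faces M)) = 2 - 2 * int g"

definition planar_map :: "'a rmap \<Rightarrow> bool" where
  "planar_map M \<longleftrightarrow> rooted_map M \<and> has_genus M 0"

definition cubic :: "'a rmap \<Rightarrow> bool" where
  "cubic M \<longleftrightarrow> (\<forall>v\<in>vertices M. card v = 3)"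

text \<open>
  Homeomorphic rooted maps (orientation and root being preserved) are those whose rotation systems
  agree up to relabelling of the half-edges.
\<close>

definition rmap_iso :: "'a rmap \<Rightarrow> 'b rmap \<Rightarrow> bool" where
  "rmap_iso M N \<longleftrightarrow>
     (\<exists>f. bij_betw f (half_edges M) (half_edges N) \<and>
          (\<forall>d\<in>half_edges M. f (rot M d) = rot N (f d) \<and> f (opp M d) = opp N (f d)) \<and>
          f (root M) = root N)"

text \<open>Every finite map is isomorphic to one whose half-edges are natural numbers.\<close>

definition planar_cubic_maps :: "nat \<Rightarrow> nat rmap set" where
  "planar_cubic_maps m = {M. planar_map M \<and> cubic M \<and> card (edges M) = m}"

definition iso_rel :: "'a rmap set \<Rightarrow> ('a rmap \<times> 'a rmap) set" where
  "iso_rel A = {(M, N). M \<in> A \<and> N \<in> A \<and> rmap_iso M N}"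

lemma rmap_iso_refl: "rmap_iso M M"
  unfolding rmap_iso_def by (rule exI[of _ id]) auto

lemma rmap_iso_trans:
  assumes "rmap_iso M N" "rmap_iso N P"
  shows "rmap_iso M P"
proof -
  obtain f where f: "bij_betw f (half_edges M) (half_edges N)"
    "\<forall>d\<in>half_edges M. f (rot M d) = rot N (f d) \<and> f (opp M d) = opp N (f d)"
    "f (root M) = root N"
    using assms(1) unfolding rmap_iso_def by blast
  obtain g where g: "bij_betw g (half_edges N) (half_edges P)"
    "\<forall>d\<in>half_edges N. g (rot N d) = rot P (g d) \<and> g (opp N d) = opp P (g d)"
    "g (root N) = root P"
    using assms(2) unfolding rmap_iso_def by blast
  have "f d \<in> half_edges N" if "d \<in> half_edges M" for d
    using f(1) that by (rule bij_betw_apply)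
  then show ?thesis
    unfolding rmap_iso_def using bij_betw_trans[OF f(1) g(1)] f(2,3) g(2,3)
    by (intro exI[of _ "g \<circ> f"]) simp
qed

lemma rmap_iso_sym:
  assumes "rooted_map M" "rmap_iso M N"
  shows "rmap_iso N M"
proof -
  let ?D = "half_edges M"
  obtain f where f: "bij_betw f ?D (half_edges N)"
    "\<And>d. d \<in> ?D \<Longrightarrow> f (rot M d) = rot N (f d)"
    "\<And>d. d \<in> ?D \<Longrightarrow> f (opp M d) = opp N (f d)"
    "f (root M) = root N"
    using assms(2) unfolding rmap_iso_def by blast
  let ?g = "inv_into ?D f"
  have closed: "root M \<in> ?D" "\<And>d. d \<in> ?D \<Longrightarrow> rot M d \<in> ?D" "\<And>d. d \<in> ?D \<Longrightarrow> opp M d \<in> ?D"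
    using assms(1) by (auto simp: rooted_map_def permutes_in_image)
  have g: "?g (f d) = d" if "d \<in> ?D" for d
    using f(1) that by (rule bij_betw_inv_into_left)
  have "?g (rot N e) = rot M (?g e) \<and> ?g (opp N e) = opp M (?g e)" if "e \<in> half_edges N" for e
  proof -
    have "e \<in> f ` ?D"
      using that bij_betw_imp_surj_on[OF f(1)] by simp
    then obtain d where d: "d \<in> ?D" "e = f d"
      by blast
    then show ?thesis
      by (simp flip: f(2,3) add: g closed)
  qed
  moreover have "?g (root N) = root M"
    using g[OF closed(1)] f(4) by simp
  ultimately show ?thesis
    unfolding rmap_iso_def using bij_betw_inv_into[OF f(1)] by blast
qed

lemma equiv_iso_rel: "equiv (planar_cubic_maps m) (iso_rel (planar_cubic_maps m))"
proof (rule equivI)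
  let ?A = "planar_cubic_maps m"
  show "iso_rel ?A \<subseteq> ?A \<times> ?A"
    by (auto simp: iso_rel_def)
  show "refl_on ?A (iso_rel ?A)"
    by (simp add: refl_on_def iso_rel_def rmap_iso_refl)
  have "rooted_map M" if "M \<in> ?A" for M
    using that by (simp add: planar_cubic_maps_def planar_map_def)
  then show "sym (iso_rel ?A)"
    by (simp add: sym_def iso_rel_def rmap_iso_sym)
  show "trans (iso_rel ?A)"
    unfolding trans_def iso_rel_def using rmap_iso_trans by blast
qed

text \<open>
  There is no cubic map without edges; the recurrence relies on the convention that the count
  is 1 in this case.
\<close>

definition T :: "nat \<Rightarrow> nat" where
  "T n = (if n = 0 then 1
          else card (planar_cubic_maps (3 * n) // iso_rel (planar_cubic_maps (3 * n))))"

end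

theory Submission
  imports "HOL-Computational_Algebra.Formal_Power_Series" "HOL-Computational_Algebra.Polynomial" Defs
begin

text \<open>
  Give a planar map an extra half-edge fixed by \<open>opp\<close>, a leg, at its root vertex, and let all other
  vertices be cubic. Let \<open>p\<close> be the degree of the root vertex without the leg and \<open>n\<close> the number of
  other vertices. Following Tutte, look at the edge next to the leg: an edge leading to another
  vertex can be contracted, which leads to \<open>(p + 1, n - 1)\<close>; a loop at the root vertex separates the
  map, and removing it leaves two maps of the same kind. The genus inequality is what forces the
  two sides of a loop to be disconnected and planar. This is bijective, so the maps are counted by
  codes recording the decomposition, and the generating function \<open>F(y, t)\<close>, in which \<open>y\<close> marks \<open>p\<close>
  and \<open>t\<close> marks \<open>(p + n) / 2\<close>, satisfies
  \<open>t * y^3 * F^2 + (1 - y) * F = 1 - y + y * u(t)\<close> with \<open>u(t) = (\<Sum>n. T n * t^(n+1))\<close>.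
  The quadratic method eliminates \<open>F\<close> and yields \<open>u' = (1 - 2 * u + 6 * t * u')^2\<close>, which is the
  claimed recurrence.
\<close>

section \<open>Orbits of permutations and the genus inequality\<close>

text \<open>The root degree \<open>p\<close> is kept as a catalytic parameter because contraction
  raises it, so that the decomposition gives no recurrence in the number of edges alone. The leg
  marks the root corner by a half-edge. Thus the one-vertex map becomes encodable and can start the
  recursion, and both parts of a removed loop have a marked corner again: one half of the loop
  becomes the leg of one part, the old leg stays with the other.

  The obstacle is planarity of the parts, since removing a loop controls only their total number of
  faces. The genus inequality bounds the faces of each part by the planar value; the two bounds add
  up to the total, so both are attained. To show that there are two parts at all, it has to hold for
  disconnected maps with legs, and this generality is also what lets it be proved by deleting edges.

  In the elimination, the usual double root \<open>y(t)\<close> of the discriminant is replaced by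
  divisibility by \<open>r = 1 - y + 2 * t * y^3 * F\<close>, so that no series is substituted for
  \<open>y\<close>. Rooted cubic maps have \<open>p = 3\<close>; the unknown \<open>u\<close> of the
  equation is the coefficient of \<open>y\<close> in \<open>F\<close>, and the two agree because the
  counts for \<open>p = 1, 2, 3\<close> coincide apart from the smallest case.\<close>

definition num_orbits :: "('a \<Rightarrow> 'a) \<Rightarrow> 'a set \<Rightarrow> nat" where
  "num_orbits f H = card (orbit f ` H)"

text \<open>Unlike \<open>permutes\<close>, this leaves the values off \<open>H\<close> open, so
  that one function can serve on a carrier and on its invariant parts, and a modified function can
  be compared with the old one on a smaller carrier.\<close>

definition perm_on :: "('a \<Rightarrow> 'a) \<Rightarrow> 'a set \<Rightarrow> bool" where
  "perm_on f H \<longleftrightarrow> finite H \<and> f \<in> H \<rightarrow> H \<and> inj_on f H"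

lemma perm_onD:
  assumes "perm_on f H"
  shows "finite H" "x \<in> H \<Longrightarrow> f x \<in> H" "\<lbrakk>x \<in> H; y \<in> H; f x = f y\<rbrakk> \<Longrightarrow> x = y"
  using assms by (auto simp: perm_on_def dest: inj_onD)

lemma perm_on_surj:
  assumes "perm_on f H"
  shows "f ` H = H"
  using assms unfolding perm_on_def by (simp add: endo_inj_surj funcset_image)

lemma perm_on_preimage:
  assumes "perm_on f H" "y \<in> H"
  obtains x where "x \<in> H" "f x = y"
proof -
  have "y \<in> f ` H"
    using perm_on_surj[OF assms(1)] assms(2) by simp
  then show ?thesis
    using that by auto
qed

lemma perm_onI:
  assumes "finite H" "\<And>x. x \<in> H \<Longrightarrow> f x \<in> H" "\<And>x y. \<lbrakk>x \<in> H; y \<in> H; f x = f y\<rbrakk> \<Longrightarrow> x = y"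
  shows "perm_on f H"
  unfolding perm_on_def
proof (intro conjI)
  show "inj_on f H"
    by (rule inj_onI) (rule assms(3))
  show "f \<in> H \<rightarrow> H"
    using assms(2) by (rule funcsetI)
qed (rule assms(1))

lemma perm_on_cong:
  assumes f: "perm_on f H" and eq: "\<And>x. x \<in> H \<Longrightarrow> f x = g x"
  shows "perm_on g H"
proof (rule perm_onI)
  show "x = y" if "x \<in> H" "y \<in> H" "g x = g y" for x y
    using perm_onD(3)[OF f that(1,2)] that(3) eq[OF that(1)] eq[OF that(2)] by simp
  show "g x \<in> H" if "x \<in> H" for x
    using perm_onD(2)[OF f that] eq[OF that] by simp
qed (rule perm_onD(1)[OF f])

lemma perm_on_comp:
  assumes "perm_on f H" "perm_on g H"
  shows "perm_on (f \<circ> g) H"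
proof (rule perm_onI)
  show "x = y" if "x \<in> H" "y \<in> H" "(f \<circ> g) x = (f \<circ> g) y" for x y
    using that perm_onD(3)[OF assms(1), of "g x" "g y"] perm_onD(3)[OF assms(2), of x y]
      perm_onD(2)[OF assms(2)] by simp
qed (simp_all add: perm_onD[OF assms(1)] perm_onD(2)[OF assms(2)])

lemma perm_on_Un:
  assumes "perm_on f A" "perm_on f B" "A \<inter> B = {}"
  shows "perm_on f (A \<union> B)"
proof (rule perm_onI)
  show "x = y" if "x \<in> A \<union> B" "y \<in> A \<union> B" "f x = f y" for x y
    using that perm_onD(2,3)[OF assms(1)] perm_onD(2,3)[OF assms(2)] assms(3)
    by (metis Un_iff disjoint_iff)
qed (use perm_onD[OF assms(1)] perm_onD[OF assms(2)] in auto)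

lemma orbit_subset_closed:
  assumes "f \<in> H \<rightarrow> H" "x \<in> H"
  shows "orbit f x \<subseteq> H"
proof
  fix y assume "y \<in> orbit f x"
  then show "y \<in> H"
    by induct (use assms in auto)
qed

lemma orbit_subset_perm_on: "perm_on f H \<Longrightarrow> x \<in> H \<Longrightarrow> orbit f x \<subseteq> H"
  by (rule orbit_subset_closed) (auto simp: perm_on_def)

text \<open>\<open>orbit f x\<close> starts at \<open>f x\<close>, so \<open>x\<close> lies in it
  only because the cycle of a finite permutation closes up. Restricting \<open>f\<close> by the
  identity off \<open>H\<close> gives a genuine permutation with the same orbit.\<close>

lemma self_in_orbit:
  assumes "perm_on f H" "x \<in> H"
  shows "x \<in> orbit f x"
proof -
  have "bij_betw f H H"
    using assms(1) perm_on_surj[OF assms(1)] by (simp add: bij_betw_def perm_on_def)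
  then have "bij_betw (perm_restrict f H) H H"
    by (simp cong: bij_betw_cong add: perm_restrict_simps)
  then have "perm_restrict f H permutes H"
    by (rule bij_imp_permutes) (simp add: perm_restrict_simps)
  then have "x \<in> orbit (perm_restrict f H) x"
    using assms(1) by (intro permutation_self_in_orbit) (auto simp: permutation_permutes perm_on_def)
  also have "orbit (perm_restrict f H) x = orbit f x"
    using assms by (intro orbit_cong0[of _ H]) (auto simp: perm_restrict_def perm_on_def)
  finally show ?thesis .
qed

lemma orbit_eq:
  assumes "perm_on f H" "x \<in> H" "y \<in> orbit f x"
  shows "orbit f y = orbit f x"
  using self_in_orbit[OF assms(1,2)] assms(3)
  by (meson orbit_swap orbit_trans subsetI subset_antisym)

lemma orbit_disjoint:
  assumes "perm_on f H" "x \<in> H" "y \<in> H" "y \<notin> orbit f x"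
  shows "orbit f x \<inter> orbit f y = {}"
proof (rule ccontr)
  assume "orbit f x \<inter> orbit f y \<noteq> {}"
  then obtain z where "z \<in> orbit f x" "z \<in> orbit f y"
    by blast
  then have "orbit f x = orbit f y"
    using orbit_eq[OF assms(1,2)] orbit_eq[OF assms(1,3)] by metis
  then show False
    using self_in_orbit[OF assms(1,3)] assms(4) by simp
qed

lemma orbit_cong_closed:
  assumes "f \<in> A \<rightarrow> A" "x \<in> A" "\<And>y. y \<in> A \<Longrightarrow> f y = g y"
  shows "orbit f x = orbit g x"
  using assms by (intro orbit_cong0[of x A]) auto

lemma num_orbits_cong:
  assumes "f \<in> H \<rightarrow> H" "\<And>y. y \<in> H \<Longrightarrow> f y = g y"
  shows "num_orbits f H = num_orbits g H"
  unfolding num_orbits_def using orbit_cong_closed[OF assms(1) _ assms(2)]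
  by (intro arg_cong[where f = card] image_cong) auto

lemma num_orbits_Un:
  assumes "perm_on f A" "perm_on f B" "A \<inter> B = {}"
  shows "num_orbits f (A \<union> B) = num_orbits f A + num_orbits f B"
proof -
  have "orbit f x \<noteq> orbit f y" if "x \<in> A" "y \<in> B" for x y
    using that assms(3) self_in_orbit[OF assms(1)] orbit_subset_perm_on[OF assms(2)] by fastforce
  then have "orbit f ` A \<inter> orbit f ` B = {}"
    by blast
  then show ?thesis
    using perm_onD(1)[OF assms(1)] perm_onD(1)[OF assms(2)] by (simp add: num_orbits_def image_Un card_Un_disjoint)
qed

lemma orbit_image:
  assumes "perm_on f H" "x \<in> H" "\<And>y. y \<in> H \<Longrightarrow> g (f y) = f' (g y)"
  shows "orbit f' (g x) = g ` orbit f x"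
proof -
  have "f' (g y) = g (f y)" if "y \<in> orbit f x" for y
    using that assms(3) orbit_subset_perm_on[OF assms(1,2)] by auto
  then show ?thesis
    using orbit_inverse[of x f f' g, OF self_in_orbit[OF assms(1,2)]] by simp
qed

lemma num_orbits_image:
  assumes "perm_on f H" "inj_on g H" "\<And>y. y \<in> H \<Longrightarrow> g (f y) = f' (g y)"
  shows "num_orbits f' (g ` H) = num_orbits f H"
proof -
  have "orbit f' ` g ` H = (`) g ` orbit f ` H"
    unfolding image_image using orbit_image[of f H _ g f'] assms(1,3) by auto
  moreover have "inj_on ((`) g) (orbit f ` H)"
    using inj_on_image_eq_iff[OF assms(2)] orbit_subset_perm_on[OF assms(1)]
    by (auto simp: inj_on_def)
  ultimately show ?thesis
    by (simp add: num_orbits_def card_image)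
qed

section \<open>Deleting an element from its cycle\<close>

definition skip :: "'a \<Rightarrow> ('a \<Rightarrow> 'a) \<Rightarrow> 'a \<Rightarrow> 'a" where
  "skip e f x = (if f x = e then f e else f x)"

lemma perm_on_skip:
  assumes "perm_on f (insert e H)" "e \<notin> H"
  shows "perm_on (skip e f) H"
proof -
  note f = perm_onD[OF assms(1)]
  have "skip e f x \<in> H" if "x \<in> H" for x
    using f(2)[of x] f(2)[of e] f(3)[of x e] that assms(2) by (auto simp: skip_def)
  moreover have "x = y" if "x \<in> H" "y \<in> H" "skip e f x = skip e f y" for x y
  proof (rule f(3))
    have "e \<noteq> x" "e \<noteq> y"
      using that assms(2) by auto
    then have "f x \<noteq> f e" "f y \<noteq> f e"
      using f(3)[of e x] f(3)[of e y] that by auto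
    then show "f x = f y"
      using that(3) by (simp add: skip_def split: if_splits)
  qed (use that in auto)
  ultimately show ?thesis
    using f(1) by (auto simp: perm_on_def inj_on_def)
qed

lemma orbit_skip:
  assumes f: "perm_on f (insert e H)" and e: "e \<notin> H" "f e \<noteq> e" and x: "x \<in> H"
  shows "orbit (skip e f) x = orbit f x - {e}"
proof (intro subset_antisym subsetI)
  fix y assume "y \<in> orbit (skip e f) x"
  then show "y \<in> orbit f x - {e}"
  proof induct
    case base
    show ?case
      using e orbit.step[OF orbit.base, of f x] orbit.base[of f x] by (auto simp: skip_def)
  next
    case (step y)
    then show ?case
      using e orbit.step[of y f x] orbit.step[of "f y" f x] by (auto simp: skip_def)
  qed
next
  have *: "(if y = e then f e else y) \<in> orbit (skip e f) x" if "y \<in> orbit f x" for y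
    using that
  proof induct
    case base
    show ?case
      using orbit.base[of "skip e f" x] by (auto simp: skip_def[of e f x])
  next
    case (step y)
    show ?case
    proof (cases "y = e")
      case True
      then show ?thesis using step e by auto
    next
      case False
      then have "skip e f y \<in> orbit (skip e f) x"
        using step by (auto intro: orbit.step)
      then show ?thesis by (auto simp: skip_def[of e f y])
    qed
  qed
  fix y assume "y \<in> orbit f x - {e}"
  then show "y \<in> orbit (skip e f) x"
    using *[of y] by auto
qed

text \<open>No orbit is lost because \<open>e\<close> is not alone in its cycle, and none are
  identified because two orbits that agree up to \<open>e\<close> share a point of \<open>H\<close>.
  This is the device behind all face counts below: a surgery on a map deletes a few half-edges from
  the cycles of the face permutation.\<close>

lemma num_orbits_skip:
  assumes f: "perm_on f (insert e H)" and e: "e \<notin> H" "f e \<noteq> e"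
  shows "num_orbits (skip e f) H = num_orbits f (insert e H)"
proof -
  have "orbit f e = orbit f (f e)"
    using f by (metis insertI1 self_in_orbit self_in_orbit_step)
  moreover have "f e \<in> H"
    using perm_onD(2)[OF f, of e] e by auto
  ultimately have 1: "orbit f ` insert e H = orbit f ` H"
    by auto
  have 2: "orbit (skip e f) ` H = (\<lambda>X. X - {e}) ` orbit f ` H"
    unfolding image_image using orbit_skip[OF f e] by (intro image_cong) auto
  have "inj_on (\<lambda>X. X - {e}) (orbit f ` H)"
  proof (rule inj_onI, safe)
    fix x y assume xy: "x \<in> H" "y \<in> H" "orbit f x - {e} = orbit f y - {e}"
    then have "x \<in> orbit f y"
      using self_in_orbit[OF f, of x] e by auto
    then show "z \<in> orbit f y" if "z \<in> orbit f x" for z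
      using that orbit_trans by metis
    show "z \<in> orbit f x" if "z \<in> orbit f y" for z
      using that orbit_eq[OF f, of y x] \<open>x \<in> orbit f y\<close> xy by auto
  qed
  then show ?thesis
    unfolding num_orbits_def 1 2 by (rule card_image)
qed

section \<open>Composing a permutation with a transposition on the right\<close>

definition swapped :: "'a \<Rightarrow> 'a \<Rightarrow> ('a \<Rightarrow> 'a) \<Rightarrow> 'a \<Rightarrow> 'a" where
  "swapped a b f = f(a := f b, b := f a)"

lemma swapped_swapped: "swapped a b (swapped a b f) = f"
  by (auto simp: swapped_def)

lemma perm_on_swapped:
  assumes "perm_on f H" "a \<in> H" "b \<in> H"
  shows "perm_on (swapped a b f) H"
proof -
  note f = perm_onD[OF assms(1)]
  have "x = y" if "x \<in> H" "y \<in> H" "swapped a b f x = swapped a b f y" for x y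
    using f(3)[of x y] f(3)[of a y] f(3)[of b y] f(3)[of x a] f(3)[of x b] f(3)[of a b] that assms(2,3)
    by (simp add: swapped_def split: if_splits)
  moreover have "swapped a b f x \<in> H" if "x \<in> H" for x
    using f(2) assms(2,3) that by (simp add: swapped_def)
  ultimately show ?thesis
    using f(1) by (metis perm_onI)
qed

lemma orbits_swapped_subset:
  assumes "perm_on f H"
  shows "{X \<in> orbit f ` H. a \<notin> X \<and> b \<notin> X} \<subseteq> {X \<in> orbit (swapped a b f) ` H. a \<notin> X \<and> b \<notin> X}"
proof safe
  fix x assume x: "x \<in> H" "a \<notin> orbit f x" "b \<notin> orbit f x"
  then have "orbit (swapped a b f) x = orbit f x"
    using self_in_orbit[OF assms] by (intro orbit_cong) (auto simp: swapped_def)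
  then show "orbit f x \<in> orbit (swapped a b f) ` H"
    using x by blast
qed

lemma orbits_split:
  assumes "perm_on f H" "a \<in> H" "b \<in> H"
  shows "orbit f ` H = {X \<in> orbit f ` H. a \<notin> X \<and> b \<notin> X} \<union> {orbit f a, orbit f b}"
  using assms(2,3) orbit_eq[OF assms(1)] by blast

text \<open>\<open>K\<close> collects the orbits that avoid \<open>a\<close> and \<open>b\<close>;
  these are common to both permutations. Only the one or two orbits through \<open>a\<close> and
  \<open>b\<close> are left to compare.\<close>

lemma num_orbits_swapped_aux:
  assumes f: "perm_on f H" and ab: "a \<in> H" "b \<in> H"
  obtains K where "finite K" "orbit f ` H = K \<union> {orbit f a, orbit f b}"
    "orbit (swapped a b f) ` H = K \<union> {orbit (swapped a b f) a, orbit (swapped a b f) b}"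
    "orbit f a \<notin> K" "orbit f b \<notin> K" "orbit (swapped a b f) a \<notin> K"
proof -
  let ?g = "swapped a b f"
  let ?K = "\<lambda>f. {X \<in> orbit f ` H. a \<notin> X \<and> b \<notin> X}"
  have g: "perm_on ?g H"
    using perm_on_swapped[OF f ab] .
  have KK: "?K f = ?K ?g"
    using orbits_swapped_subset[OF f, of a b] orbits_swapped_subset[OF g, of a b]
    unfolding swapped_swapped by (rule subset_antisym)
  show ?thesis
  proof (rule that[of "?K f"])
    show "orbit f ` H = ?K f \<union> {orbit f a, orbit f b}"
      by (rule orbits_split[OF f ab])
    show "orbit ?g ` H = ?K f \<union> {orbit ?g a, orbit ?g b}"
      unfolding KK by (rule orbits_split[OF g ab])
  qed (use perm_onD(1)[OF f] self_in_orbit[OF f] self_in_orbit[OF g] ab in simp_all)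
qed

lemma num_orbits_swapped_le:
  assumes f: "perm_on f H" and ab: "a \<in> H" "b \<in> H"
  shows "num_orbits (swapped a b f) H \<le> num_orbits f H + 1"
proof -
  obtain K where K: "finite K" "orbit f ` H = K \<union> {orbit f a, orbit f b}"
    "orbit (swapped a b f) ` H = K \<union> {orbit (swapped a b f) a, orbit (swapped a b f) b}"
    "orbit f a \<notin> K"
    using num_orbits_swapped_aux[OF f ab] by metis
  have "card (K \<union> {orbit f a, orbit f b}) \<ge> card (insert (orbit f a) K)"
    using K(1) by (intro card_mono) auto
  then show ?thesis
    unfolding num_orbits_def K(2,3) using K(1,4) by (simp add: card_insert_if)
qed

text \<open>The new permutation goes from \<open>a\<close> to \<open>f b\<close> and then along the
  whole old cycle of \<open>b\<close>, hence reaches \<open>b\<close>: the two cycles have been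
  joined.\<close>

lemma num_orbits_swapped_merge:
  assumes f: "perm_on f H" and ab: "a \<in> H" "b \<in> H" "b \<notin> orbit f a"
  shows "num_orbits f H = num_orbits (swapped a b f) H + 1"
proof -
  let ?g = "swapped a b f"
  have g: "perm_on ?g H"
    using perm_on_swapped[OF f ab(1,2)] .
  have "a \<notin> orbit f b"
    using ab orbit_eq[OF f, of b a] self_in_orbit[OF f, of b] by auto
  have ga: "?g a = f b"
    using ab by (auto simp: swapped_def)
  have "y \<in> orbit ?g a" if "y \<in> orbit f b" for y
    using that
  proof induct
    case base
    show ?case using ga orbit.base[of ?g a] by simp
  next
    case (step y)
    have "y \<noteq> a"
      using step \<open>a \<notin> orbit f b\<close> by auto
    show ?case
    proof (cases "y = b")
      case True
      then show ?thesis using ga orbit.base[of ?g a] by simp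
    next
      case False
      then have "?g y = f y"
        using \<open>y \<noteq> a\<close> by (simp add: swapped_def)
      then show ?thesis
        using step orbit.step by metis
    qed
  qed
  then have "b \<in> orbit ?g a"
    using self_in_orbit[OF f ab(2)] .
  then have *: "orbit ?g b = orbit ?g a"
    using orbit_eq[OF g ab(1)] by simp
  obtain K where K: "finite K" "orbit f ` H = K \<union> {orbit f a, orbit f b}"
    "orbit ?g ` H = K \<union> {orbit ?g a, orbit ?g b}"
    "orbit f a \<notin> K" "orbit f b \<notin> K" "orbit (swapped a b f) a \<notin> K"
    using num_orbits_swapped_aux[OF f ab(1,2)] by metis
  have "orbit f a \<noteq> orbit f b"
    using self_in_orbit[OF f ab(2)] ab(3) by auto
  then show ?thesis
    unfolding num_orbits_def K(2,3) * using K by (simp add: card_insert_if)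
qed

section \<open>Connected components under two permutations\<close>

definition link :: "'a set \<Rightarrow> ('a \<Rightarrow> 'a) \<Rightarrow> ('a \<Rightarrow> 'a) \<Rightarrow> ('a \<times> 'a) set" where
  "link H s t = {(d, s d) | d. d \<in> H} \<union> {(d, t d) | d. d \<in> H}"

definition conn :: "'a set \<Rightarrow> ('a \<Rightarrow> 'a) \<Rightarrow> ('a \<Rightarrow> 'a) \<Rightarrow> ('a \<times> 'a) set" where
  "conn H s t = (link H s t \<union> (link H s t)\<inverse>)\<^sup>*"

lemma conn_refl [simp]: "(x, x) \<in> conn H s t"
  by (simp add: conn_def)

lemma conn_sym: "(x, y) \<in> conn H s t \<Longrightarrow> (y, x) \<in> conn H s t"
  unfolding conn_def using sym_rtrancl[of "link H s t \<union> (link H s t)\<inverse>"]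
  by (auto simp: sym_def sym_Un_converse)

lemma conn_trans: "(x, y) \<in> conn H s t \<Longrightarrow> (y, z) \<in> conn H s t \<Longrightarrow> (x, z) \<in> conn H s t"
  unfolding conn_def by (rule rtrancl_trans)

lemma conn_step: "d \<in> H \<Longrightarrow> (d, s d) \<in> conn H s t" "d \<in> H \<Longrightarrow> (d, t d) \<in> conn H s t"
  by (auto simp: conn_def link_def)

text \<open>Each generating step need only go to a path, not to a step. This covers maps that
  collapse new half-edges to old ones as well as steps that a surgery replaces by a detour.\<close>

lemma conn_map:
  assumes "(x, y) \<in> conn H s t"
    and "\<And>d. d \<in> H \<Longrightarrow> (p d, p (s d)) \<in> conn H' s' t'"
    and "\<And>d. d \<in> H \<Longrightarrow> (p d, p (t d)) \<in> conn H' s' t'"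
  shows "(p x, p y) \<in> conn H' s' t'"
  using assms(1) unfolding conn_def[of H s t]
proof induct
  case base
  show ?case by simp
next
  case (step y z)
  then have "(p y, p z) \<in> conn H' s' t'"
    unfolding link_def by (auto intro: assms(2,3) conn_sym[OF assms(2)] conn_sym[OF assms(3)])
  then show ?case
    using step conn_trans by metis
qed

lemma conn_sub:
  assumes "(x, y) \<in> conn H s t"
    and "\<And>d. d \<in> H \<Longrightarrow> (d, s d) \<in> conn H' s' t'"
    and "\<And>d. d \<in> H \<Longrightarrow> (d, t d) \<in> conn H' s' t'"
  shows "(x, y) \<in> conn H' s' t'"
  using conn_map[where p = "\<lambda>x. x", OF assms] .

lemma conn_closed:
  assumes "(x, y) \<in> conn H s t" "x \<in> H" "s \<in> H \<rightarrow> H" "t \<in> H \<rightarrow> H"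
  shows "y \<in> H"
  using assms(1) unfolding conn_def
  by induct (use assms(2-) in \<open>auto simp: link_def\<close>)

lemma conn_orbit:
  assumes "y \<in> orbit f x" "x \<in> H" "f \<in> H \<rightarrow> H" "\<And>d. d \<in> H \<Longrightarrow> (d, f d) \<in> conn H s t"
  shows "(x, y) \<in> conn H s t"
  using assms(1)
proof induct
  case base
  then show ?case using assms by auto
next
  case (step y)
  then have "y \<in> H"
    using orbit_subset_closed[OF assms(3,2)] by auto
  then show ?case
    using step assms(4) conn_trans by metis
qed

definition num_comps :: "'a set \<Rightarrow> ('a \<Rightarrow> 'a) \<Rightarrow> ('a \<Rightarrow> 'a) \<Rightarrow> nat" where
  "num_comps H s t = card ((\<lambda>x. conn H s t `` {x}) ` H)"

lemma conn_class_eq: "(x, y) \<in> conn H s t \<Longrightarrow> conn H s t `` {x} = conn H s t `` {y}"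
  by (auto intro: conn_sym conn_trans)

section \<open>The genus inequality\<close>

lemma genus_inequality_id:
  assumes s: "perm_on s H" and t: "\<And>d. d \<in> H \<Longrightarrow> t d = d"
  shows "num_orbits s H + num_orbits t H + num_orbits (s \<circ> t) H \<le> card H + 2 * num_comps H s t"
proof -
  have "orbit t d = {d}" if "d \<in> H" for d
    using t[OF that] orbit_eq_singleton_iff by metis
  then have "orbit t ` H = (\<lambda>d. {d}) ` H"
    by auto
  then have 1: "num_orbits t H = card H"
    by (simp add: num_orbits_def card_image)
  have 2: "num_orbits (s \<circ> t) H = num_orbits s H"
    using s t by (intro num_orbits_cong) (auto simp: perm_on_def)
  have "conn H s t `` {x} = orbit s x" if "x \<in> H" for x
  proof (intro subset_antisym subsetI)
    fix y assume "y \<in> conn H s t `` {x}"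
    then have "(x, y) \<in> (link H s t \<union> (link H s t)\<inverse>)\<^sup>*"
      by (simp add: conn_def)
    then show "y \<in> orbit s x"
    proof induct
      case base
      show ?case using self_in_orbit[OF s that] .
    next
      case (step y z)
      then have "z = s y \<or> y = s z \<or> z = y" "z \<in> H"
        using perm_onD(2)[OF s] t by (auto simp: link_def)
      then show ?case
        using step(3) self_in_orbit[OF s, of z]
        by (metis orbit.step orbit_swap orbit_trans self_in_orbit_step orbit.base)
    qed
  next
    fix y assume "y \<in> orbit s x"
    then show "y \<in> conn H s t `` {x}"
      using conn_orbit[of y s x H s t] that s conn_step[of _ H s t] by (auto simp: perm_on_def)
  qed
  then have "num_comps H s t = num_orbits s H"
    by (simp add: num_comps_def num_orbits_def cong: image_cong_simp)
  then show ?thesis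
    using 1 2 by simp
qed

text \<open>\<open>t0\<close> cuts the edge from \<open>a\<close> to \<open>t a\<close> into two
  legs. A component of the cut map that contains neither end is a component of the original as well.
  So only the ends matter: they account for one component before the cut and for at most two after
  it, or for one if they stay connected.\<close>

lemma num_comps_cut:
  assumes H: "finite H" "a \<in> H" "t a \<in> H" and t: "t (t a) = a"
    and t0: "t0 = t(a := a, t a := t a)"
  shows "(a, t a) \<in> conn H s t0 \<Longrightarrow> num_comps H s t0 \<le> num_comps H s t"
    and "num_comps H s t0 \<le> num_comps H s t + 1"
proof -
  let ?E = "conn H s t" and ?C = "conn H s t0" and ?a' = "t a"
  define K where "K = {X \<in> (\<lambda>x. ?C `` {x}) ` H. a \<notin> X \<and> ?a' \<notin> X}"
  have fin: "finite K"
    unfolding K_def using H(1) by auto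
  have 0: "(\<lambda>x. ?C `` {x}) ` H = K \<union> {?C `` {a}, ?C `` {?a'}}"
    unfolding K_def using H(2,3) conn_class_eq[of _ _ H s t0] by auto
  have sub: "(x, y) \<in> ?E" if "(x, y) \<in> ?C" for x y
  proof (rule conn_sub[OF that])
    fix d assume d: "d \<in> H"
    show "(d, t0 d) \<in> ?E"
    proof (cases "d = a \<or> d = ?a'")
      case False
      then have "t0 d = t d"
        by (simp add: t0)
      then show ?thesis
        using conn_step(2)[OF d] by simp
    qed (auto simp: t0)
  qed (auto intro: conn_step)
  have "?E `` {x} = ?C `` {x}" if x: "a \<notin> ?C `` {x}" "?a' \<notin> ?C `` {x}" for x
  proof (intro subset_antisym subsetI)
    fix y assume "y \<in> ?E `` {x}"
    then have "(x, y) \<in> (link H s t \<union> (link H s t)\<inverse>)\<^sup>*"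
      by (simp add: conn_def)
    then show "y \<in> ?C `` {x}"
    proof induct
      case (step y z)
      have y: "y \<noteq> a" "y \<noteq> ?a'"
        using step(3) x by auto
      from step(2) consider "y \<in> H" "z = s y" | "z \<in> H" "y = s z" | "y \<in> H" "z = t y"
        | "z \<in> H" "y = t z"
        by (auto simp: link_def)
      then have "(y, z) \<in> ?C"
      proof cases
        case 3
        then show ?thesis
          using y conn_step(2)[of y H t0 s] by (simp add: t0)
      next
        case 4
        then have "z \<noteq> a" "z \<noteq> ?a'"
          using y t by auto
        then show ?thesis
          using 4 conn_sym[OF conn_step(2)[of z H t0 s]] by (simp add: t0)
      qed (auto intro: conn_step conn_sym)
      then show ?case
        using step(3) conn_trans[of x y H s t0 z] by auto
    qed auto
  qed (use sub in auto)
  then have "K \<subseteq> (\<lambda>x. ?E `` {x}) ` H"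
    unfolding K_def by blast
  moreover have "?E `` {a} \<notin> K"
    unfolding K_def by auto
  ultimately have "card K + 1 \<le> num_comps H s t"
    unfolding num_comps_def using H(1,2) fin
      card_mono[of "(\<lambda>x. ?E `` {x}) ` H" "insert (?E `` {a}) K"] by auto
  moreover have "num_comps H s t0 \<le> card K + 2"
    unfolding num_comps_def 0 using fin by (simp add: card_insert_if)
  moreover have "num_comps H s t0 \<le> card K + 1" if "(a, ?a') \<in> ?C"
    unfolding num_comps_def 0 using fin conn_class_eq[OF that] by (simp add: card_insert_if)
  ultimately show "(a, t a) \<in> conn H s t0 \<Longrightarrow> num_comps H s t0 \<le> num_comps H s t"
    "num_comps H s t0 \<le> num_comps H s t + 1"
    by force+
qed

text \<open>\<open>card H - num_orbits t H\<close> is the number of edges with two ends, so this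
  says that vertices minus edges plus faces is at most twice the number of components. Fixed points
  of \<open>t\<close> are legs; allowing them makes induction on the number of edges possible,
  because a cut edge leaves two legs behind.\<close>

lemma genus_inequality:
  assumes s: "perm_on s H" and t: "perm_on t H" "\<And>d. d \<in> H \<Longrightarrow> t (t d) = d"
  shows "num_orbits s H + num_orbits t H + num_orbits (s \<circ> t) H \<le> card H + 2 * num_comps H s t"
  using t
proof (induction "card {d \<in> H. t d \<noteq> d}" arbitrary: t rule: less_induct)
  case less
  note t = less.prems
  show ?case
  proof (cases "\<exists>a\<in>H. t a \<noteq> a")
    case False
    then show ?thesis
      using genus_inequality_id[OF s, of t] by auto
  next
    case True
    then obtain a where a: "a \<in> H" "t a \<noteq> a"
      by blast
    define b where "b = t a"
    have b: "b \<in> H" "t b = a" "b \<noteq> a"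
      using a t perm_onD(2) by (auto simp: b_def)
    define t0 where "t0 = t(a := a, b := b)"
    \<comment> \<open>As \<open>t\<close> exchanges \<open>a\<close> and \<open>b\<close>, composing
      it with their transposition fixes both. The face permutation changes by the same
      transposition.\<close>
    have sw: "t0 = swapped a b t" "t = swapped a b t0" "s \<circ> t = swapped a b (s \<circ> t0)"
      using a b by (auto simp: t0_def swapped_def b_def fun_eq_iff)
    have t0: "perm_on t0 H"
      unfolding sw(1) using t a b by (intro perm_on_swapped)
    have inv0: "t0 (t0 d) = d" if "d \<in> H" for d
      using t(2)[OF that] t(2)[OF a(1)] b by (auto simp: t0_def b_def)
    have "{d \<in> H. t0 d \<noteq> d} \<subset> {d \<in> H. t d \<noteq> d}"
      using a b by (auto simp: t0_def)
    then have "card {d \<in> H. t0 d \<noteq> d} < card {d \<in> H. t d \<noteq> d}"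
      using perm_onD(1)[OF s] by (intro psubset_card_mono) auto
    then have IH: "num_orbits s H + num_orbits t0 H + num_orbits (s \<circ> t0) H \<le> card H + 2 * num_comps H s t0"
      by (rule less.hyps) (use t0 inv0 in auto)
    have "orbit t0 a = {a}"
      using b by (simp add: orbit_eq_singleton_iff t0_def)
    then have nt: "num_orbits t0 H = num_orbits t H + 1"
      unfolding sw(2) using t0 a b num_orbits_swapped_merge[of t0 H a b] by auto
    have f0: "perm_on (s \<circ> t0) H"
      using perm_on_comp s t0 by blast
    note nc = num_comps_cut[of H a t t0 s, folded b_def, OF perm_onD(1)[OF s] a(1) b(1,2) t0_def]
    \<comment> \<open>Restoring the edge merges two orbits of \<open>t\<close>. If its ends are
      connected without it, the faces grow by at most 1, which this loss pays for. Otherwise the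
      ends lie on different faces, which merge as well; the total loss of 2 matches one component
      less.\<close>
    show ?thesis
    proof (cases "(a, b) \<in> conn H s t0")
      case True
      then show ?thesis
        using IH nt nc(1) num_orbits_swapped_le[OF f0 a(1) b(1), folded sw(3)] by linarith
    next
      case False
      have "(d, (s \<circ> t0) d) \<in> conn H s t0" if "d \<in> H" for d
        using conn_trans[OF conn_step(2)[OF that, of t0 s] conn_step(1)[OF perm_onD(2)[OF t0 that], of s t0]]
        by simp
      then have "b \<notin> orbit (s \<circ> t0) a"
        using False a(1) conn_orbit[of b "s \<circ> t0" a H s t0] f0 unfolding perm_on_def by blast
      then show ?thesis
        using IH nt nc(2) num_orbits_swapped_merge[OF f0 a(1) b(1), folded sw(3)] by linarith
    qed
  qed
qed

section \<open>Orbit sizes and invariants along paths\<close>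

lemma perm_on_surjI:
  assumes "finite H" "H \<subseteq> f ` H"
  shows "perm_on f H"
proof -
  have "f ` H = H"
    using assms by (metis card_image_le card_seteq finite_imageI)
  then show ?thesis
    using assms finite_surj_inj[OF assms] by (simp add: perm_on_def image_subset_iff_funcset[symmetric])
qed

lemma perm_on_involution:
  assumes "finite H" "\<And>d. d \<in> H \<Longrightarrow> t d \<in> H" "\<And>d. d \<in> H \<Longrightarrow> t (t d) = d"
  shows "perm_on t H"
proof (rule perm_on_surjI)
  show "H \<subseteq> t ` H"
    using assms(2,3) by (metis image_eqI subsetI)
qed (rule assms(1))

text \<open>The orbits partition \<open>H\<close>, and all except the one of \<open>r\<close> have
  \<open>k\<close> elements. Adding \<open>k\<close> on the left avoids the natural subtraction in
  the number of other orbits.\<close>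

lemma card_orbits:
  assumes f: "perm_on f H" and r: "r \<in> H"
    and k: "\<And>d. d \<in> H \<Longrightarrow> d \<notin> orbit f r \<Longrightarrow> card (orbit f d) = k"
  shows "card H + k = card (orbit f r) + k * num_orbits f H"
proof -
  let ?O = "orbit f ` H"
  have fin: "finite ?O"
    using perm_onD(1)[OF f] by simp
  have "\<Union> ?O = H"
    using orbit_subset_perm_on[OF f] self_in_orbit[OF f] by auto
  then have "card H = card (\<Union> ?O)"
    by simp
  also have "\<dots> = sum card ?O"
  proof (rule card_Union_disjoint)
    show "pairwise disjnt ?O"
      unfolding pairwise_def disjnt_def using orbit_eq[OF f] by blast
    show "finite X" if "X \<in> ?O" for X
      using that orbit_subset_perm_on[OF f] perm_onD(1)[OF f] by (auto intro: finite_subset)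
  qed
  also have "\<dots> = card (orbit f r) + sum card (?O - {orbit f r})"
    using fin r by (simp add: sum.remove)
  also have "sum card (?O - {orbit f r}) = (\<Sum>X\<in>?O - {orbit f r}. k)"
  proof (rule sum.cong)
    fix X assume "X \<in> ?O - {orbit f r}"
    then show "card X = k"
      using k orbit_eq[OF f r] by auto
  qed simp
  also have "\<dots> = k * (card ?O - 1)"
    using fin r by simp
  finally have "card H = card (orbit f r) + k * (card ?O - 1)" .
  moreover have "card ?O \<noteq> 0"
    using fin r by auto
  ultimately show ?thesis
    by (cases "card ?O") (simp_all add: num_orbits_def)
qed

lemma card_opp_orbit:
  assumes "t (t d) = d" "t d \<noteq> d"
  shows "card (orbit t d) = 2"
proof -
  have "orbit t d = {d, t d}"
  proof (rule subset_antisym)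
    show "orbit t d \<subseteq> {d, t d}"
      by (rule orbit_subset_closed) (use assms in auto)
    show "{d, t d} \<subseteq> orbit t d"
      using orbit.step[OF orbit.base[of t d]] orbit.base[of t d] assms by simp
  qed
  then show ?thesis
    using assms by simp
qed

lemma conn_invariant:
  assumes "(x, y) \<in> conn H s t" "\<And>d. d \<in> H \<Longrightarrow> P d \<longleftrightarrow> P (s d)" "\<And>d. d \<in> H \<Longrightarrow> P d \<longleftrightarrow> P (t d)"
  shows "P x \<longleftrightarrow> P y"
proof -
  \<comment> \<open>Over the empty carrier \<open>conn\<close> is equality, so \<open>P\<close> is a
    map to two isolated points.\<close>
  have "(P x, P y) \<in> conn {} id id"
    by (rule conn_map[OF assms(1)]) (use assms(2,3) in auto)
  then show ?thesis
    by (simp add: conn_def link_def)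
qed

text \<open>A path that starts at \<open>x\<close> never leaves the component of \<open>x\<close>,
  so all its steps are available there.\<close>

lemma conn_component:
  assumes "(x, y) \<in> conn H s t"
  shows "(x, y) \<in> conn (conn H s t `` {x}) s t"
proof -
  let ?C = "conn H s t `` {x}"
  show ?thesis
    using assms unfolding conn_def[of H]
  proof (induct rule: rtrancl_induct)
    case (step y z)
    have y: "y \<in> ?C"
      using step(1) by (simp add: conn_def)
    have z: "z \<in> ?C"
      using rtrancl.rtrancl_into_rtrancl[OF step(1,2)] by (simp add: conn_def)
    have "(y, z) \<in> conn ?C s t"
      using step(2) conn_step[OF y, of s t] conn_step[OF y, of t s]
        conn_sym[OF conn_step(1)[OF z, of s t]] conn_sym[OF conn_step(2)[OF z, of t s]]
      by (auto simp: link_def)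
    then show ?case
      using step(3) by (auto simp flip: conn_def intro: conn_trans)
  qed (simp flip: conn_def)
qed

lemma num_comps_connected:
  assumes "r \<in> H" "\<And>d. d \<in> H \<Longrightarrow> (r, d) \<in> conn H s t"
  shows "num_comps H s t = 1"
proof -
  have "(\<lambda>x. conn H s t `` {x}) ` H = {conn H s t `` {r}}"
    using assms conn_class_eq[of r _ H s t] by auto
  then show ?thesis
    by (simp add: num_comps_def)
qed

section \<open>Contracting an edge and removing a loop\<close>

text \<open>
  The root cycle \<open>(r b c \<dots>)\<close> of \<open>s'\<close> is split into the cycles \<open>(r a \<dots>)\<close> and \<open>(a' b c)\<close> of \<open>s\<close>,
  joined by the new edge \<open>{a, a'}\<close>.
\<close>

locale contraction =
  fixes H' :: "'a set" and s' t' :: "'a \<Rightarrow> 'a" and r a a' :: 'a and s t :: "'a \<Rightarrow> 'a"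
  assumes s': "perm_on s' H'"
    and t': "\<And>d. d \<in> H' \<Longrightarrow> t' d \<in> H'" "\<And>d. d \<in> H' \<Longrightarrow> t' (t' d) = d"
    and r: "r \<in> H'" "t' r = r"
    and deg: "s' r \<noteq> r" "s' (s' r) \<noteq> r"
    and new: "a \<notin> H'" "a' \<notin> H'" "a \<noteq> a'"
    and s: "s r = a" "s a = s' (s' (s' r))" "s a' = s' r" "s (s' (s' r)) = a'"
      "\<And>d. d \<in> H' \<Longrightarrow> d \<noteq> r \<Longrightarrow> d \<noteq> s' (s' r) \<Longrightarrow> s d = s' d"
    and t: "t a = a'" "t a' = a" "\<And>d. d \<in> H' \<Longrightarrow> t d = t' d"
begin

abbreviation "b \<equiv> s' r"
abbreviation "c \<equiv> s' b"
abbreviation "H \<equiv> insert a' (insert a H')"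

lemma in_H' [simp]: "b \<in> H'" "c \<in> H'" "s' c \<in> H'" "r \<in> H'"
  using perm_onD(2)[OF s'] r by auto

lemma s'_eq: "x \<in> H' \<Longrightarrow> y \<in> H' \<Longrightarrow> s' x = s' y \<longleftrightarrow> x = y"
  using perm_onD(3)[OF s'] by metis

lemma distinct: "b \<noteq> c" "s' c \<noteq> b" "s' c \<noteq> c" "a \<noteq> r" "a' \<noteq> r" "a \<noteq> c" "a' \<noteq> c" "a \<noteq> b" "a' \<noteq> b"
  using s'_eq[of r b] s'_eq[of b c] s'_eq[of c r] deg new in_H' by metis+

lemma s_b: "s b = c"
  using s(5)[of b] deg distinct by simp

lemma perm_on_s: "perm_on s H"
proof (rule perm_on_surjI)
  show "finite H"
    using perm_onD(1)[OF s'] by simp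
  show "H \<subseteq> s ` H"
  proof
    fix y assume "y \<in> H"
    then consider "y = a" | "y = a'" | "y \<in> H'"
      by auto
    then show "y \<in> s ` H"
    proof cases
      case 3
      then obtain x where x: "x \<in> H'" "s' x = y"
        using perm_on_preimage[OF s'] by metis
      consider "x = r" | "x = c" | "x \<noteq> r" "x \<noteq> c"
        by auto
      then show ?thesis
      proof cases
        case 1
        then have "y = s a'"
          using x s by simp
        then show ?thesis by simp
      next
        case 2
        then have "y = s a"
          using x s by simp
        then show ?thesis by simp
      next
        case 3
        then have "y = s x"
          using x s by simp
        then show ?thesis using x by simp
      qed
    qed (use s(1,4) in \<open>auto simp: image_iff\<close>)
  qed
qed

lemma t_H: "d \<in> H \<Longrightarrow> t d \<in> H" "d \<in> H \<Longrightarrow> t (t d) = d"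
  using t t' by auto

lemma perm_on_t: "perm_on t H"
  using t_H perm_onD(1)[OF s'] by (intro perm_on_involution) simp_all

text \<open>The two sides of the new edge are visited right after \<open>r\<close> and right after
  the half-edge opposite to \<open>c\<close>. Deleting \<open>a'\<close> and \<open>a\<close> from
  the cycles of \<open>s \<circ> t\<close> gives \<open>s' \<circ> t'\<close>, and neither is a face
  of its own.\<close>

lemma num_orbits_faces: "num_orbits (s \<circ> t) H = num_orbits (s' \<circ> t') H'"
proof -
  let ?F = "s \<circ> t"
  have f: "perm_on ?F H"
    using perm_on_comp perm_on_s perm_on_t by blast
  have 1: "num_orbits (skip a' ?F) (insert a H') = num_orbits ?F H"
  proof (rule num_orbits_skip)
    show "a' \<notin> insert a H'"
      using new by auto
    have "?F a' = s' c"
      using s t by simp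
    then show "?F a' \<noteq> a'"
      using in_H'(3) new by metis
  qed (rule f)
  have f1: "perm_on (skip a' ?F) (insert a H')"
    using f new by (intro perm_on_skip) auto
  have Fa: "skip a' ?F a = b"
    using s t distinct by (simp add: skip_def)
  have 2: "num_orbits (skip a (skip a' ?F)) H' = num_orbits (skip a' ?F) (insert a H')"
    using f1 new distinct Fa by (intro num_orbits_skip) auto
  have "skip a (skip a' ?F) d = (s' \<circ> t') d" if "d \<in> H'" for d
  proof -
    consider "d = r" | "t' d = c" | "d \<noteq> r" "t' d \<noteq> c"
      by auto
    then show ?thesis
    proof cases
      case 1
      then have "skip a' ?F d = a"
        using t r s new by (simp add: skip_def)
      then show ?thesis
        using 1 Fa r by (simp add: skip_def[of a])
    next
      case 2
      then have "?F d = a'" "?F a' = s' c"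
        using t that s by auto
      then have "skip a' ?F d = s' c"
        by (simp add: skip_def)
      then show ?thesis
        using 2 new in_H'(3) by (auto simp: skip_def[of a])
    next
      case 3
      then have "t' d \<noteq> r"
        using t'(2)[OF that] r by auto
      then have "?F d = s' (t' d)"
        using 3 t(3)[OF that] s(5)[OF t'(1)[OF that]] by simp
      moreover have "s' (t' d) \<in> H'"
        using t'(1)[OF that] perm_onD(2)[OF s'] by simp
      ultimately show ?thesis
        using new by (auto simp: skip_def)
    qed
  qed
  moreover have "skip a (skip a' ?F) \<in> H' \<rightarrow> H'"
    using perm_on_skip[OF f1 new(1)] by (simp add: perm_on_def)
  ultimately have "num_orbits (s' \<circ> t') H' = num_orbits (skip a (skip a' ?F)) H'"
    by (metis num_orbits_cong)
  then show ?thesis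
    using 1 2 by simp
qed

lemma orbit_root: "orbit s r = insert a (orbit s' r - {b, c})"
proof (intro subset_antisym subsetI)
  fix y assume "y \<in> orbit s r"
  then show "y \<in> insert a (orbit s' r - {b, c})"
  proof induct
    case base
    then show ?case using s by simp
  next
    case (step y)
    consider "y = a" | "y = r" | "y \<in> orbit s' r" "y \<noteq> b" "y \<noteq> c" "y \<noteq> r"
      using step by auto
    then show ?case
    proof cases
      case 1
      then show ?thesis
        using s distinct orbit.step[OF orbit.step[OF orbit.base[of s' r]]] by simp
    next
      case 2
      then show ?thesis using s by simp
    next
      case 3
      then have "y \<in> H'"
        using orbit_subset_perm_on[OF s' r(1)] by auto
      then show ?thesis
        using 3 s(5)[of y] s'_eq[of y r] s'_eq[of y b] by (auto intro: orbit.step)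
    qed
  qed
next
  have a: "a \<in> orbit s r"
    using s(1) orbit.base[of s r] by simp
  have *: "y \<in> orbit s r \<union> {b, c}" if "y \<in> orbit s' r" for y
    using that
  proof induct
    case base
    then show ?case by simp
  next
    case (step y)
    consider "y = b" | "y = c" | "y = r" | "y \<in> orbit s r" "y \<noteq> c" "y \<noteq> r"
      using step by auto
    then show ?case
    proof cases
      case 2
      then show ?thesis
        using s(2) orbit.step[OF a] by simp
    next
      case 4
      then have "y \<in> H'"
        using step(1) orbit_subset_perm_on[OF s' r(1)] by auto
      then show ?thesis
        using 4 s(5)[of y] orbit.step[of y s r] by simp
    qed auto
  qed
  fix y assume "y \<in> insert a (orbit s' r - {b, c})"
  then show "y \<in> orbit s r"
    using * a by auto
qed

lemma card_orbit_root: "card (orbit s' r) = card (orbit s r) + 1"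
proof -
  have fin: "finite (orbit s' r)" and sub: "orbit s' r \<subseteq> H'"
    using finite_orbit self_in_orbit[OF s' r(1)] orbit_subset_perm_on[OF s' r(1)] by auto
  have bc: "{b, c} \<subseteq> orbit s' r"
    by (auto intro: orbit.intros)
  have "a \<notin> orbit s' r"
    using sub new by auto
  moreover have "card (orbit s' r) \<ge> card {b, c}"
    using bc fin by (intro card_mono)
  ultimately show ?thesis
    unfolding orbit_root using fin bc distinct by (simp add: card_Diff_subset)
qed

lemma orbit_new: "orbit s a' = {a', b, c}"
proof (intro subset_antisym subsetI)
  fix y assume "y \<in> orbit s a'"
  then show "y \<in> {a', b, c}"
    by induct (use s s_b in auto)
next
  have "b \<in> orbit s a'"
    using orbit.base[of s a'] s by simp
  then have "c \<in> orbit s a'"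
    using orbit.step[of b s a'] s_b by simp
  then have "a' \<in> orbit s a'"
    using orbit.step[of c s a'] s by simp
  then show "y \<in> orbit s a'" if "y \<in> {a', b, c}" for y
    using that \<open>b \<in> _\<close> \<open>c \<in> _\<close> by auto
qed

lemma orbit_other:
  assumes "d \<in> H'" "d \<notin> orbit s' r"
  shows "orbit s d = orbit s' d"
proof (rule orbit_cong)
  show "d \<in> orbit s' d"
    by (rule self_in_orbit[OF s' assms(1)])
  fix y assume y: "y \<in> orbit s' d"
  have "y \<notin> orbit s' r"
    using y orbit_eq[OF s' assms(1) y] orbit_eq[OF s' r(1), of y] \<open>d \<in> orbit s' d\<close> assms(2) by auto
  moreover have "y \<in> H'"
    using y orbit_subset_perm_on[OF s' assms(1)] by auto
  ultimately show "s y = s' y"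
    using s(5)[of y] self_in_orbit[OF s' r(1)] orbit.step[OF orbit.base[of s' r]] by metis
qed

text \<open>Contracting maps both new half-edges to \<open>r\<close>, which sends steps to paths.
  Conversely only the steps from \<open>r\<close> to \<open>b\<close> and from \<open>c\<close> to
  \<open>s' c\<close> are broken by the expansion, and each has a detour through the new
  edge.\<close>

lemma connected_iff:
  "(\<forall>d\<in>H. (r, d) \<in> conn H s t) \<longleftrightarrow> (\<forall>d\<in>H'. (r, d) \<in> conn H' s' t')"
proof
  assume L: "\<forall>d\<in>H. (r, d) \<in> conn H s t"
  define p where "p = (\<lambda>d. if d \<in> H' then d else r)"
  have p: "p d = d" if "d \<in> H'" for d
    using that by (simp add: p_def)
  have pa: "p a = r" "p a' = r"
    using new by (simp_all add: p_def)
  have rb: "(r, b) \<in> conn H' s' t'" and bc: "(b, c) \<in> conn H' s' t'" and cs: "(c, s' c) \<in> conn H' s' t'"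
    by (simp_all add: conn_step)
  show "\<forall>d\<in>H'. (r, d) \<in> conn H' s' t'"
  proof
    fix d assume "d \<in> H'"
    have "(p r, p d) \<in> conn H' s' t'"
    proof (rule conn_map[where p = p])
      show "(r, d) \<in> conn H s t"
        using L \<open>d \<in> H'\<close> by simp
      fix e assume "e \<in> H"
      then consider "e = a" | "e = a'" | "e \<in> H'"
        by auto
      note cases = this
      from cases show "(p e, p (t e)) \<in> conn H' s' t'"
        by cases (simp_all add: t pa p t' conn_step)
      consider "e = a" | "e = a'" | "e = r" | "e = c" | "e \<in> H'" "e \<noteq> r" "e \<noteq> c"
        using cases by blast
      then show "(p e, p (s e)) \<in> conn H' s' t'"
      proof cases
        case 1
        then show ?thesis
          using rb bc cs by (simp add: s p pa) (metis conn_trans)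
      next
        case 4
        then show ?thesis
          using rb bc by (simp add: s p pa) (metis conn_trans conn_sym)
      next
        case 5
        then show ?thesis
          using perm_onD(2)[OF s', of e] by (simp add: s(5) p conn_step)
      qed (use rb in \<open>simp_all add: s p pa\<close>)
    qed
    then show "(r, d) \<in> conn H' s' t'"
      using \<open>d \<in> H'\<close> by (simp add: p)
  qed
next
  assume R: "\<forall>d\<in>H'. (r, d) \<in> conn H' s' t'"
  have ra: "(r, a) \<in> conn H s t" and aa: "(a, a') \<in> conn H s t" and ab: "(a', b) \<in> conn H s t"
    and ca: "(c, a') \<in> conn H s t" and as: "(a, s' c) \<in> conn H s t"
    using conn_step(1)[of r H s t] conn_step(2)[of a H t s] conn_step(1)[of a' H s t]
      conn_step(1)[of c H s t] conn_step(1)[of a H s t] by (simp_all add: s t)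
  have *: "(r, d) \<in> conn H s t" if "d \<in> H'" for d
  proof (rule conn_sub)
    show "(r, d) \<in> conn H' s' t'"
      using R that by simp
    fix e assume e: "e \<in> H'"
    show "(e, t' e) \<in> conn H s t"
      using e conn_step(2)[of e H t s] by (simp add: t)
    consider "e = r" | "e = c" | "e \<noteq> r" "e \<noteq> c"
      by blast
    then show "(e, s' e) \<in> conn H s t"
    proof cases
      case 1
      then show ?thesis using ra aa ab by (metis conn_trans)
    next
      case 2
      then show ?thesis using ca aa as by (metis conn_trans conn_sym)
    next
      case 3
      then show ?thesis
        using e conn_step(1)[of e H s t] by (simp add: s(5))
    qed
  qed
  show "\<forall>d\<in>H. (r, d) \<in> conn H s t"
    using * ra aa by (auto intro: conn_trans)
qed

end

text \<open>
  The cycles \<open>(a x\<^sub>1 \<dots>)\<close> and \<open>(r y\<^sub>1 \<dots>)\<close> of \<open>s0\<close> are merged into the cycle \<open>(r a x\<^sub>1 \<dots> a' y\<^sub>1 \<dots>)\<close>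
  of \<open>s\<close>, and the legs \<open>a\<close> and \<open>a'\<close> become a loop; the leg \<open>r\<close> stays.
\<close>

locale loop_insertion =
  fixes H0 :: "'a set" and s0 t0 :: "'a \<Rightarrow> 'a" and a r a' :: 'a and s t :: "'a \<Rightarrow> 'a"
  assumes s0: "perm_on s0 H0"
    and t0: "\<And>d. d \<in> H0 \<Longrightarrow> t0 d \<in> H0" "\<And>d. d \<in> H0 \<Longrightarrow> t0 (t0 d) = d"
    and ar: "a \<in> H0" "t0 a = a" "r \<in> H0" "t0 r = r" "a \<noteq> r"
    and new: "a' \<notin> H0"
    and s: "s r = a" "s a' = s0 r"
      "\<And>d. d \<in> H0 \<Longrightarrow> d \<noteq> r \<Longrightarrow> s d = (if s0 d = a then a' else s0 d)"
    and s0_root: "s0 r \<noteq> a"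
    and t: "t a = a'" "t a' = a" "\<And>d. d \<in> H0 \<Longrightarrow> d \<noteq> a \<Longrightarrow> t d = t0 d"
begin

abbreviation "H \<equiv> insert a' H0"

lemma neq: "a' \<noteq> a" "a' \<noteq> r"
  using new ar by auto

lemma perm_on_s: "perm_on s H"
proof (rule perm_on_surjI)
  show "finite H"
    using perm_onD(1)[OF s0] by simp
  show "H \<subseteq> s ` H"
  proof
    fix y assume "y \<in> H"
    then consider "y = a" | "y = a'" | "y \<in> H0" "y \<noteq> a"
      by auto
    then show "y \<in> s ` H"
    proof cases
      case 1
      then show ?thesis using s(1) ar by (auto simp: image_iff)
    next
      case 2
      obtain x where x: "x \<in> H0" "s0 x = a"
        using perm_on_preimage[OF s0 ar(1)] .
      then have "s x = a'"
        using s(3)[of x] s0_root by auto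
      then show ?thesis using 2 x by auto
    next
      case 3
      obtain x where x: "x \<in> H0" "s0 x = y"
        using perm_on_preimage[OF s0 3(1)] .
      show ?thesis
      proof (cases "x = r")
        case True
        then have "y = s a'"
          using x s by simp
        then show ?thesis by simp
      next
        case False
        then have "y = s x"
          using x s(3)[of x] 3 by simp
        then show ?thesis using x by simp
      qed
    qed
  qed
qed

lemma t_H: "d \<in> H \<Longrightarrow> t d \<in> H" "d \<in> H \<Longrightarrow> t (t d) = d"
proof -
  have "t0 d \<noteq> a" if "d \<in> H0" "d \<noteq> a" for d
    using t0(2)[OF that(1)] ar that by auto
  then show "d \<in> H \<Longrightarrow> t d \<in> H" "d \<in> H \<Longrightarrow> t (t d) = d"
    using t t0 ar by (cases "d = a"; auto)+
qed

lemma perm_on_t: "perm_on t H"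
  using t_H perm_onD(1)[OF s0] by (intro perm_on_involution) simp_all

text \<open>The fixed point \<open>a\<close> becomes the 2-cycle of \<open>a\<close> and
  \<open>a'\<close>, one orbit in place of one.\<close>

lemma num_orbits_t: "num_orbits t0 H0 = num_orbits t H"
proof -
  have "skip a' t d = t0 d" if "d \<in> H0" for d
  proof (cases "d = a")
    case False
    then show ?thesis
      using that t(3)[of d] t0(1)[of d] new by (auto simp: skip_def)
  qed (use t ar in \<open>simp add: skip_def\<close>)
  then have "num_orbits t0 H0 = num_orbits (skip a' t) H0"
    using t0(1) by (intro num_orbits_cong) auto
  also have "\<dots> = num_orbits t H"
    using perm_on_t new t neq by (intro num_orbits_skip) auto
  finally show ?thesis .
qed

text \<open>The face permutation of the map with the loop sends \<open>r\<close> to \<open>a\<close>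
  and \<open>a\<close> to \<open>s0 r\<close>; once \<open>a\<close> is skipped, \<open>r\<close>
  goes to \<open>s0 r\<close> as it did at the leg. The other half \<open>a'\<close> of the loop
  takes over the place of the leg \<open>a\<close>, which is the renaming \<open>g\<close>.\<close>

lemma faces_conj:
  defines "g \<equiv> id(a := a')"
  assumes "y \<in> H0"
  shows "skip a (s \<circ> t) (g y) = g ((s0 \<circ> t0) y)"
proof -
  consider "y = a" | "y = r" | "y \<noteq> a" "y \<noteq> r"
    by blast
  then show ?thesis
  proof cases
    case 1
    then show ?thesis
      using s(3)[of a] ar neq by (simp add: g_def skip_def t)
  next
    case 2
    then show ?thesis
      using ar s s0_root by (simp add: g_def skip_def t)
  next
    case 3
    then have "t0 y \<noteq> r" "t0 y \<in> H0"
      using t0[OF assms(2)] ar by auto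
    then have "s (t y) = g (s0 (t0 y))" "g (s0 (t0 y)) \<noteq> a"
      using s(3)[of "t0 y"] 3 t(3)[OF assms(2)] neq by (auto simp: g_def)
    then show ?thesis
      using 3 by (simp add: g_def skip_def)
  qed
qed

lemma num_orbits_faces: "num_orbits (s \<circ> t) H = num_orbits (s0 \<circ> t0) H0"
proof -
  let ?g = "id(a := a')"
  have t0': "perm_on t0 H0"
    using t0 perm_onD(1)[OF s0] by (intro perm_on_involution) auto
  have f0: "perm_on (s0 \<circ> t0) H0"
    using perm_on_comp s0 t0' by blast
  have f: "perm_on (s \<circ> t) H"
    using perm_on_comp perm_on_s perm_on_t by blast
  have inj: "inj_on ?g H0"
    using new by (auto simp: inj_on_def)
  have img: "insert a (?g ` H0) = H"
    using ar by (auto simp: image_iff)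
  have "num_orbits (skip a (s \<circ> t)) (?g ` H0) = num_orbits (s0 \<circ> t0) H0"
    by (rule num_orbits_image[OF f0 inj]) (rule faces_conj[symmetric])
  moreover have "num_orbits (skip a (s \<circ> t)) (?g ` H0) = num_orbits (s \<circ> t) (insert a (?g ` H0))"
  proof (rule num_orbits_skip)
    show "perm_on (s \<circ> t) (insert a (?g ` H0))"
      unfolding img by (rule f)
    show "a \<notin> ?g ` H0"
      using neq by auto
    show "(s \<circ> t) a \<noteq> a"
      using s t s0_root by simp
  qed
  ultimately show ?thesis
    unfolding img by simp
qed

text \<open>
  If \<open>a\<close> were on the \<open>s0\<close>-cycle of \<open>r\<close>, the stretch of that cycle strictly between \<open>r\<close> and \<open>a\<close>
  would be closed up by \<open>a'\<close> to an \<open>s\<close>-cycle missing \<open>r\<close>.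
\<close>

lemma separated:
  assumes "r \<in> orbit s a'"
  shows "a \<notin> orbit s0 r"
proof
  assume "a \<in> orbit s0 r"
  then obtain k where k: "0 < k" "(s0 ^^ k) r = a"
    by (auto simp: orbit_altdef)
  define m where "m = (LEAST k. 0 < k \<and> (s0 ^^ k) r = a)"
  have m: "0 < m" "(s0 ^^ m) r = a"
    using LeastI[of "\<lambda>k. 0 < k \<and> (s0 ^^ k) r = a" k] k by (auto simp: m_def)
  have least: "(s0 ^^ j) r \<noteq> a" if "0 < j" "j < m" for j
    using not_less_Least[of j "\<lambda>k. 0 < k \<and> (s0 ^^ k) r = a"] that by (auto simp: m_def)
  \<comment> \<open>A return to \<open>r\<close> after \<open>j\<close> steps would put
    \<open>a\<close> already at step \<open>m - j\<close>, against minimality of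
    \<open>m\<close>.\<close>
  have not_r: "(s0 ^^ j) r \<noteq> r" if "0 < j" "j < m" for j
  proof
    assume "(s0 ^^ j) r = r"
    then have "(s0 ^^ (m - j)) r = (s0 ^^ (m - j)) ((s0 ^^ j) r)"
      by simp
    also have "\<dots> = (s0 ^^ (m - j + j)) r"
      by (simp only: funpow_add comp_apply)
    also have "\<dots> = a"
      using m that by simp
    finally show False
      using least[of "m - j"] m that by simp
  qed
  have "m \<noteq> 1"
    using m s0_root by auto
  define X where "X = insert a' ((\<lambda>j. (s0 ^^ j) r) ` {0<..<m})"
  have H0: "(s0 ^^ j) r \<in> H0" for j
    by (induct j) (use ar perm_onD(2)[OF s0] in auto)
  have "s \<in> X \<rightarrow> X"
  proof
    fix x assume "x \<in> X"
    then consider "x = a'" | j where "0 < j" "j < m" "x = (s0 ^^ j) r"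
      unfolding X_def by auto
    then show "s x \<in> X"
    proof cases
      case 1
      have "s0 r = (s0 ^^ 1) r"
        by simp
      moreover have "1 \<in> {0<..<m}"
        using m \<open>m \<noteq> 1\<close> by simp
      ultimately have "s0 r \<in> X"
        unfolding X_def by blast
      then show ?thesis
        using 1 s by simp
    next
      case 2
      have sx: "s x = (if (s0 ^^ Suc j) r = a then a' else (s0 ^^ Suc j) r)"
        using s(3)[OF H0[of j]] not_r[OF 2(1,2)] 2(3) by simp
      show ?thesis
      proof (cases "Suc j = m")
        case True
        then show ?thesis
          using sx m by (simp add: X_def)
      next
        case False
        then have "Suc j \<in> {0<..<m}"
          using 2 by simp
        then have "(s0 ^^ Suc j) r \<in> X"
          unfolding X_def by (intro insertI2 imageI)
        then show ?thesis
          unfolding sx by (simp add: X_def)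
      qed
    qed
  qed
  then have "orbit s a' \<subseteq> X"
    by (rule orbit_subset_closed) (simp add: X_def)
  moreover have "r \<notin> X"
    unfolding X_def using not_r neq by (auto simp: image_iff) (metis)
  ultimately show False
    using assms by blast
qed

lemma orbit_other:
  assumes "d \<in> H0" "d \<notin> orbit s0 a" "d \<notin> orbit s0 r"
  shows "orbit s d = orbit s0 d"
proof (rule orbit_cong)
  show d: "d \<in> orbit s0 d"
    by (rule self_in_orbit[OF s0 assms(1)])
  fix y assume y: "y \<in> orbit s0 d"
  have eq: "orbit s0 y = orbit s0 d"
    by (rule orbit_eq[OF s0 assms(1) y])
  have "y \<in> H0"
    using y orbit_subset_perm_on[OF s0 assms(1)] by auto
  moreover have "y \<noteq> r"
    using eq d assms by auto
  moreover have "s0 y \<noteq> a"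
    using eq d assms(2) orbit_eq[OF s0 \<open>y \<in> H0\<close> orbit.base] by auto
  ultimately show "s y = s0 y"
    using s(3)[of y] by simp
qed

lemma orbit_root:
  assumes sep: "a \<notin> orbit s0 r"
  shows "orbit s r = insert a' (orbit s0 a \<union> orbit s0 r)"
proof (rule subset_antisym)
  let ?S = "insert a' (orbit s0 a \<union> orbit s0 r)"
  have self: "a \<in> orbit s0 a" "r \<in> orbit s0 r"
    using self_in_orbit[OF s0] ar by auto
  have sub: "orbit s0 a \<subseteq> H0" "orbit s0 r \<subseteq> H0"
    using orbit_subset_perm_on[OF s0] ar by auto
  have "s \<in> ?S \<rightarrow> ?S"
  proof
    fix x assume "x \<in> ?S"
    then consider "x = r" | "x = a'" | "x \<in> orbit s0 a \<union> orbit s0 r" "x \<in> H0" "x \<noteq> r"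
      using sub by auto
    then show "s x \<in> ?S"
    proof cases
      case 3
      then show ?thesis
        using s(3)[of x] by (auto intro: orbit.step)
    qed (use s self orbit.base[of s0 r] in simp_all)
  qed
  then show "orbit s r \<subseteq> ?S"
    by (rule orbit_subset_closed) (simp add: self)
  have a: "a \<in> orbit s r"
    using s(1) orbit.base[of s r] by simp
  have r: "r \<notin> orbit s0 a"
    using sep self orbit_eq[OF s0 ar(1), of r] by auto
  have s0_step: "s0 y \<in> orbit s r" if "y \<in> orbit s r" "y \<in> H0" "y \<noteq> r" for y
    using s(3)[OF that(2,3)] orbit.step[OF that(1)] a by (cases "s0 y = a") simp_all
  have Oa: "orbit s0 a \<subseteq> orbit s r"
  proof
    fix y assume "y \<in> orbit s0 a"
    then show "y \<in> orbit s r"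
    proof induct
      case base
      show ?case using s0_step[OF a] ar by simp
    next
      case (step y)
      then show ?case using s0_step[of y] sub r by blast
    qed
  qed
  obtain p where p: "p \<in> H0" "s0 p = a"
    using perm_on_preimage[OF s0 ar(1)] .
  then have "p \<in> orbit s0 a"
    using orbit_eq[OF s0 p(1), of a] orbit.base[of s0 p] self_in_orbit[OF s0 p(1)] by simp
  then have "p \<in> orbit s r" "p \<noteq> r"
    using Oa r by auto
  then have a': "a' \<in> orbit s r"
    using s(3)[OF p(1)] p(2) orbit.step[of p s r] by simp
  have base: "s0 r \<in> orbit s r"
    using s(2) orbit.step[OF a'] by simp
  have "orbit s0 r \<subseteq> orbit s r"
  proof
    fix y assume "y \<in> orbit s0 r"
    then show "y \<in> orbit s r"
    proof induct
      case (step y)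
      show ?case
      proof (cases "y = r")
        case True
        then show ?thesis using base by simp
      next
        case False
        then show ?thesis using s0_step[of y] step sub by blast
      qed
    qed (rule base)
  qed
  then show "?S \<subseteq> orbit s r"
    using Oa a' by simp
qed

lemma card_orbit_root:
  assumes sep: "a \<notin> orbit s0 r"
  shows "card (orbit s r) = 1 + card (orbit s0 a) + card (orbit s0 r)"
proof -
  have sub: "orbit s0 a \<subseteq> H0" "orbit s0 r \<subseteq> H0"
    using orbit_subset_perm_on[OF s0] ar by auto
  then have "finite (orbit s0 a)" "finite (orbit s0 r)"
    using perm_onD(1)[OF s0] finite_subset by auto
  moreover have "orbit s0 a \<inter> orbit s0 r = {}"
    using orbit_disjoint[OF s0 ar(3,1) sep] by blast
  ultimately show ?thesis
    unfolding orbit_root[OF sep] using sub new by (subst card_insert_disjoint) (auto simp: card_Un_disjoint)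
qed

lemma num_orbits_s:
  assumes sep: "a \<notin> orbit s0 r"
  shows "num_orbits s0 H0 = num_orbits s H + 1"
proof -
  let ?O = "\<lambda>f. orbit f ` (H0 - orbit s0 a - orbit s0 r)"
  have self: "a \<in> orbit s0 a" "r \<in> orbit s0 r"
    using self_in_orbit[OF s0] ar by auto
  have sub: "orbit s0 a \<subseteq> H0" "orbit s0 r \<subseteq> H0"
    using orbit_subset_perm_on[OF s0] ar by auto
  have "?O s = ?O s0"
    using orbit_other by (intro image_cong) auto
  have "orbit s ` H = ?O s \<union> {orbit s r}"
  proof -
    have "H = (H0 - orbit s0 a - orbit s0 r) \<union> orbit s r"
      unfolding orbit_root[OF sep] using sub by blast
    moreover have "orbit s ` orbit s r = {orbit s r}"
    proof -
      have "orbit s y = orbit s r" if "y \<in> orbit s r" for y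
        using orbit_eq[OF perm_on_s _ that] ar by simp
      then show ?thesis
        using orbit_nonempty[of s r] by auto
    qed
    ultimately show ?thesis
      by (metis image_Un)
  qed
  moreover have "orbit s0 ` H0 = ?O s0 \<union> {orbit s0 a, orbit s0 r}"
  proof -
    have *: "orbit s0 ` orbit s0 x = {orbit s0 x}" if "x \<in> H0" for x
    proof -
      have "orbit s0 y = orbit s0 x" if "y \<in> orbit s0 x" for y
        using orbit_eq[OF s0 \<open>x \<in> H0\<close> that] .
      then show ?thesis
        using orbit_nonempty[of s0 x] by auto
    qed
    have "H0 = (H0 - orbit s0 a - orbit s0 r) \<union> (orbit s0 a \<union> orbit s0 r)"
      using sub by blast
    then have "orbit s0 ` H0 = ?O s0 \<union> (orbit s0 ` orbit s0 a \<union> orbit s0 ` orbit s0 r)"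
      by (metis image_Un)
    then show ?thesis
      unfolding *[OF ar(1)] *[OF ar(3)] by blast
  qed
  moreover have "orbit s r \<notin> ?O s0" "orbit s0 a \<notin> ?O s0" "orbit s0 r \<notin> ?O s0"
  proof -
    show "orbit s r \<notin> ?O s0"
      using orbit_subset_perm_on[OF s0] new unfolding orbit_root[OF sep] by blast
    show "orbit s0 a \<notin> ?O s0" "orbit s0 r \<notin> ?O s0"
      using self_in_orbit[OF s0] by blast+
  qed
  moreover have "orbit s0 a \<noteq> orbit s0 r"
    using sep self by auto
  moreover have "finite (?O s0)"
    using perm_onD(1)[OF s0] by simp
  ultimately show ?thesis
    unfolding num_orbits_def by (simp add: \<open>?O s = ?O s0\<close> card_insert_if)
qed

text \<open>If \<open>a\<close> and \<open>r\<close> are connected without the loop, then renaming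
  \<open>a'\<close> to \<open>a\<close> turns every path into one that avoids the loop. This serves
  to refute the connectedness of \<open>a\<close> and \<open>r\<close> in the planar case.\<close>

lemma conn_collapse:
  assumes "(x, y) \<in> conn H s t" "(a, r) \<in> conn H0 s0 t0"
  shows "((id(a' := a)) x, (id(a' := a)) y) \<in> conn H0 s0 t0"
proof (rule conn_map[OF assms(1)])
  let ?p = "id(a' := a)"
  have ra: "(r, a) \<in> conn H0 s0 t0"
    using conn_sym[OF assms(2)] .
  fix d assume "d \<in> H"
  then consider "d = a'" | "d = r" | "d \<in> H0" "d \<noteq> r" "d \<noteq> a'"
    using new by auto
  then show "(?p d, ?p (s d)) \<in> conn H0 s0 t0"
  proof cases
    case 1
    then show ?thesis
      using conn_trans[OF assms(2) conn_step(1)[OF ar(3), of s0 t0]] perm_onD(2)[OF s0 ar(3)] s neq new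
      by (cases "s0 r = a'") simp_all
  next
    case 2
    then show ?thesis
      using ra s neq by simp
  next
    case 3
    then show ?thesis
      using conn_step(1)[OF 3(1), of s0 t0] s(3)[of d] perm_onD(2)[OF s0 3(1)] new by auto
  qed
  from \<open>d \<in> H\<close> consider "d = a'" | "d = a" | "d \<in> H0" "d \<noteq> a" "d \<noteq> a'"
    using new by auto
  then show "(?p d, ?p (t d)) \<in> conn H0 s0 t0"
  proof cases
    case 3
    then show ?thesis
      using conn_step(2)[OF 3(1), of t0 s0] t(3)[of d] t0(1)[of d] new by auto
  qed (use t neq in simp_all)
qed

text \<open>Being connected to \<open>a\<close> or to \<open>r\<close> is preserved by every step
  inside \<open>H0\<close>, and the steps that involve the loop lead only between points with this
  property, up to renaming \<open>a'\<close> to \<open>a\<close>. So removing the loop leaves at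
  most two components.\<close>

lemma conn_two:
  assumes "(r, d) \<in> conn H s t" "d \<in> H0"
  shows "(a, d) \<in> conn H0 s0 t0 \<or> (r, d) \<in> conn H0 s0 t0"
proof -
  let ?p = "id(a' := a)"
  define Q where "Q x \<longleftrightarrow> (a, x) \<in> conn H0 s0 t0 \<or> (r, x) \<in> conn H0 s0 t0" for x
  have Q: "Q a" "Q r"
    by (simp_all add: Q_def)
  have Q_conn: "Q x \<longleftrightarrow> Q y" if "(x, y) \<in> conn H0 s0 t0" for x y
    using that unfolding Q_def by (metis conn_sym conn_trans)
  have "Q (?p r) \<longleftrightarrow> Q (?p d)"
  proof (rule conn_invariant[OF assms(1)])
    fix d assume "d \<in> H"
    then consider "d = a'" | "d = r" | "d \<in> H0" "d \<noteq> r" "d \<noteq> a'"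
      using new by auto
    then show "Q (?p d) \<longleftrightarrow> Q (?p (s d))"
    proof cases
      case 1
      then show ?thesis
        using Q Q_conn[OF conn_step(1)[OF ar(3), of s0 t0]] perm_onD(2)[OF s0 ar(3)] s neq new
        by (cases "s0 r = a'") simp_all
    next
      case 2
      then show ?thesis
        using Q s neq by simp
    next
      case 3
      then show ?thesis
        using Q Q_conn[OF conn_step(1)[OF 3(1), of s0 t0]] s(3)[of d] perm_onD(2)[OF s0 3(1)] new by auto
    qed
    from \<open>d \<in> H\<close> consider "d = a'" | "d = a" | "d \<in> H0" "d \<noteq> a" "d \<noteq> a'"
      using new by auto
    then show "Q (?p d) \<longleftrightarrow> Q (?p (t d))"
    proof cases
      case 3
      then show ?thesis
        using Q_conn[OF conn_step(2)[OF 3(1), of t0 s0]] t(3)[of d] t0(1)[of d] new by auto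
    qed (use t neq in simp_all)
  qed
  then show ?thesis
    using assms(2) neq Q new unfolding Q_def by (cases "d = a'") simp_all
qed

lemma conn_lift:
  assumes "(x, y) \<in> conn H0 s0 t0"
  shows "(x, y) \<in> conn H s t"
proof (rule conn_sub[OF assms])
  have ra: "(r, a) \<in> conn H s t" and aa: "(a, a') \<in> conn H s t" and ar0: "(a', s0 r) \<in> conn H s t"
    using conn_step(1)[of r H s t] conn_step(2)[of a H t s] conn_step(1)[of a' H s t] s t ar by simp_all
  fix d assume d: "d \<in> H0"
  show "(d, t0 d) \<in> conn H s t"
    using conn_step(2)[of d H t s] d t(3)[of d] ar by (cases "d = a") simp_all
  have ds: "(d, s d) \<in> conn H s t"
    using conn_step(1)[of d H s t] d by simp
  consider "d = r" | "d \<noteq> r" "s0 d = a" | "d \<noteq> r" "s0 d \<noteq> a"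
    by blast
  then show "(d, s0 d) \<in> conn H s t"
  proof cases
    case 1
    then show ?thesis using ra aa ar0 conn_trans by metis
  next
    case 2
    then have "(d, a') \<in> conn H s t"
      using ds s(3)[OF d] by simp
    then show ?thesis using 2 conn_sym[OF aa] conn_trans by metis
  next
    case 3
    then show ?thesis using ds s(3)[OF d] by simp
  qed
qed

lemma connected_lift:
  assumes "\<And>d. d \<in> H0 \<Longrightarrow> (a, d) \<in> conn H0 s0 t0 \<or> (r, d) \<in> conn H0 s0 t0"
  shows "\<forall>d\<in>H. (r, d) \<in> conn H s t"
proof
  have ra: "(r, a) \<in> conn H s t" and aa: "(a, a') \<in> conn H s t"
    using conn_step(1)[of r H s t] conn_step(2)[of a H t s] s t ar by simp_all
  fix d assume "d \<in> H"
  then show "(r, d) \<in> conn H s t"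
    using assms[of d] conn_lift[of _ d] ra aa conn_trans by (metis insertE)
qed

end

section \<open>Maps with one leg\<close>

text \<open>
  There are \<open>n + 1\<close> vertices and \<open>(p + 3 * n + 2) / 2\<close> orbits of \<open>opp\<close>, so the condition on the number
  of faces is Euler's formula for genus 0.
\<close>

definition leg_map :: "nat \<Rightarrow> nat \<Rightarrow> 'a rmap \<Rightarrow> bool" where
  "leg_map p n M \<longleftrightarrow>
     perm_on (rot M) (half_edges M) \<and>
     (\<forall>d\<in>half_edges M. opp M d \<in> half_edges M \<and> opp M (opp M d) = d) \<and>
     root M \<in> half_edges M \<and>
     (\<forall>d\<in>half_edges M. opp M d = d \<longleftrightarrow> d = root M) \<and>
     (\<forall>d\<in>half_edges M. (root M, d) \<in> conn (half_edges M) (rot M) (opp M)) \<and>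
     card (orbit (rot M) (root M)) = p + 1 \<and>
     (\<forall>d\<in>half_edges M - orbit (rot M) (root M). card (orbit (rot M) d) = 3) \<and>
     card (half_edges M) = p + 1 + 3 * n \<and>
     2 * num_orbits (rot M \<circ> opp M) (half_edges M) = p + n + 2"

text \<open>A relation rather than a function: read from \<open>M'\<close> to \<open>M\<close> it
  leaves the names of the two new half-edges free.\<close>

definition contracts :: "'a rmap \<Rightarrow> 'a rmap \<Rightarrow> bool" where
  "contracts M M' \<longleftrightarrow> (\<exists>a a'. half_edges M = insert a' (insert a (half_edges M')) \<and> root M = root M' \<and>
     contraction (half_edges M') (rot M') (opp M') (root M') a a' (rot M) (opp M))"

definition connected_rmap :: "'a rmap \<Rightarrow> bool" where
  "connected_rmap M \<longleftrightarrow> perm_on (rot M) (half_edges M) \<and>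
     (\<forall>d\<in>half_edges M. opp M d \<in> half_edges M) \<and>
     (\<forall>d\<in>half_edges M. (root M, d) \<in> conn (half_edges M) (rot M) (opp M))"

text \<open>The parts are required to be connected so that they can be recovered from
  \<open>M\<close>, as the components of the two roots after removal of the loop. \<open>s0\<close>
  and \<open>t0\<close> glue the permutations of the two parts, whose values off their carriers are
  arbitrary.\<close>

definition splits :: "'a rmap \<Rightarrow> 'a rmap \<Rightarrow> 'a rmap \<Rightarrow> bool" where
  "splits M M1 M2 \<longleftrightarrow> (\<exists>s0 t0 a'.
     half_edges M = insert a' (half_edges M1 \<union> half_edges M2) \<and> root M = root M2 \<and>
     half_edges M1 \<inter> half_edges M2 = {} \<and>
     root M1 \<in> half_edges M1 \<and> root M2 \<in> half_edges M2 \<and>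
     connected_rmap M1 \<and> connected_rmap M2 \<and>
     (\<forall>d\<in>half_edges M1. s0 d = rot M1 d \<and> t0 d = opp M1 d) \<and>
     (\<forall>d\<in>half_edges M2. s0 d = rot M2 d \<and> t0 d = opp M2 d) \<and>
     loop_insertion (half_edges M1 \<union> half_edges M2) s0 t0 (root M1) (root M2) a' (rot M) (opp M))"

section \<open>Parameters under contraction and splitting\<close>

lemma leg_map_connected_rmap: "leg_map p n M \<Longrightarrow> connected_rmap M"
  by (simp add: leg_map_def connected_rmap_def)

lemma contracts_up:
  assumes "contracts M M'" "leg_map (Suc p) n M'"
  shows "leg_map p (Suc n) M"
proof -
  obtain a a' where H: "half_edges M = insert a' (insert a (half_edges M'))" and rM: "root M = root M'"
    and "contraction (half_edges M') (rot M') (opp M') (root M') a a' (rot M) (opp M)"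
    using assms(1) unfolding contracts_def by blast
  then interpret contraction "half_edges M'" "rot M'" "opp M'" "root M'" a a' "rot M" "opp M"
    by simp
  note L = assms(2)[unfolded leg_map_def]
  show ?thesis
    unfolding leg_map_def H rM
  proof (intro conjI)
    show "perm_on (rot M) H"
      by (rule perm_on_s)
    show "\<forall>d\<in>H. opp M d \<in> H \<and> opp M (opp M d) = d"
      using t_H by blast
    show "root M' \<in> H"
      using r by simp
    show "\<forall>d\<in>H. opp M d = d \<longleftrightarrow> d = root M'"
      using L t new distinct by auto
    show "\<forall>d\<in>H. (root M', d) \<in> conn H (rot M) (opp M)"
      unfolding connected_iff using L by blast
    show "card (orbit (rot M) (root M')) = p + 1"
      using card_orbit_root L by simp
    show "\<forall>d\<in>H - orbit (rot M) (root M'). card (orbit (rot M) d) = 3"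
    proof
      fix d assume d: "d \<in> H - orbit (rot M) (root M')"
      consider "d \<in> {a', b, c}" | "d \<in> half_edges M'" "d \<notin> orbit (rot M') (root M')"
        using d unfolding orbit_root by blast
      then show "card (orbit (rot M) d) = 3"
      proof cases
        case 1
        then have "d \<in> orbit (rot M) a'"
          by (simp add: orbit_new)
        then have "orbit (rot M) d = {a', b, c}"
          using orbit_eq[OF perm_on_s, of a'] orbit_new by simp
        then show ?thesis
          using distinct by simp
      next
        case 2
        then show ?thesis
          using orbit_other L by simp
      qed
    qed
    show "card H = p + 1 + 3 * Suc n"
      using L new perm_onD(1)[OF s'] by simp
    show "2 * num_orbits (rot M \<circ> opp M) H = p + Suc n + 2"
      using L num_orbits_faces by simp
  qed
qed

text \<open>\<open>n\<close> is positive because the far end of the contracted edge sits at the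
  vertex of \<open>a'\<close>, \<open>b\<close> and \<open>c\<close>, which is off the root vertex
  and leaves room for at least three more half-edges.\<close>

lemma contracts_down:
  assumes "contracts M M'" "leg_map p n M"
  obtains n' where "n = Suc n'" "leg_map (Suc p) n' M'"
proof -
  obtain a a' where H: "half_edges M = insert a' (insert a (half_edges M'))" and rM: "root M = root M'"
    and "contraction (half_edges M') (rot M') (opp M') (root M') a a' (rot M) (opp M)"
    using assms(1) unfolding contracts_def by blast
  then interpret contraction "half_edges M'" "rot M'" "opp M'" "root M'" a a' "rot M" "opp M"
    by simp
  note L = assms(2)[unfolded leg_map_def H rM]
  have fin: "finite (half_edges M')"
    using perm_onD(1)[OF s'] .
  have "{a', b, c} \<inter> orbit (rot M) (root M') = {}"
    unfolding orbit_root using orbit_subset_perm_on[OF s' r(1)] new distinct by auto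
  moreover have sub: "orbit (rot M) (root M') \<subseteq> H"
    using orbit_subset_perm_on[OF perm_on_s, of "root M'"] by simp
  moreover have "finite (orbit (rot M) (root M'))"
    using finite_subset[OF sub] fin by simp
  moreover have "card ({a', b, c} \<union> orbit (rot M) (root M')) \<le> card H"
    using fin sub by (intro card_mono) simp_all
  ultimately have "card {a', b, c} + card (orbit (rot M) (root M')) \<le> card H"
    by (subst (asm) card_Un_disjoint) simp_all
  moreover have "card {a', b, c} = 3"
    using distinct by simp
  moreover have "card H = p + 1 + 3 * n" "card (orbit (rot M) (root M')) = p + 1"
    using L by blast+
  ultimately have "n \<noteq> 0"
    by linarith
  then obtain n' where n': "n = Suc n'"
    using not0_implies_Suc by blast
  have "leg_map (Suc p) n' M'"
    unfolding leg_map_def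
  proof (intro conjI)
    show "perm_on (rot M') (half_edges M')" "root M' \<in> half_edges M'"
      using s' r by auto
    show "\<forall>d\<in>half_edges M'. opp M' d \<in> half_edges M' \<and> opp M' (opp M' d) = d"
      using t' by blast
    show "\<forall>d\<in>half_edges M'. (opp M' d = d) = (d = root M')"
      using L t by auto
    show "\<forall>d\<in>half_edges M'. (root M', d) \<in> conn (half_edges M') (rot M') (opp M')"
      using connected_iff L by blast
    show "card (orbit (rot M') (root M')) = Suc p + 1"
      using card_orbit_root L by simp
    show "\<forall>d\<in>half_edges M' - orbit (rot M') (root M'). card (orbit (rot M') d) = 3"
    proof
      fix d assume d: "d \<in> half_edges M' - orbit (rot M') (root M')"
      then have "d \<in> H - orbit (rot M) (root M')"
        unfolding orbit_root using new by auto
      then have "card (orbit (rot M) d) = 3"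
        using L by blast
      then show "card (orbit (rot M') d) = 3"
        using d orbit_other[of d] by simp
    qed
    show "card (half_edges M') = Suc p + 1 + 3 * n'"
      using L new fin n' by simp
    show "2 * num_orbits (rot M' \<circ> opp M') (half_edges M') = Suc p + n' + 2"
      using L num_orbits_faces n' by simp
  qed
  then show ?thesis
    using that n' by blast
qed

lemma splits_up:
  assumes "splits M M1 M2" and L1: "leg_map p n M1" and L2: "leg_map q m M2"
  shows "leg_map (p + q + 2) (n + m) M"
proof -
  let ?H1 = "half_edges M1" and ?H2 = "half_edges M2"
  obtain s0 t0 a' where H: "half_edges M = insert a' (?H1 \<union> ?H2)" and r: "root M = root M2"
    and disj: "?H1 \<inter> ?H2 = {}"
    and e1: "\<And>d. d \<in> ?H1 \<Longrightarrow> s0 d = rot M1 d" "\<And>d. d \<in> ?H1 \<Longrightarrow> t0 d = opp M1 d"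
    and e2: "\<And>d. d \<in> ?H2 \<Longrightarrow> s0 d = rot M2 d" "\<And>d. d \<in> ?H2 \<Longrightarrow> t0 d = opp M2 d"
    and "loop_insertion (?H1 \<union> ?H2) s0 t0 (root M1) (root M2) a' (rot M) (opp M)"
    using assms(1) unfolding splits_def by blast
  then interpret loop_insertion "?H1 \<union> ?H2" s0 t0 "root M1" "root M2" a' "rot M" "opp M"
    by simp
  note L1 = L1[unfolded leg_map_def] and L2 = L2[unfolded leg_map_def]
  have f1: "perm_on s0 ?H1"
    using L1 e1 perm_on_cong[of "rot M1" ?H1 s0] by simp
  have f2: "perm_on s0 ?H2"
    using L2 e2 perm_on_cong[of "rot M2" ?H2 s0] by simp
  have g1: "perm_on t0 ?H1"
    using L1 e1 perm_onD(1)[OF f1] by (intro perm_on_involution) simp_all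
  have g2: "perm_on t0 ?H2"
    using L2 e2 perm_onD(1)[OF f2] by (intro perm_on_involution) simp_all
  have O1: "orbit s0 d = orbit (rot M1) d" if "d \<in> ?H1" for d
    using f1 that e1 by (intro orbit_cong_closed) (simp_all add: perm_on_def)
  have O2: "orbit s0 d = orbit (rot M2) d" if "d \<in> ?H2" for d
    using f2 that e2 by (intro orbit_cong_closed) (simp_all add: perm_on_def)
  have sub2: "orbit s0 d \<subseteq> ?H2" if "d \<in> ?H2" for d
    using orbit_subset_perm_on[OF f2 that] .
  have rr: "root M1 \<in> ?H1" "root M2 \<in> ?H2"
    using L1 L2 by auto
  have sep: "root M1 \<notin> orbit s0 (root M2)"
    using sub2[OF rr(2)] rr disj by auto
  show ?thesis
    unfolding leg_map_def H r
  proof (intro conjI)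
    show "perm_on (rot M) H"
      by (rule perm_on_s)
    show "\<forall>d\<in>H. opp M d \<in> H \<and> opp M (opp M d) = d"
      using t_H by blast
    show "root M2 \<in> H"
      using rr by simp
    show "\<forall>d\<in>H. opp M d = d \<longleftrightarrow> d = root M2"
    proof
      fix d assume "d \<in> H"
      then consider "d = a'" | "d = root M1" | "d \<in> ?H1" "d \<noteq> root M1" | "d \<in> ?H2" "d \<noteq> root M1"
        using rr disj by blast
      then show "opp M d = d \<longleftrightarrow> d = root M2"
      proof cases
        case 3
        then show ?thesis
          using t(3)[of d] L1 e1 rr disj by auto
      next
        case 4
        then show ?thesis
          using t(3)[of d] L2 e2 by auto
      qed (use t neq ar in auto)
    qed
    show "\<forall>d\<in>H. (root M2, d) \<in> conn H (rot M) (opp M)"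
    proof (rule connected_lift)
      fix d assume "d \<in> ?H1 \<union> ?H2"
      then show "(root M1, d) \<in> conn (?H1 \<union> ?H2) s0 t0 \<or> (root M2, d) \<in> conn (?H1 \<union> ?H2) s0 t0"
      proof
        assume d: "d \<in> ?H1"
        have "(root M1, d) \<in> conn (?H1 \<union> ?H2) s0 t0"
        proof (rule conn_sub)
          show "(root M1, d) \<in> conn ?H1 (rot M1) (opp M1)"
            using L1 d by blast
          fix e assume "e \<in> ?H1"
          then show "(e, rot M1 e) \<in> conn (?H1 \<union> ?H2) s0 t0" "(e, opp M1 e) \<in> conn (?H1 \<union> ?H2) s0 t0"
            using conn_step[of e "?H1 \<union> ?H2"] e1 by (metis UnI1)+
        qed
        then show ?thesis ..
      next
        assume d: "d \<in> ?H2"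
        have "(root M2, d) \<in> conn (?H1 \<union> ?H2) s0 t0"
        proof (rule conn_sub)
          show "(root M2, d) \<in> conn ?H2 (rot M2) (opp M2)"
            using L2 d by blast
          fix e assume "e \<in> ?H2"
          then show "(e, rot M2 e) \<in> conn (?H1 \<union> ?H2) s0 t0" "(e, opp M2 e) \<in> conn (?H1 \<union> ?H2) s0 t0"
            using conn_step[of e "?H1 \<union> ?H2"] e2 by (metis UnI2)+
        qed
        then show ?thesis ..
      qed
    qed
    show "card (orbit (rot M) (root M2)) = p + q + 2 + 1"
      using card_orbit_root[OF sep] O1 O2 rr L1 L2 by simp
    show "\<forall>d\<in>H - orbit (rot M) (root M2). card (orbit (rot M) d) = 3"
    proof
      fix d assume "d \<in> H - orbit (rot M) (root M2)"
      then have d: "d \<in> ?H1 \<union> ?H2" "d \<notin> orbit s0 (root M1)" "d \<notin> orbit s0 (root M2)"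
        unfolding orbit_root[OF sep] by auto
      then have "orbit (rot M) d = orbit s0 d"
        by (intro orbit_other)
      then show "card (orbit (rot M) d) = 3"
        using d L1 L2 O1 O2 rr by auto
    qed
    show "card H = p + q + 2 + 1 + 3 * (n + m)"
      using L1 L2 new perm_onD(1)[OF f1] perm_onD(1)[OF f2] disj by (simp add: card_Un_disjoint)
    \<comment> \<open>No face is gained or lost by the loop. This fits Euler's formula, as
      \<open>(p + n + 2) + (q + m + 2)\<close> equals \<open>(p + q + 2) + (n + m) + 2\<close>: the
      loop adds 2 to the root degree.\<close>
    have "num_orbits (s0 \<circ> t0) ?H1 = num_orbits (rot M1 \<circ> opp M1) ?H1"
      using perm_on_comp[OF f1 g1] e1 perm_onD(2)[OF g1] by (intro num_orbits_cong) (auto simp: perm_on_def)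
    moreover have "num_orbits (s0 \<circ> t0) ?H2 = num_orbits (rot M2 \<circ> opp M2) ?H2"
      using perm_on_comp[OF f2 g2] e2 perm_onD(2)[OF g2] by (intro num_orbits_cong) (auto simp: perm_on_def)
    ultimately show "2 * num_orbits (rot M \<circ> opp M) H = p + q + 2 + (n + m) + 2"
      using num_orbits_faces num_orbits_Un[OF perm_on_comp[OF f1 g1] perm_on_comp[OF f2 g2] disj] L1 L2 by simp
  qed
qed

section \<open>Decomposing a planar map with one leg\<close>

text \<open>For a component with a single leg and all other vertices cubic, the genus inequality
  bounds the number of faces by the planar value, and equality is planarity. The inequality is
  stated along with the conditional conclusion because equality is available only after both
  components of a split map are added up.\<close>

lemma component_leg_map:
  assumes s0: "perm_on s0 H0" and t0: "\<And>d. d \<in> H0 \<Longrightarrow> t0 d \<in> H0" "\<And>d. d \<in> H0 \<Longrightarrow> t0 (t0 d) = d"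
    and x: "x \<in> H0" "t0 x = x"
  defines "C \<equiv> conn H0 s0 t0 `` {x}"
  assumes leg: "\<And>d. d \<in> C \<Longrightarrow> t0 d = d \<Longrightarrow> d = x"
    and deg: "\<And>d. d \<in> C \<Longrightarrow> d \<notin> orbit s0 x \<Longrightarrow> card (orbit s0 d) = 3"
  shows "\<exists>p n. card (orbit s0 x) = p + 1 \<and> card C = p + 1 + 3 * n \<and>
    2 * num_orbits (s0 \<circ> t0) C \<le> p + n + 2 \<and>
    (2 * num_orbits (s0 \<circ> t0) C = p + n + 2 \<longrightarrow> leg_map p n \<lparr>half_edges = C, rot = s0, opp = t0, root = x\<rparr>)"
proof -
  have sub: "C \<subseteq> H0"
    unfolding C_def using conn_closed[of x _ H0 s0 t0] x t0 s0 by (auto simp: perm_on_def)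
  have closed: "s0 d \<in> C" "t0 d \<in> C" if "d \<in> C" for d
    using that sub conn_step[of d H0] conn_trans unfolding C_def by (metis Image_singleton_iff subsetD)+
  have fC: "perm_on s0 C"
    using s0 sub closed(1) finite_subset[OF sub] inj_on_subset[of s0 H0 C] by (auto simp: perm_on_def)
  have invC: "t0 (t0 d) = d" if "d \<in> C" for d
    using t0(2) sub that by auto
  have tC: "perm_on t0 C"
    using closed invC perm_onD(1)[OF fC] by (intro perm_on_involution)
  have xC: "x \<in> C"
    by (simp add: C_def)
  have connC: "(x, d) \<in> conn C s0 t0" if "d \<in> C" for d
    using that conn_component[of x d H0 s0 t0] by (simp add: C_def)
  define p where "p = card (orbit s0 x) - 1"
  define n where "n = num_orbits s0 C - 1"
  have "finite (orbit s0 x)"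
    using orbit_subset_perm_on[OF fC xC] perm_onD(1)[OF fC] by (rule finite_subset)
  then have "card (orbit s0 x) \<noteq> 0"
    using orbit_nonempty[of s0 x] by simp
  then have p: "card (orbit s0 x) = p + 1"
    by (simp add: p_def)
  have "num_orbits s0 C \<noteq> 0"
    using perm_onD(1)[OF fC] xC by (auto simp: num_orbits_def)
  then have n: "num_orbits s0 C = n + 1"
    by (simp add: n_def)
  have card: "card C = p + 1 + 3 * n"
    using card_orbits[OF fC xC, of 3] deg p n by simp
  have ot: "orbit t0 x = {x}"
    using x by (simp add: orbit_eq_singleton_iff)
  have "card (orbit t0 d) = 2" if d: "d \<in> C" "d \<notin> orbit t0 x" for d
    using leg[OF d(1)] d(2) ot invC[OF d(1)] by (intro card_opp_orbit) auto
  then have "card C + 2 = card (orbit t0 x) + 2 * num_orbits t0 C"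
    by (intro card_orbits[OF tC xC])
  then have e: "card C + 1 = 2 * num_orbits t0 C"
    using ot by simp
  have "num_orbits s0 C + num_orbits t0 C + num_orbits (s0 \<circ> t0) C \<le> card C + 2 * num_comps C s0 t0"
    by (rule genus_inequality[OF fC tC invC])
  also have "num_comps C s0 t0 = 1"
    using xC connC by (rule num_comps_connected)
  finally have le: "2 * num_orbits (s0 \<circ> t0) C \<le> p + n + 2"
    using e n card by linarith
  show ?thesis
  proof (rule exI[of _ p], rule exI[of _ n], intro conjI impI p card le)
    assume "2 * num_orbits (s0 \<circ> t0) C = p + n + 2"
    then show "leg_map p n \<lparr>half_edges = C, rot = s0, opp = t0, root = x\<rparr>"
      unfolding leg_map_def rmap.select_convs
    proof (intro conjI ballI)
      show "t0 d = d \<longleftrightarrow> d = x" if "d \<in> C" for d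
        using leg[OF that] x(2) by blast
      show "card (orbit s0 d) = 3" if "d \<in> C - orbit s0 x" for d
        using deg that by blast
    qed (assumption | rule fC closed(2) invC xC connC p card)+
  qed
qed

text \<open>Planarity of \<open>M\<close> is used twice: the genus inequality shows first that
  removing the loop disconnects the map, and then that neither part can have fewer faces than a
  planar map, since the total leaves no slack.\<close>

lemma ex_split:
  assumes L: "leg_map p n M" and deg: "rot M (root M) \<noteq> root M"
    and loop: "opp M (rot M (root M)) \<in> orbit (rot M) (root M)"
  obtains M1 M2 p1 n1 p2 n2 where "splits M M1 M2" "leg_map p1 n1 M1" "leg_map p2 n2 M2"
    "p = p1 + p2 + 2" "n = n1 + n2"
proof -
  define s t r G where "s = rot M" and "t = opp M" and "r = root M" and "G = half_edges M"
  define a where "a = s r"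
  define a' where "a' = t a"
  define H0 where "H0 = G - {a'}"
  \<comment> \<open>This inverts the loop insertion: the root cycle
    \<open>(r a x ... a' y ...)\<close> is cut into \<open>(a x ...)\<close> and
    \<open>(r y ...)\<close>.\<close>
  define s0 where "s0 d = (if d = r then s a' else if s d = a' then a else s d)" for d
  define t0 where "t0 = t(a := a)"
  note L = L[unfolded leg_map_def, folded s_def t_def r_def G_def]
  have fs: "perm_on s G"
    using L by blast
  note s = perm_onD[OF fs]
  have t: "\<And>d. d \<in> G \<Longrightarrow> t d \<in> G" "\<And>d. d \<in> G \<Longrightarrow> t (t d) = d" "\<And>d. d \<in> G \<Longrightarrow> t d = d \<longleftrightarrow> d = r"
    using L by blast+
  have r: "r \<in> G"
    using L by blast
  have a: "a \<in> G" "a \<noteq> r"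
    using s(2) r deg by (simp_all add: a_def s_def r_def)
  have ta': "t a' = a"
    using t(2)[OF a(1)] by (simp add: a'_def)
  then have a': "a' \<in> G" "a' \<noteq> a" "t a' = a" "a' \<noteq> r"
    using t(1)[OF a(1)] t(3)[OF a(1)] t(3)[OF r] a by (auto simp: a'_def)
  have sa: "s d = a \<longleftrightarrow> d = r" if "d \<in> G" for d
    using s(3)[OF that r] by (auto simp: a_def)
  have "a' \<in> orbit s r"
    using loop by (simp add: a'_def a_def s_def t_def r_def)
  then have rO: "r \<in> orbit s a'"
    using orbit_eq[OF fs r, of a'] self_in_orbit[OF fs r] by metis
  have sa': "s a' \<noteq> a'" "s a' \<noteq> a"
    using rO a' orbit_eq_singleton_iff[of s a'] sa by auto
  have fin: "finite H0"
    using s(1) by (simp add: H0_def)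
  have G: "G = insert a' H0"
    using a' by (auto simp: H0_def)
  have f0: "perm_on s0 H0"
  proof (rule perm_onI)
    show "s0 x \<in> H0" if "x \<in> H0" for x
      using that s(2) a a' sa' by (auto simp: s0_def H0_def)
    fix x y assume xy: "x \<in> H0" "y \<in> H0" "s0 x = s0 y"
    \<comment> \<open>\<open>s0\<close> is \<open>s\<close> after rerouting \<open>r\<close> to
      \<open>a'\<close> and the predecessor of \<open>a'\<close> to \<open>r\<close>, so its
      injectivity comes from that of \<open>s\<close>.\<close>
    define g where "g d = (if d = r then a' else if s d = a' then r else d)" for d
    have "s0 d = s (g d)" for d
      by (simp add: s0_def g_def a_def)
    moreover have "g d \<in> G" if "d \<in> H0" for d
      using that a' r by (auto simp: g_def H0_def)
    ultimately have "g x = g y"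
      using xy s(3) by metis
    then show "x = y"
      using xy s(3)[of x y] a' by (auto simp: g_def H0_def split: if_splits)
  qed (rule fin)
  have t0_H0: "t0 d \<in> H0" "t0 (t0 d) = d" if "d \<in> H0" for d
    using that t(1,2)[of d] t(2)[OF a(1)] a a' by (auto simp: t0_def H0_def a'_def)
  note tt = t
  interpret loop_insertion H0 s0 t0 a r a' s t
  proof
    show "s d = (if s0 d = a then a' else s0 d)" if "d \<in> H0" "d \<noteq> r" for d
      using that sa[of d] by (auto simp: s0_def H0_def)
    show "s0 r \<noteq> a"
      using sa' by (simp add: s0_def)
  qed (use f0 t0_H0 a a' r t(3)[OF r] in \<open>auto simp: H0_def t0_def s0_def a_def a'_def\<close>)
  have sep: "a \<notin> orbit s0 r"
    by (rule separated[OF rO])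
  have V: "num_orbits s G = n + 1"
    using card_orbits[OF fs r, of 3] L by auto
  have tG: "perm_on t G"
    unfolding G by (rule perm_on_t)
  have "t r = r"
    using tt(3)[OF r] by simp
  then have ot: "orbit t r = {r}"
    by (simp add: orbit_eq_singleton_iff)
  have "card (orbit t d) = 2" if d: "d \<in> G" "d \<notin> orbit t r" for d
    using tt(2,3)[OF d(1)] d(2) ot by (intro card_opp_orbit) auto
  then have "card G + 2 = card (orbit t r) + 2 * num_orbits t G"
    by (intro card_orbits[OF tG r])
  then have E: "card G + 1 = 2 * num_orbits t G"
    using ot by simp
  have g0: "perm_on t0 H0"
    using t0_H0 fin by (intro perm_on_involution)
  have cardG: "card G = card H0 + 1"
    unfolding G using fin new by simp
  have "num_orbits s0 H0 + num_orbits t0 H0 + num_orbits (s0 \<circ> t0) H0 \<le> card H0 + 2 * num_comps H0 s0 t0"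
    by (rule genus_inequality[OF f0 g0 t0_H0(2)])
  \<comment> \<open>For \<open>M\<close> the three orbit counts sum to \<open>card G + 2\<close> by
    planarity. Removing the loop splits the root vertex, keeps the other two counts and drops one
    half-edge, so the sum becomes \<open>card H0 + 4\<close>. Hence there are at least two
    components.\<close>
  then have nc: "num_comps H0 s0 t0 \<ge> 2"
    using num_orbits_s[OF sep, folded G] num_orbits_t[folded G] num_orbits_faces[folded G] V E L cardG by auto
  have conn: "(r, d) \<in> conn G s t" if "d \<in> G" for d
    using L that by blast
  have notconn: "(a, r) \<notin> conn H0 s0 t0"
  proof
    assume ar0: "(a, r) \<in> conn H0 s0 t0"
    have "(r, d) \<in> conn H0 s0 t0" if "d \<in> H0" for d
      using conn_collapse[OF conn[of d, unfolded G] ar0] that neq new by (cases "d = a'") auto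
    then have "num_comps H0 s0 t0 = 1"
      using ar(3) by (intro num_comps_connected)
    then show False
      using nc by simp
  qed
  define H1 where "H1 = conn H0 s0 t0 `` {a}"
  define H2 where "H2 = conn H0 s0 t0 `` {r}"
  have disj: "H1 \<inter> H2 = {}"
    unfolding H1_def H2_def using notconn by (auto intro: conn_sym conn_trans)
  have sub: "H1 \<subseteq> H0" "H2 \<subseteq> H0"
    unfolding H1_def H2_def using conn_closed[of _ _ H0 s0 t0] ar t0_H0 f0 by (auto simp: perm_on_def)
  have un: "H1 \<union> H2 = H0"
    using sub conn_two[OF conn[unfolded G]] unfolding H1_def H2_def by auto
  have sub': "orbit s0 a \<subseteq> H1" "orbit s0 r \<subseteq> H2"
    unfolding H1_def H2_def using conn_orbit[of _ s0 _ H0 s0 t0] ar conn_step(1)[of _ H0 s0 t0] f0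
    by (auto simp: perm_on_def)
  have leg0: "d = a \<or> d = r" if "d \<in> H0" "t0 d = d" for d
  proof (cases "d = a")
    case False
    then have "t d = d"
      using that(2) by (simp add: t0_def)
    moreover have "d \<in> G"
      using that(1) by (simp add: H0_def)
    ultimately show ?thesis
      using tt(3) by metis
  qed simp
  have deg0: "card (orbit s0 d) = 3" if "d \<in> H0" "d \<notin> orbit s0 a" "d \<notin> orbit s0 r" for d
  proof -
    have "d \<notin> orbit s r" "d \<in> G"
      using that new unfolding orbit_root[OF sep] G by auto
    then have "card (orbit s d) = 3"
      using L by blast
    then show ?thesis
      using orbit_other[OF that] by simp
  qed
  have "\<exists>p n. card (orbit s0 a) = p + 1 \<and> card H1 = p + 1 + 3 * n \<and>
    2 * num_orbits (s0 \<circ> t0) H1 \<le> p + n + 2 \<and>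
    (2 * num_orbits (s0 \<circ> t0) H1 = p + n + 2 \<longrightarrow> leg_map p n \<lparr>half_edges = H1, rot = s0, opp = t0, root = a\<rparr>)"
  proof (rule component_leg_map[OF f0 t0_H0 ar(1,2), folded H1_def])
    show "d = a" if "d \<in> H1" "t0 d = d" for d
    proof -
      have "r \<in> H2"
        by (simp add: H2_def)
      then show ?thesis
        using leg0[of d] that sub disj by blast
    qed
    show "card (orbit s0 d) = 3" if "d \<in> H1" "d \<notin> orbit s0 a" for d
      using deg0[of d] that sub disj sub' by blast
  qed
  then obtain p1 n1 where 1: "card (orbit s0 a) = p1 + 1" "card H1 = p1 + 1 + 3 * n1"
    "2 * num_orbits (s0 \<circ> t0) H1 \<le> p1 + n1 + 2"
    "2 * num_orbits (s0 \<circ> t0) H1 = p1 + n1 + 2 \<Longrightarrow> leg_map p1 n1 \<lparr>half_edges = H1, rot = s0, opp = t0, root = a\<rparr>"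
    by blast
  have "\<exists>p n. card (orbit s0 r) = p + 1 \<and> card H2 = p + 1 + 3 * n \<and>
    2 * num_orbits (s0 \<circ> t0) H2 \<le> p + n + 2 \<and>
    (2 * num_orbits (s0 \<circ> t0) H2 = p + n + 2 \<longrightarrow> leg_map p n \<lparr>half_edges = H2, rot = s0, opp = t0, root = r\<rparr>)"
  proof (rule component_leg_map[OF f0 t0_H0 ar(3,4), folded H2_def])
    show "d = r" if "d \<in> H2" "t0 d = d" for d
    proof -
      have "a \<in> H1"
        by (simp add: H1_def)
      then show ?thesis
        using leg0[of d] that sub disj by blast
    qed
    show "card (orbit s0 d) = 3" if "d \<in> H2" "d \<notin> orbit s0 r" for d
      using deg0[of d] that sub disj sub' by blast
  qed
  then obtain p2 n2 where 2: "card (orbit s0 r) = p2 + 1" "card H2 = p2 + 1 + 3 * n2"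
    "2 * num_orbits (s0 \<circ> t0) H2 \<le> p2 + n2 + 2"
    "2 * num_orbits (s0 \<circ> t0) H2 = p2 + n2 + 2 \<Longrightarrow> leg_map p2 n2 \<lparr>half_edges = H2, rot = s0, opp = t0, root = r\<rparr>"
    by blast
  have p: "p = p1 + p2 + 2"
    using card_orbit_root[OF sep] 1(1) 2(1) L by simp
  have "card H0 = card H1 + card H2"
    using disj fin sub by (metis card_Un_disjoint finite_subset un)
  then have n: "n = n1 + n2"
    using cardG 1(2) 2(2) L p by simp
  have fp: "perm_on (s0 \<circ> t0) C" if "C = H1 \<or> C = H2" for C
  proof (rule perm_onI)
    have "C \<subseteq> H0"
      using that sub by auto
    then show "finite C"
      using fin finite_subset by auto
    show "x = y" if "x \<in> C" "y \<in> C" "(s0 \<circ> t0) x = (s0 \<circ> t0) y" for x y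
      using perm_onD(3)[OF perm_on_comp[OF f0 g0]] that \<open>C \<subseteq> H0\<close> by blast
    show "(s0 \<circ> t0) x \<in> C" if "x \<in> C" for x
    proof -
      have "(x, (s0 \<circ> t0) x) \<in> conn H0 s0 t0"
        using that \<open>C \<subseteq> H0\<close> conn_step(2)[of x H0 t0 s0] conn_step(1)[OF t0_H0(1), of x s0 t0]
        by (auto intro: conn_trans)
      then show ?thesis
        using \<open>x \<in> C\<close> \<open>C = H1 \<or> C = H2\<close> unfolding H1_def H2_def by (auto intro: conn_trans)
    qed
  qed
  have "num_orbits (s0 \<circ> t0) H0 = num_orbits (s0 \<circ> t0) H1 + num_orbits (s0 \<circ> t0) H2"
    using num_orbits_Un[of "s0 \<circ> t0" H1 H2] fp disj un by simp
  then have "2 * num_orbits (s0 \<circ> t0) H1 + 2 * num_orbits (s0 \<circ> t0) H2 = p + n + 2"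
    using num_orbits_faces[folded G] L by simp
  \<comment> \<open>Two upper bounds whose sum is attained are both attained.\<close>
  then have eq: "2 * num_orbits (s0 \<circ> t0) H1 = p1 + n1 + 2" "2 * num_orbits (s0 \<circ> t0) H2 = p2 + n2 + 2"
    using p n 1(3) 2(3) by linarith+
  let ?M1 = "\<lparr>half_edges = H1, rot = s0, opp = t0, root = a\<rparr>"
  let ?M2 = "\<lparr>half_edges = H2, rot = s0, opp = t0, root = r\<rparr>"
  have L12: "leg_map p1 n1 ?M1" "leg_map p2 n2 ?M2"
    using 1(4) 2(4) eq by auto
  have "loop_insertion H0 s0 t0 a r a' s t"
    by unfold_locales
  moreover have "a \<in> H1" "r \<in> H2"
    by (simp_all add: H1_def H2_def)
  ultimately have "splits M ?M1 ?M2"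
    unfolding splits_def
    by - (rule exI[of _ s0], rule exI[of _ t0], rule exI[of _ a'],
      use L12[THEN leg_map_connected_rmap] disj un G in \<open>simp add: r_def s_def t_def G_def\<close>)
  then show ?thesis
    using that L12 p n by blast
qed

lemma orbit_card_3:
  assumes f: "perm_on f H" "x \<in> H" and card: "card (orbit f x) = 3"
  shows "f (f (f x)) = x" "f x \<noteq> x" "f (f x) \<noteq> x" "f x \<noteq> f (f x)"
proof -
  have x: "x \<in> orbit f x"
    by (rule self_in_orbit[OF f])
  have "card (orbit f x) = funpow_dist1 f x x"
    unfolding orbit_conv_funpow_dist1[OF x] using inj_on_funpow_dist1[OF x] by (simp add: card_image)
  then have "(f ^^ 3) x = x"
    using funpow_dist1_prop[OF x] card by metis
  then show "f (f (f x)) = x"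
    by (simp add: numeral_3_eq_3)
  show 1: "f x \<noteq> x"
    using card orbit_eq_singleton_iff[of f x] by auto
  show "f (f x) \<noteq> x"
  proof
    assume "f (f x) = x"
    then have "orbit f x \<subseteq> {x, f x}"
      by (intro orbit_subset_closed) auto
    then have "card (orbit f x) \<le> card {x, f x}"
      by (intro card_mono) auto
    then show False
      using card card_insert_le_m1[of 2 "{f x}" x] by (simp add: card_insert_if split: if_splits)
  qed
  show "f x \<noteq> f (f x)"
    using perm_onD(3)[OF f(1) f(2) perm_onD(2)[OF f]] 1 by auto
qed

lemma ex_contraction:
  assumes L: "leg_map p n M" and deg: "rot M (root M) \<noteq> root M"
    and edge: "opp M (rot M (root M)) \<notin> orbit (rot M) (root M)"
  obtains M' where "contracts M M'"
proof -
  define s t r G where "s = rot M" and "t = opp M" and "r = root M" and "G = half_edges M"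
  define a where "a = s r"
  define a' where "a' = t a"
  define b where "b = s a'"
  define c where "c = s b"
  define H' where "H' = G - {a, a'}"
  \<comment> \<open>The far end lies on a cubic vertex \<open>(a' b c)\<close>; contraction puts
    \<open>b c\<close> in the place of \<open>a\<close> in the root cycle.\<close>
  define s' where "s' = s(r := b, c := s a)"
  note L = L[unfolded leg_map_def, folded s_def t_def r_def G_def]
  have fs: "perm_on s G"
    using L by blast
  note s = perm_onD[OF fs]
  have t: "\<And>d. d \<in> G \<Longrightarrow> t d \<in> G" "\<And>d. d \<in> G \<Longrightarrow> t (t d) = d" "\<And>d. d \<in> G \<Longrightarrow> t d = d \<longleftrightarrow> d = r"
    using L by blast+
  have r: "r \<in> G"
    using L by blast
  have a: "a \<in> G" "a \<noteq> r"
    using s(2) r deg by (simp_all add: a_def s_def r_def)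
  have ta': "t a' = a"
    using t(2)[OF a(1)] by (simp add: a'_def)
  then have a': "a' \<in> G" "a' \<noteq> a" "t a' = a" "a' \<noteq> r"
    using t(1)[OF a(1)] t(3)[OF a(1)] t(3)[OF r] a by (auto simp: a'_def)
  have bc: "b \<in> G" "c \<in> G"
    using a' s(2) by (auto simp: b_def c_def)
  have a'O: "a' \<notin> orbit s r"
    using edge by (simp add: a'_def a_def s_def t_def r_def)
  have "card (orbit s a') = 3"
    using L a' a'O by blast
  have O: "b \<in> orbit s a'" "c \<in> orbit s a'" "s c \<in> orbit s a'"
    unfolding b_def c_def by (auto intro: orbit.intros)
  have s_c: "s c = a'" and bca': "b \<noteq> a'" "c \<noteq> a'" "b \<noteq> c"
    using orbit_card_3[OF fs a'(1)] L a' a'O by (simp_all add: b_def c_def)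
  have disj: "orbit s r \<inter> orbit s a' = {}"
    using orbit_disjoint[OF fs r a'(1) a'O] .
  have aO: "a \<in> orbit s r" "r \<in> orbit s r"
    using orbit.base[of s r] self_in_orbit[OF fs r] by (auto simp: a_def)
  have bc': "b \<noteq> r" "c \<noteq> r" "b \<noteq> a" "c \<noteq> a"
    using O aO disj by auto
  \<comment> \<open>\<open>s'\<close> is \<open>s\<close> after rerouting \<open>r\<close> to
    \<open>a'\<close> and \<open>c\<close> to \<open>a\<close>. The two targets are missing from
    \<open>H'\<close>, so \<open>g\<close> is injective there.\<close>
  define g where "g d = (if d = r then a' else if d = c then a else d)" for d
  have s'_g: "s' d = s (g d)" for d
    using bc' by (simp add: s'_def g_def b_def)
  have g: "g d \<in> G" if "d \<in> H'" for d
    using that a a' by (auto simp: g_def H'_def)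
  have H': "d \<in> H' \<longleftrightarrow> d \<in> G \<and> d \<noteq> a \<and> d \<noteq> a'" for d
    by (auto simp: H'_def)
  have fs': "perm_on s' H'"
  proof (rule perm_onI)
    show "finite H'"
      using s(1) by (simp add: H'_def)
    fix x assume x: "x \<in> H'"
    have "s (g x) \<noteq> a"
      using s(3)[OF g[OF x] r] a' a x by (auto simp: g_def a_def split: if_splits)
    moreover have "s (g x) \<noteq> a'"
      using s(3)[OF g[OF x] bc(2)] s_c bca' bc' x by (auto simp: g_def H' split: if_splits)
    ultimately show "s' x \<in> H'"
      using s(2)[OF g[OF x]] by (simp add: s'_g H')
    fix y assume y: "y \<in> H'" "s' x = s' y"
    then have "g x = g y"
      using s(3)[OF g[OF x] g[OF y(1)]] by (simp add: s'_g)
    then show "x = y"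
      using x y(1) a' by (auto simp: g_def H' split: if_splits)
  qed
  let ?M' = "\<lparr>half_edges = H', rot = s', opp = t, root = r\<rparr>"
  have s'_vals: "s' r = b" "s' b = c" "s' c = s a"
    using bc' bca' by (auto simp: s'_def c_def)
  have t_H': "t d \<in> H'" if "d \<in> H'" for d
    using t(1)[of d] t(2)[of d] that ta' by (auto simp: H' a'_def)
  have "contraction H' s' t r a a' s t"
  proof
    show "s' r \<noteq> r" "s' (s' r) \<noteq> r"
      using s'_vals bc' by simp_all
    show "s a = s' (s' (s' r))" "s (s' (s' r)) = a'" "s a' = s' r"
      using s'_vals s_c by (simp_all add: b_def)
    show "s d = s' d" if "d \<in> H'" "d \<noteq> r" "d \<noteq> s' (s' r)" for d
      using that unfolding s'_vals by (simp add: s'_def)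
    show "t (t d) = d" if "d \<in> H'" for d
      using t(2) that by (simp add: H')
  qed (use fs' t_H' a a' r t(3)[OF r] in \<open>simp_all add: H' a_def a'_def\<close>)
  then have "contracts M ?M'"
    unfolding contracts_def
    by - (rule exI[of _ a], rule exI[of _ a'],
      use a a' in \<open>auto simp: H'_def G_def s_def t_def r_def\<close>)
  then show ?thesis
    by (rule that)
qed

section \<open>Codes\<close>

text \<open>The history of the decomposition, which will serve as a name for an isomorphism class of
  maps.\<close>

datatype code = Point | Contract code | Split code code

inductive codes :: "'a rmap \<Rightarrow> code \<Rightarrow> bool" where
  point: "half_edges M = {root M} \<Longrightarrow> rot M (root M) = root M \<Longrightarrow> opp M (root M) = root M \<Longrightarrow> codes M Point"
| contract: "contracts M M' \<Longrightarrow> codes M' x \<Longrightarrow> codes M (Contract x)"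
| split: "splits M M1 M2 \<Longrightarrow> codes M1 x \<Longrightarrow> codes M2 y \<Longrightarrow> codes M (Split x y)"

text \<open>The pair \<open>(p, n)\<close> is read off the tree alone, so that counting needs no
  maps. In \<open>contract\<close> the result has positive \<open>p\<close> because the contracted
  edge itself occupies a place at the root vertex.\<close>

inductive shape :: "nat \<Rightarrow> nat \<Rightarrow> code \<Rightarrow> bool" where
  point: "shape 0 0 Point"
| contract: "shape (Suc (Suc p)) n x \<Longrightarrow> shape (Suc p) (Suc n) (Contract x)"
| split: "shape p n x \<Longrightarrow> shape q m y \<Longrightarrow> shape (p + q + 2) (n + m) (Split x y)"

section \<open>Every planar map with one leg has a code\<close>

text \<open>If the leg is alone at its vertex, then being the root is invariant under
  \<open>rot\<close> and \<open>opp\<close>, so connectedness excludes all other half-edges.\<close>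

lemma leg_map_0:
  assumes L: "leg_map p n M" and deg: "rot M (root M) = root M"
  shows "half_edges M = {root M}" "opp M (root M) = root M" "p = 0" "n = 0"
proof -
  note L = L[unfolded leg_map_def]
  have f: "perm_on (rot M) (half_edges M)" and r: "root M \<in> half_edges M"
    using L by blast+
  show o: "opp M (root M) = root M"
    using L by blast
  have "d = root M" if d: "d \<in> half_edges M" for d
  proof -
    have "(root M, d) \<in> conn (half_edges M) (rot M) (opp M)"
      using L d by blast
    then have "(root M = root M) = (d = root M)"
    proof (rule conn_invariant)
      fix e assume e: "e \<in> half_edges M"
      show "(e = root M) = (rot M e = root M)"
        using perm_onD(3)[OF f e r] deg by auto
      have "opp M (opp M e) = e"
        using L e by blast
      then show "(e = root M) = (opp M e = root M)"
        using o by auto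
    qed
    then show ?thesis
      by simp
  qed
  then show H: "half_edges M = {root M}"
    using r by blast
  have "card (orbit (rot M) (root M)) = p + 1" "card (half_edges M) = p + 1 + 3 * n"
    using L by blast+
  moreover have "orbit (rot M) (root M) = {root M}"
    using deg by (simp add: orbit_eq_singleton_iff)
  ultimately show "p = 0" "n = 0"
    unfolding H by simp_all
qed

lemma leg_map_Suc:
  assumes L: "leg_map p n M" and deg: "rot M (root M) \<noteq> root M"
  obtains p' where "p = Suc p'"
proof -
  note L = L[unfolded leg_map_def]
  have f: "perm_on (rot M) (half_edges M)" and r: "root M \<in> half_edges M"
    and c: "card (orbit (rot M) (root M)) = p + 1"
    using L by blast+
  have "p \<noteq> 0"
  proof
    assume "p = 0"
    then obtain z where "orbit (rot M) (root M) = {z}"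
      using c by (auto simp: card_1_singleton_iff)
    then show False
      using self_in_orbit[OF f r] orbit.base[of "rot M" "root M"] deg by auto
  qed
  then show ?thesis
    using that not0_implies_Suc by blast
qed

lemma ex_code:
  assumes "leg_map p n M"
  shows "\<exists>x. codes M x \<and> shape p n x"
  using assms
proof (induction "card (half_edges M)" arbitrary: p n M rule: less_induct)
  case less
  note L = less.prems
  have card: "card (half_edges M) = p + 1 + 3 * n"
    using L unfolding leg_map_def by blast
  show ?case
  proof (cases "rot M (root M) = root M")
    case True
    then show ?thesis
      using leg_map_0[OF L True] codes.point[of M] shape.point by auto
  next
    case False
    show ?thesis
    proof (cases "opp M (rot M (root M)) \<in> orbit (rot M) (root M)")
      case True
      obtain M1 M2 p1 n1 p2 n2 where M: "splits M M1 M2" "leg_map p1 n1 M1" "leg_map p2 n2 M2"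
        "p = p1 + p2 + 2" "n = n1 + n2"
        using ex_split[OF L False True] by blast
      have "card (half_edges M1) = p1 + 1 + 3 * n1" "card (half_edges M2) = p2 + 1 + 3 * n2"
        using M(2,3) unfolding leg_map_def by blast+
      then obtain x y where "codes M1 x" "shape p1 n1 x" "codes M2 y" "shape p2 n2 y"
        using less.hyps[OF _ M(2)] less.hyps[OF _ M(3)] card M(4,5) by auto
      then show ?thesis
        using codes.split[OF M(1)] shape.split M(4,5) by blast
    next
      case edge: False
      obtain M' where M': "contracts M M'"
        using ex_contraction[OF L False edge] .
      obtain n' where n': "n = Suc n'" "leg_map (Suc p) n' M'"
        using contracts_down[OF M' L] .
      have "card (half_edges M') = Suc p + 1 + 3 * n'"
        using n' unfolding leg_map_def by blast
      then obtain x where "codes M' x" "shape (Suc p) n' x"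
        using less.hyps[OF _ n'(2)] card n' by auto
      moreover obtain p' where "p = Suc p'"
        using leg_map_Suc[OF L False] .
      ultimately show ?thesis
        using codes.contract[OF M'] shape.contract n' by blast
    qed
  qed
qed

section \<open>Every shape is realised by a map\<close>

lemma ex_contracts:
  fixes M' :: "nat rmap"
  assumes L: "leg_map (Suc (Suc p)) n M'" and A: "finite A" "half_edges M' \<inter> A = {}"
  obtains M where "contracts M M'" "half_edges M \<inter> A = {}"
proof -
  define s' t' r H' where "s' = rot M'" and "t' = opp M'" and "r = root M'" and "H' = half_edges M'"
  note L = L[unfolded leg_map_def, folded s'_def t'_def r_def H'_def]
  have f: "perm_on s' H'" and r: "r \<in> H'" and c: "card (orbit s' r) = p + 3"
    and t': "\<And>d. d \<in> H' \<Longrightarrow> t' d \<in> H'" "\<And>d. d \<in> H' \<Longrightarrow> t' (t' d) = d" "t' r = r"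
    using L by auto
  have fin: "finite (H' \<union> A)"
    using A perm_onD(1)[OF f] by simp
  obtain a where a: "a \<notin> H' \<union> A"
    using ex_new_if_finite[OF infinite_UNIV_nat fin] by blast
  have fin': "finite (insert a (H' \<union> A))"
    using fin by simp
  obtain a' where a': "a' \<notin> insert a (H' \<union> A)"
    using ex_new_if_finite[OF infinite_UNIV_nat fin'] by blast
  define b c where "b = s' r" and "c = s' b"
  have bc: "b \<in> H'" "c \<in> H'"
    using r perm_onD(2)[OF f] by (simp_all add: b_def c_def)
  have "b \<noteq> r"
    using c orbit_eq_singleton_iff[of s' r] by (auto simp: b_def)
  have "c \<noteq> r"
  proof
    assume "c = r"
    then have "orbit s' r \<subseteq> {r, b}"
      by (intro orbit_subset_closed) (auto simp: b_def c_def)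
    then have "card (orbit s' r) \<le> card {r, b}"
      by (intro card_mono) auto
    then show False
      using c by (auto simp: card_insert_if split: if_splits)
  qed
  define s where "s = s'(r := a, c := a', a := s' c, a' := b)"
  define t where "t = t'(a := a', a' := a)"
  let ?M = "\<lparr>half_edges = insert a' (insert a H'), rot = s, opp = t, root = r\<rparr>"
  have "contraction H' s' t' r a a' s t"
    by unfold_locales
      (use f t' r a a' bc \<open>b \<noteq> r\<close> \<open>c \<noteq> r\<close> in \<open>auto simp: s_def t_def b_def c_def\<close>)
  then have "contracts ?M M'"
    unfolding contracts_def by - (rule exI[of _ a], rule exI[of _ a'], simp add: H'_def s'_def t'_def r_def)
  then show ?thesis
    using a a' A(2) by (intro that[of ?M]) (auto simp: H'_def)
qed

lemma ex_splits:
  fixes M1 M2 :: "nat rmap"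
  assumes L1: "leg_map p n M1" and L2: "leg_map q m M2"
    and A: "finite A" "half_edges M1 \<inter> A = {}" "half_edges M2 \<inter> A = {}"
    and disj: "half_edges M1 \<inter> half_edges M2 = {}"
  obtains M where "splits M M1 M2" "half_edges M \<inter> A = {}"
proof -
  let ?H1 = "half_edges M1" and ?H2 = "half_edges M2"
  define a r where "a = root M1" and "r = root M2"
  have f1: "perm_on (rot M1) ?H1" and f2: "perm_on (rot M2) ?H2"
    using L1 L2 by (simp_all add: leg_map_def)
  have a: "a \<in> ?H1" "opp M1 a = a" and r: "r \<in> ?H2" "opp M2 r = r"
    using L1 L2 by (simp_all add: leg_map_def a_def r_def)
  have t1: "opp M1 d \<in> ?H1" "opp M1 (opp M1 d) = d" if "d \<in> ?H1" for d
    using L1 that by (simp_all add: leg_map_def)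
  have t2: "opp M2 d \<in> ?H2" "opp M2 (opp M2 d) = d" if "d \<in> ?H2" for d
    using L2 that by (simp_all add: leg_map_def)
  define s0 where "s0 d = (if d \<in> ?H1 then rot M1 d else rot M2 d)" for d
  define t0 where "t0 d = (if d \<in> ?H1 then opp M1 d else opp M2 d)" for d
  have e1: "s0 d = rot M1 d" "t0 d = opp M1 d" if "d \<in> ?H1" for d
    using that by (simp_all add: s0_def t0_def)
  have e2: "s0 d = rot M2 d" "t0 d = opp M2 d" if "d \<in> ?H2" for d
    using that disj by (auto simp: s0_def t0_def)
  have "perm_on s0 ?H1" "perm_on s0 ?H2"
    using perm_on_cong[OF f1] perm_on_cong[OF f2] e1 e2 by metis+
  then have f: "perm_on s0 (?H1 \<union> ?H2)"
    using disj by (intro perm_on_Un)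
  have fin: "finite (?H1 \<union> ?H2 \<union> A)"
    using A perm_onD(1)[OF f] by simp
  obtain a' where a': "a' \<notin> ?H1 \<union> ?H2 \<union> A"
    using ex_new_if_finite[OF infinite_UNIV_nat fin] by blast
  define s where "s d = (if d = r then a else if d = a' then s0 r else if s0 d = a then a' else s0 d)" for d
  define t where "t = t0(a := a', a' := a)"
  have "a \<noteq> r"
    using a r disj by auto
  have "s0 r \<in> ?H2"
    using e2(1)[OF r(1)] perm_onD(2)[OF f2 r(1)] by simp
  have neq: "a' \<noteq> a" "a' \<noteq> r"
    using a r a' by auto
  have loop: "loop_insertion (?H1 \<union> ?H2) s0 t0 a r a' s t"
  proof
    show "t0 d \<in> ?H1 \<union> ?H2" "t0 (t0 d) = d" if "d \<in> ?H1 \<union> ?H2" for d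
      using that e1 e2 t1 t2 by auto
    show "s0 r \<noteq> a"
      using \<open>s0 r \<in> ?H2\<close> a disj by auto
    show "s d = (if s0 d = a then a' else s0 d)" if "d \<in> ?H1 \<union> ?H2" "d \<noteq> r" for d
      using that a' by (auto simp: s_def)
    show "t d = t0 d" if "d \<in> ?H1 \<union> ?H2" "d \<noteq> a" for d
      using that a' by (auto simp: t_def)
  qed (use f a r \<open>a \<noteq> r\<close> e1 e2 a' neq in \<open>simp_all add: s_def t_def\<close>)
  let ?M = "\<lparr>half_edges = insert a' (?H1 \<union> ?H2), rot = s, opp = t, root = r\<rparr>"
  have "splits ?M M1 M2"
    unfolding splits_def
    by (rule exI[of _ s0], rule exI[of _ t0], rule exI[of _ a'])
      (use loop disj e1 e2 leg_map_connected_rmap[OF L1] leg_map_connected_rmap[OF L2] a r in \<open>simp add: a_def r_def\<close>)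
  then show ?thesis
    using a' A by (intro that[of ?M]) auto
qed

text \<open>The set \<open>A\<close> of forbidden half-edges is there so that the maps for the two
  branches of a \<open>Split\<close> can be chosen disjoint; natural numbers supply fresh
  half-edges.\<close>

lemma ex_map:
  assumes "shape p n x" "finite A"
  shows "\<exists>M :: nat rmap. codes M x \<and> leg_map p n M \<and> half_edges M \<inter> A = {}"
  using assms
proof (induction arbitrary: A)
  case point
  obtain r :: nat where r: "r \<notin> A"
    using ex_new_if_finite[OF infinite_UNIV_nat point] by blast
  let ?M = "\<lparr>half_edges = {r}, rot = id, opp = id, root = r\<rparr>"
  have "orbit id r = {r}" "orbit (id \<circ> id) r = {r}"
    by (simp_all add: orbit_eq_singleton_iff)
  then have "leg_map 0 0 ?M"
    by (auto simp: leg_map_def num_orbits_def perm_on_def)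
  moreover have "codes ?M Point"
    by (rule codes.point) simp_all
  ultimately show ?case
    using r by (intro exI[of _ ?M]) simp
next
  case (contract p n x)
  obtain M' :: "nat rmap" where M': "codes M' x" "leg_map (Suc (Suc p)) n M'" "half_edges M' \<inter> A = {}"
    using contract by blast
  obtain M where M: "contracts M M'" "half_edges M \<inter> A = {}"
    using ex_contracts[OF M'(2) contract.prems M'(3)] .
  then show ?case
    using codes.contract[OF M(1) M'(1)] contracts_up[OF M(1) M'(2)] by blast
next
  case (split p n x q m y)
  obtain M1 :: "nat rmap" where M1: "codes M1 x" "leg_map p n M1" "half_edges M1 \<inter> A = {}"
    using split.IH(1)[OF split.prems] by blast
  have "finite (half_edges M1)"
    using M1(2) by (simp add: leg_map_def perm_on_def)
  then have "finite (A \<union> half_edges M1)"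
    using split.prems by simp
  then obtain M2 :: "nat rmap" where M2: "codes M2 y" "leg_map q m M2" "half_edges M2 \<inter> (A \<union> half_edges M1) = {}"
    using split.IH(2)[OF \<open>finite (A \<union> half_edges M1)\<close>] by blast
  then have "half_edges M2 \<inter> A = {}" "half_edges M1 \<inter> half_edges M2 = {}"
    by auto
  then obtain M where M: "splits M M1 M2" "half_edges M \<inter> A = {}"
    using ex_splits[OF M1(2) M2(2) split.prems M1(3)] by metis
  then show ?case
    using codes.split[OF M(1) M1(1) M2(1)] splits_up[OF M(1) M1(2) M2(2)] by blast
qed

section \<open>Contraction and splitting respect isomorphism in both directions\<close>

lemma bij_betw_insert:
  assumes "bij_betw f A B" "a \<notin> A" "b \<notin> B"
  shows "bij_betw (f(a := b)) (insert a A) (insert b B)"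
proof -
  have "(f(a := b)) ` A = f ` A"
    using assms(2) by (intro image_cong) auto
  then show ?thesis
    using assms unfolding bij_betw_def by (simp add: inj_on_fun_updI)
qed

text \<open>The places where the new edge is attached, \<open>b\<close> and \<open>c\<close>, are
  reached from the root by \<open>rot\<close>, so an isomorphism matches them and extends by
  matching the new half-edges.\<close>

lemma contracts_iso_extend:
  assumes "contracts M M'" "contracts N N'" "rmap_iso M' N'"
  shows "rmap_iso M N"
proof -
  obtain a a' where HM: "half_edges M = insert a' (insert a (half_edges M'))" and rM: "root M = root M'"
    and "contraction (half_edges M') (rot M') (opp M') (root M') a a' (rot M) (opp M)"
    using assms(1) unfolding contracts_def by blast
  then interpret m: contraction "half_edges M'" "rot M'" "opp M'" "root M'" a a' "rot M" "opp M"
    by simp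
  obtain e e' where HN: "half_edges N = insert e' (insert e (half_edges N'))" and rN: "root N = root N'"
    and "contraction (half_edges N') (rot N') (opp N') (root N') e e' (rot N) (opp N)"
    using assms(2) unfolding contracts_def by blast
  then interpret n: contraction "half_edges N'" "rot N'" "opp N'" "root N'" e e' "rot N" "opp N"
    by simp
  obtain f where f: "bij_betw f (half_edges M') (half_edges N')"
    "\<And>d. d \<in> half_edges M' \<Longrightarrow> f (rot M' d) = rot N' (f d)"
    "\<And>d. d \<in> half_edges M' \<Longrightarrow> f (opp M' d) = opp N' (f d)"
    "f (root M') = root N'"
    using assms(3) unfolding rmap_iso_def by blast
  define g where "g = f(a := e, a' := e')"
  have g: "g d = f d" if "d \<in> half_edges M'" for d
    using that m.new by (auto simp: g_def)
  have ga: "g a = e" "g a' = e'"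
    using m.new by (simp_all add: g_def)
  have b: "f m.b = n.b" "f m.c = n.c" "f (rot M' m.c) = rot N' n.c"
    using f(2,4) m.in_H' by simp_all
  have f_in: "f d \<in> half_edges N'" if "d \<in> half_edges M'" for d
    using f(1) that by (rule bij_betw_apply)
  have inj: "f d = f d' \<longleftrightarrow> d = d'" if "d \<in> half_edges M'" "d' \<in> half_edges M'" for d d'
    using f(1) that by (meson bij_betw_def inj_onD)
  have "bij_betw g (half_edges M) (half_edges N)"
    unfolding HM HN g_def using f(1) m.new n.new by (intro bij_betw_insert) auto
  moreover have "g (rot M d) = rot N (g d) \<and> g (opp M d) = opp N (g d)" if dM: "d \<in> half_edges M" for d
  proof -
    consider "d = a" | "d = a'" | "d = root M'" | "d = m.c" "d \<noteq> root M'"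
      | "d \<in> half_edges M'" "d \<noteq> root M'" "d \<noteq> m.c"
      using dM unfolding HM by blast
    then show ?thesis
    proof cases
      case 5
      then have "rot M d \<in> half_edges M'" "f d \<noteq> root N'" "f d \<noteq> n.c"
        using perm_onD(2)[OF m.s' 5(1)] m.s(5)[OF 5] inj[OF 5(1), of "root M'"] inj[OF 5(1), of m.c]
          5(2,3) f(4) b m.in_H' by simp_all
      then show ?thesis
        using 5 m.s(5)[of d] n.s(5)[of "f d"] f_in[of d] f(2)[of d] f(3)[of d] m.t(3)[of d] n.t(3)[of "f d"]
          m.t'(1)[of d] by (simp add: g)
    next
      case 3
      then show ?thesis
        using m.s n.s m.t(3)[of d] n.t(3)[of "root N'"] m.r n.r f(4) by (simp add: g ga)
    next
      case 4
      then show ?thesis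
        using m.s n.s m.t(3)[of d] n.t(3)[of n.c] b f(3)[of d] m.t'(1)[of d] by (simp add: g ga)
    qed (use m.s n.s m.t n.t b m.in_H' in \<open>simp_all add: g ga\<close>)
  qed
  moreover have "g (root M) = root N"
    using f(4) by (simp add: rM rN g)
  ultimately show ?thesis
    unfolding rmap_iso_def by blast
qed

text \<open>The contracted edge is canonical: \<open>a\<close> is the half-edge after the root and
  \<open>a'\<close> is opposite to it. Hence every isomorphism matches these edges and can be
  restricted to the rest.\<close>

lemma contracts_iso_restrict:
  assumes "contracts M M'" "contracts N N'" "rmap_iso M N"
  shows "rmap_iso M' N'"
proof -
  obtain a a' where HM: "half_edges M = insert a' (insert a (half_edges M'))" and rM: "root M = root M'"
    and "contraction (half_edges M') (rot M') (opp M') (root M') a a' (rot M) (opp M)"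
    using assms(1) unfolding contracts_def by blast
  then interpret m: contraction "half_edges M'" "rot M'" "opp M'" "root M'" a a' "rot M" "opp M"
    by simp
  obtain e e' where HN: "half_edges N = insert e' (insert e (half_edges N'))" and rN: "root N = root N'"
    and "contraction (half_edges N') (rot N') (opp N') (root N') e e' (rot N) (opp N)"
    using assms(2) unfolding contracts_def by blast
  then interpret n: contraction "half_edges N'" "rot N'" "opp N'" "root N'" e e' "rot N" "opp N"
    by simp
  obtain f where f: "bij_betw f (half_edges M) (half_edges N)"
    "\<And>d. d \<in> half_edges M \<Longrightarrow> f (rot M d) = rot N (f d)"
    "\<And>d. d \<in> half_edges M \<Longrightarrow> f (opp M d) = opp N (f d)"
    "f (root M') = root N'"
    using assms(3) unfolding rmap_iso_def rM rN by blast
  have fa: "f a = e" "f a' = e'"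
    using f(2)[of "root M'"] f(3)[of a] f(4) m.s n.s m.t n.t HM by simp_all
  have fb: "f m.b = n.b"
    using f(2)[of a'] fa m.s n.s HM by simp
  have fc: "f m.c = n.c"
    using f(2)[of m.b] fb m.s_b n.s_b HM by simp
  have fd: "f (rot M' m.c) = rot N' n.c"
    using f(2)[of a] fa m.s n.s HM by simp
  have inj: "f d = f d' \<longleftrightarrow> d = d'" if "d \<in> half_edges M" "d' \<in> half_edges M" for d d'
    using f(1) that by (meson bij_betw_def inj_onD)
  have "bij_betw f (half_edges M - {a, a'}) (half_edges N - {e, e'})"
    using f(1) fa HM HN inj by (intro bij_betw_DiffI) (auto simp: bij_betw_def)
  moreover have "half_edges M - {a, a'} = half_edges M'" "half_edges N - {e, e'} = half_edges N'"
    using HM HN m.new n.new by auto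
  ultimately have bij: "bij_betw f (half_edges M') (half_edges N')"
    by simp
  have "f (rot M' d) = rot N' (f d) \<and> f (opp M' d) = opp N' (f d)" if "d \<in> half_edges M'" for d
  proof
    have d: "d \<in> half_edges M" "f d \<in> half_edges N'"
      using that HM bij_betw_apply[OF bij] by auto
    show "f (opp M' d) = opp N' (f d)"
      using f(3)[OF d(1)] m.t(3)[OF that] n.t(3)[OF d(2)] by simp
    show "f (rot M' d) = rot N' (f d)"
    proof (cases "d = root M' \<or> d = m.c")
      case True
      then show ?thesis
        using f(4) fb fc fd by auto
    next
      case False
      then have "f d \<noteq> root N'" "f d \<noteq> n.c"
        using inj[OF d(1), of "root M'"] inj[OF d(1), of m.c] f(4) fc HM by auto
      then show ?thesis
        using f(2)[OF d(1)] m.s(5)[OF that] n.s(5)[OF d(2)] False by simp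
    qed
  qed
  then show ?thesis
    unfolding rmap_iso_def using bij f(4) by blast
qed

lemma splits_iso_extend:
  assumes M: "splits M M1 M2" and N: "splits N N1 N2" and iso: "rmap_iso M1 N1" "rmap_iso M2 N2"
  shows "rmap_iso M N"
proof -
  let ?H = "half_edges M1 \<union> half_edges M2" and ?K = "half_edges N1 \<union> half_edges N2"
  obtain s0 t0 a' where HM: "half_edges M = insert a' ?H" and rM: "root M = root M2"
    and dM: "half_edges M1 \<inter> half_edges M2 = {}"
    and rM1: "root M1 \<in> half_edges M1" and rM2: "root M2 \<in> half_edges M2"
    and eM1: "\<And>d. d \<in> half_edges M1 \<Longrightarrow> s0 d = rot M1 d" "\<And>d. d \<in> half_edges M1 \<Longrightarrow> t0 d = opp M1 d"
    and eM2: "\<And>d. d \<in> half_edges M2 \<Longrightarrow> s0 d = rot M2 d" "\<And>d. d \<in> half_edges M2 \<Longrightarrow> t0 d = opp M2 d"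
    and cM: "connected_rmap M1" "connected_rmap M2"
    and "loop_insertion ?H s0 t0 (root M1) (root M2) a' (rot M) (opp M)"
    using M unfolding splits_def by blast
  then interpret m: loop_insertion ?H s0 t0 "root M1" "root M2" a' "rot M" "opp M"
    by simp
  obtain u0 v0 e' where HN: "half_edges N = insert e' ?K" and rN: "root N = root N2"
    and dN: "half_edges N1 \<inter> half_edges N2 = {}"
    and eN1: "\<And>d. d \<in> half_edges N1 \<Longrightarrow> u0 d = rot N1 d" "\<And>d. d \<in> half_edges N1 \<Longrightarrow> v0 d = opp N1 d"
    and eN2: "\<And>d. d \<in> half_edges N2 \<Longrightarrow> u0 d = rot N2 d" "\<And>d. d \<in> half_edges N2 \<Longrightarrow> v0 d = opp N2 d"
    and "loop_insertion ?K u0 v0 (root N1) (root N2) e' (rot N) (opp N)"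
    using N unfolding splits_def by blast
  then interpret n: loop_insertion ?K u0 v0 "root N1" "root N2" e' "rot N" "opp N"
    by simp
  obtain f1 where f1: "bij_betw f1 (half_edges M1) (half_edges N1)"
    "\<And>d. d \<in> half_edges M1 \<Longrightarrow> f1 (rot M1 d) = rot N1 (f1 d)"
    "\<And>d. d \<in> half_edges M1 \<Longrightarrow> f1 (opp M1 d) = opp N1 (f1 d)"
    "f1 (root M1) = root N1"
    using iso(1) unfolding rmap_iso_def by blast
  obtain f2 where f2: "bij_betw f2 (half_edges M2) (half_edges N2)"
    "\<And>d. d \<in> half_edges M2 \<Longrightarrow> f2 (rot M2 d) = rot N2 (f2 d)"
    "\<And>d. d \<in> half_edges M2 \<Longrightarrow> f2 (opp M2 d) = opp N2 (f2 d)"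
    "f2 (root M2) = root N2"
    using iso(2) unfolding rmap_iso_def by blast
  define f where "f d = (if d \<in> half_edges M1 then f1 d else f2 d)" for d
  have bij: "bij_betw f ?H ?K"
    unfolding f_def using f1(1) f2(1) dM dN by (rule bij_betw_disjoint_Un)
  have f: "f (s0 d) = u0 (f d) \<and> f (t0 d) = v0 (f d)" if "d \<in> ?H" for d
  proof (cases "d \<in> half_edges M1")
    case True
    then have "rot M1 d \<in> half_edges M1" "opp M1 d \<in> half_edges M1" "f1 d \<in> half_edges N1"
      using cM(1) perm_onD(2) bij_betw_apply[OF f1(1)] by (auto simp: connected_rmap_def)
    then show ?thesis
      using True f1(2,3) eM1 eN1 by (simp add: f_def)
  next
    case False
    then have d: "d \<in> half_edges M2"
      using that by simp
    then have *: "rot M2 d \<in> half_edges M2" "opp M2 d \<in> half_edges M2" "f2 d \<in> half_edges N2"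
      using cM(2) perm_onD(2) bij_betw_apply[OF f2(1)] by (auto simp: connected_rmap_def)
    then have "rot M2 d \<notin> half_edges M1" "opp M2 d \<notin> half_edges M1"
      using dM by auto
    then show ?thesis
      using False d * f2(2,3) eM2 eN2 by (simp add: f_def)
  qed
  have fr: "f (root M1) = root N1" "f (root M2) = root N2"
    using f1(4) f2(4) rM1 rM2 dM by (auto simp: f_def)
  define g where "g = f(a' := e')"
  have g: "g d = f d" if "d \<in> ?H" for d
    using that m.new by (auto simp: g_def)
  have ga: "g a' = e'"
    by (simp add: g_def)
  have f_in: "f d \<in> ?K" if "d \<in> ?H" for d
    using bij that by (rule bij_betw_apply)
  have inj: "f d = f d' \<longleftrightarrow> d = d'" if "d \<in> ?H" "d' \<in> ?H" for d d'
    using bij that by (meson bij_betw_def inj_onD)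
  have s0_in: "s0 d \<in> ?H" if "d \<in> ?H" for d
    using perm_onD(2)[OF m.s0 that] .
  have "bij_betw g (half_edges M) (half_edges N)"
    unfolding HM HN g_def using bij m.new n.new by (rule bij_betw_insert)
  moreover have "g (rot M d) = rot N (g d)" if dM: "d \<in> half_edges M" for d
  proof -
    consider "d = a'" | "d = root M2" | "d \<in> ?H" "d \<noteq> root M2"
      using dM unfolding HM by blast
    then show ?thesis
    proof cases
      case 1
      then show ?thesis
        using f[OF m.ar(3)] s0_in[OF m.ar(3)] m.s(2) n.s(2) fr by (simp only: ga g)
    next
      case 2
      then show ?thesis
        using m.s(1) n.s(1) m.ar(1,3) fr by (simp only: g)
    next
      case 3
      have "f d \<noteq> root N2"
        using inj[OF 3(1) m.ar(3)] 3(2) fr by simp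
      then have "rot N (f d) = (if f (s0 d) = root N1 then e' else f (s0 d))"
        using n.s(3)[OF f_in[OF 3(1)]] f[OF 3(1)] by simp
      moreover have "f (s0 d) = root N1 \<longleftrightarrow> s0 d = root M1"
        using inj[OF s0_in[OF 3(1)] m.ar(1)] fr by simp
      ultimately show ?thesis
        using m.s(3)[OF 3] g[OF 3(1)] g[OF s0_in[OF 3(1)]] ga by simp
    qed
  qed
  moreover have "g (opp M d) = opp N (g d)" if dM: "d \<in> half_edges M" for d
  proof -
    consider "d = a'" | "d = root M1" | "d \<in> ?H" "d \<noteq> root M1"
      using dM unfolding HM by blast
    then show ?thesis
    proof cases
      case 1
      then show ?thesis
        using m.t(2) n.t(2) m.ar(1) fr by (simp only: ga g)
    next
      case 2
      then show ?thesis
        using m.t(1) n.t(1) m.ar(1) fr by (simp only: ga g)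
    next
      case 3
      then have "f d \<noteq> root N1"
        using inj[OF 3(1) m.ar(1)] fr by simp
      then show ?thesis
        using m.t(3)[OF 3] n.t(3)[OF f_in[OF 3(1)]] f[OF 3(1)] g[OF 3(1)] g[OF m.t0(1)[OF 3(1)]]
        by simp
    qed
  qed
  moreover have "g (root M) = root N"
    using fr m.ar(3) unfolding rM rN by (simp only: g)
  ultimately show ?thesis
    unfolding rmap_iso_def by blast
qed

text \<open>The loop is found from the root, so an isomorphism matches the two loops and restricts
  to the glued parts. It cannot mix the parts: each is connected, and the root of each goes to the
  root of its counterpart.\<close>

lemma splits_iso_restrict:
  assumes M: "splits M M1 M2" and N: "splits N N1 N2" and iso: "rmap_iso M N"
  shows "rmap_iso M1 N1" "rmap_iso M2 N2"
proof -
  let ?H = "half_edges M1 \<union> half_edges M2" and ?K = "half_edges N1 \<union> half_edges N2"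
  obtain s0 t0 a' where HM: "half_edges M = insert a' ?H" and rM: "root M = root M2"
    and dM: "half_edges M1 \<inter> half_edges M2 = {}"
    and rM1: "root M1 \<in> half_edges M1" and rM2: "root M2 \<in> half_edges M2"
    and eM1: "\<And>d. d \<in> half_edges M1 \<Longrightarrow> s0 d = rot M1 d" "\<And>d. d \<in> half_edges M1 \<Longrightarrow> t0 d = opp M1 d"
    and eM2: "\<And>d. d \<in> half_edges M2 \<Longrightarrow> s0 d = rot M2 d" "\<And>d. d \<in> half_edges M2 \<Longrightarrow> t0 d = opp M2 d"
    and cM: "connected_rmap M1" "connected_rmap M2"
    and "loop_insertion ?H s0 t0 (root M1) (root M2) a' (rot M) (opp M)"
    using M unfolding splits_def by blast
  then interpret m: loop_insertion ?H s0 t0 "root M1" "root M2" a' "rot M" "opp M"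
    by simp
  obtain u0 v0 e' where HN: "half_edges N = insert e' ?K" and rN: "root N = root N2"
    and dN: "half_edges N1 \<inter> half_edges N2 = {}"
    and rN1: "root N1 \<in> half_edges N1" and rN2: "root N2 \<in> half_edges N2"
    and eN1: "\<And>d. d \<in> half_edges N1 \<Longrightarrow> u0 d = rot N1 d" "\<And>d. d \<in> half_edges N1 \<Longrightarrow> v0 d = opp N1 d"
    and eN2: "\<And>d. d \<in> half_edges N2 \<Longrightarrow> u0 d = rot N2 d" "\<And>d. d \<in> half_edges N2 \<Longrightarrow> v0 d = opp N2 d"
    and cN: "connected_rmap N1" "connected_rmap N2"
    and "loop_insertion ?K u0 v0 (root N1) (root N2) e' (rot N) (opp N)"
    using N unfolding splits_def by blast
  then interpret n: loop_insertion ?K u0 v0 "root N1" "root N2" e' "rot N" "opp N"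
    by simp
  obtain f where bijM: "bij_betw f (half_edges M) (half_edges N)"
    and f: "\<And>d. d \<in> half_edges M \<Longrightarrow> f (rot M d) = rot N (f d)"
    "\<And>d. d \<in> half_edges M \<Longrightarrow> f (opp M d) = opp N (f d)"
    and fr: "f (root M2) = root N2"
    using iso unfolding rmap_iso_def rM rN by blast
  have fa: "f (root M1) = root N1"
    using f(1)[of "root M2"] fr m.s(1) n.s(1) HM rM2 by simp
  have fa': "f a' = e'"
    using f(2)[of "root M1"] fa m.t(1) n.t(1) HM rM1 by simp
  have inj: "f d = f d' \<longleftrightarrow> d = d'" if "d \<in> half_edges M" "d' \<in> half_edges M" for d d'
    using bijM that by (meson bij_betw_def inj_onD)
  have "bij_betw f (half_edges M - {a'}) (half_edges N - {e'})"
    using bijM fa' HM HN by (intro bij_betw_DiffI) (auto simp: bij_betw_def)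
  moreover have "half_edges M - {a'} = ?H" "half_edges N - {e'} = ?K"
    using HM HN m.new n.new by auto
  ultimately have bij: "bij_betw f ?H ?K"
    by simp
  have f_in: "f d \<in> ?K" if "d \<in> ?H" for d
    using bij that by (rule bij_betw_apply)
  have fs: "f (s0 d) = u0 (f d)" if d: "d \<in> ?H" for d
  proof (cases "d = root M2")
    case True
    then show ?thesis
      using f(1)[of a'] fa' fr m.s(2) n.s(2) HM by simp
  next
    case False
    have dM: "d \<in> half_edges M" "s0 d \<in> half_edges M" "root M1 \<in> half_edges M" "a' \<in> half_edges M"
      using d perm_onD(2)[OF m.s0 d] HM rM1 by auto
    have "f d \<noteq> root N2"
      using inj[OF dM(1), of "root M2"] False fr HM rM2 by simp
    then have 1: "f (rot M d) = (if u0 (f d) = root N1 then e' else u0 (f d))"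
      using f(1)[OF dM(1)] n.s(3)[OF f_in[OF d]] by simp
    have 2: "rot M d = (if s0 d = root M1 then a' else s0 d)"
      using m.s(3)[OF d False] .
    have "u0 (f d) \<noteq> e'"
      using perm_onD(2)[OF n.s0 f_in[OF d]] n.new by auto
    moreover have "f (s0 d) \<noteq> e'"
      using inj[OF dM(2,4)] fa' perm_onD(2)[OF m.s0 d] m.new by auto
    ultimately show ?thesis
      using 1 2 fa fa' by (auto split: if_splits)
  qed
  have ft: "f (t0 d) = v0 (f d)" if d: "d \<in> ?H" for d
  proof (cases "d = root M1")
    case True
    then show ?thesis
      using fa m.ar(2) n.ar(2) by simp
  next
    case False
    have dM: "d \<in> half_edges M"
      using d HM by auto
    have "f d \<noteq> root N1"
      using inj[OF dM, of "root M1"] False fa HM rM1 by simp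
    then show ?thesis
      using f(2)[OF dM] m.t(3)[OF d False] n.t(3)[OF f_in[OF d]] by simp
  qed
  \<comment> \<open>Both parts of \<open>N\<close> are closed under the glued permutations, so
    membership in the first part is constant along every path.\<close>
  have closed1: "u0 d \<in> half_edges N1 \<longleftrightarrow> d \<in> half_edges N1" "v0 d \<in> half_edges N1 \<longleftrightarrow> d \<in> half_edges N1"
    if "d \<in> ?K" for d
    using that dN eN1 eN2 cN unfolding connected_rmap_def by (metis UnE disjoint_iff perm_onD(2))+
  have 1: "f d \<in> half_edges N1" if d: "d \<in> half_edges M1" for d
  proof -
    have "(root M1, d) \<in> conn (half_edges M1) (rot M1) (opp M1)"
      using cM(1) d by (simp add: connected_rmap_def)
    then have "f (root M1) \<in> half_edges N1 \<longleftrightarrow> f d \<in> half_edges N1"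
    proof (rule conn_invariant)
      fix x assume x: "x \<in> half_edges M1"
      show "f x \<in> half_edges N1 \<longleftrightarrow> f (rot M1 x) \<in> half_edges N1"
        using fs[of x] x closed1[OF f_in[of x]] eM1(1)[OF x] by simp
      show "f x \<in> half_edges N1 \<longleftrightarrow> f (opp M1 x) \<in> half_edges N1"
        using ft[of x] x closed1[OF f_in[of x]] eM1(2)[OF x] by simp
    qed
    then show ?thesis
      using fa rN1 by simp
  qed
  have 2: "f d \<in> half_edges N2" if d: "d \<in> half_edges M2" for d
  proof -
    have "(root M2, d) \<in> conn (half_edges M2) (rot M2) (opp M2)"
      using cM(2) d by (simp add: connected_rmap_def)
    then have "f (root M2) \<in> half_edges N1 \<longleftrightarrow> f d \<in> half_edges N1"
    proof (rule conn_invariant)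
      fix x assume x: "x \<in> half_edges M2"
      show "f x \<in> half_edges N1 \<longleftrightarrow> f (rot M2 x) \<in> half_edges N1"
        using fs[of x] x closed1[OF f_in[of x]] eM2(1)[OF x] by simp
      show "f x \<in> half_edges N1 \<longleftrightarrow> f (opp M2 x) \<in> half_edges N1"
        using ft[of x] x closed1[OF f_in[of x]] eM2(2)[OF x] by simp
    qed
    then show ?thesis
      using fr rN2 dN f_in[of d] d by auto
  qed
  have img: "f ` ?H = ?K"
    using bij by (simp add: bij_betw_def)
  have "f ` half_edges M1 = half_edges N1"
  proof
    show "half_edges N1 \<subseteq> f ` half_edges M1"
    proof
      fix y assume y: "y \<in> half_edges N1"
      then have "y \<in> f ` ?H"
        unfolding img by simp
      then show "y \<in> f ` half_edges M1"
        using 2 y dN by auto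
    qed
  qed (use 1 in blast)
  then have b1: "bij_betw f (half_edges M1) (half_edges N1)"
    using bij inj_on_subset[of f ?H "half_edges M1"] by (simp add: bij_betw_def)
  have "f ` half_edges M2 = half_edges N2"
  proof
    show "half_edges N2 \<subseteq> f ` half_edges M2"
    proof
      fix y assume y: "y \<in> half_edges N2"
      then have "y \<in> f ` ?H"
        unfolding img by simp
      then show "y \<in> f ` half_edges M2"
        using 1 y dN by auto
    qed
  qed (use 2 in blast)
  then have b2: "bij_betw f (half_edges M2) (half_edges N2)"
    using bij inj_on_subset[of f ?H "half_edges M2"] by (simp add: bij_betw_def)
  have "f (rot M1 d) = rot N1 (f d) \<and> f (opp M1 d) = opp N1 (f d)" if "d \<in> half_edges M1" for d
    using that fs[of d] ft[of d] eM1[of d] eN1[OF 1[OF that]] by simp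
  then show "rmap_iso M1 N1"
    unfolding rmap_iso_def using b1 fa by blast
  have "f (rot M2 d) = rot N2 (f d) \<and> f (opp M2 d) = opp N2 (f d)" if "d \<in> half_edges M2" for d
    using that fs[of d] ft[of d] eM2[of d] eN2[OF 2[OF that]] by simp
  then show "rmap_iso M2 N2"
    unfolding rmap_iso_def using b2 fr by blast
qed

section \<open>Codes as complete invariants of isomorphism\<close>

lemma contracts_kind:
  assumes "contracts M M'"
  shows "rot M (root M) \<noteq> root M" "opp M (rot M (root M)) \<notin> orbit (rot M) (root M)"
    "perm_on (rot M) (half_edges M)" "root M \<in> half_edges M" "d \<in> half_edges M \<Longrightarrow> opp M d \<in> half_edges M"
proof -
  obtain a a' where HM: "half_edges M = insert a' (insert a (half_edges M'))" and rM: "root M = root M'"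
    and "contraction (half_edges M') (rot M') (opp M') (root M') a a' (rot M) (opp M)"
    using assms(1) unfolding contracts_def by blast
  then interpret contraction "half_edges M'" "rot M'" "opp M'" "root M'" a a' "rot M" "opp M"
    by simp
  have "a' \<notin> orbit (rot M) (root M')"
    unfolding orbit_root using orbit_subset_perm_on[OF s' r(1)] new by auto
  then show "opp M (rot M (root M)) \<notin> orbit (rot M) (root M)"
    unfolding rM s(1) t(1) .
  show "rot M (root M) \<noteq> root M" "perm_on (rot M) (half_edges M)" "root M \<in> half_edges M"
    "d \<in> half_edges M \<Longrightarrow> opp M d \<in> half_edges M"
    using s(1) distinct perm_on_s t_H unfolding rM HM by auto
qed

lemma splits_kind:
  assumes "splits M M1 M2"
  shows "rot M (root M) \<noteq> root M" "opp M (rot M (root M)) \<in> orbit (rot M) (root M)"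
    "perm_on (rot M) (half_edges M)" "root M \<in> half_edges M" "d \<in> half_edges M \<Longrightarrow> opp M d \<in> half_edges M"
proof -
  let ?H = "half_edges M1 \<union> half_edges M2"
  obtain s0 t0 a' where HM: "half_edges M = insert a' ?H" and rM: "root M = root M2"
    and dM: "half_edges M1 \<inter> half_edges M2 = {}"
    and rM1: "root M1 \<in> half_edges M1" and rM2: "root M2 \<in> half_edges M2"
    and eM2: "\<And>d. d \<in> half_edges M2 \<Longrightarrow> s0 d = rot M2 d"
    and cM: "connected_rmap M2"
    and "loop_insertion ?H s0 t0 (root M1) (root M2) a' (rot M) (opp M)"
    using assms unfolding splits_def by blast
  then interpret loop_insertion ?H s0 t0 "root M1" "root M2" a' "rot M" "opp M"
    by simp
  have "orbit s0 (root M2) \<subseteq> half_edges M2"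
    using cM eM2 rM2 perm_onD(2) by (intro orbit_subset_closed) (auto simp: connected_rmap_def)
  then have "root M1 \<notin> orbit s0 (root M2)"
    using rM1 dM by auto
  then show "opp M (rot M (root M)) \<in> orbit (rot M) (root M)"
    unfolding rM s(1) t(1) using orbit_root by blast
  show "rot M (root M) \<noteq> root M" "perm_on (rot M) (half_edges M)" "root M \<in> half_edges M"
    "d \<in> half_edges M \<Longrightarrow> opp M d \<in> half_edges M"
    using s(1) ar perm_on_s t_H unfolding rM HM by auto
qed

text \<open>These two conditions at the root decide which constructor a code starts with. Their
  invariance is why isomorphic maps cannot have codes with different constructors.\<close>

lemma iso_kind:
  assumes iso: "rmap_iso M N" and M: "perm_on (rot M) (half_edges M)" "root M \<in> half_edges M"
    "\<And>d. d \<in> half_edges M \<Longrightarrow> opp M d \<in> half_edges M"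
  shows "rot M (root M) = root M \<longleftrightarrow> rot N (root N) = root N"
    "opp M (rot M (root M)) \<in> orbit (rot M) (root M) \<longleftrightarrow> opp N (rot N (root N)) \<in> orbit (rot N) (root N)"
proof -
  obtain f where f: "bij_betw f (half_edges M) (half_edges N)"
    "\<And>d. d \<in> half_edges M \<Longrightarrow> f (rot M d) = rot N (f d)"
    "\<And>d. d \<in> half_edges M \<Longrightarrow> f (opp M d) = opp N (f d)"
    "f (root M) = root N"
    using iso unfolding rmap_iso_def by blast
  have inj: "f d = f d' \<longleftrightarrow> d = d'" if "d \<in> half_edges M" "d' \<in> half_edges M" for d d'
    using f(1) that by (meson bij_betw_def inj_onD)
  note r = perm_onD(2)[OF M(1,2)]
  have 1: "f (rot M (root M)) = rot N (root N)" "f (opp M (rot M (root M))) = opp N (rot N (root N))"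
    using f(2)[OF M(2)] f(3)[OF r] f(4) by simp_all
  show "rot M (root M) = root M \<longleftrightarrow> rot N (root N) = root N"
    using inj[OF r M(2)] 1 f(4) by simp
  have "orbit (rot N) (root N) = f ` orbit (rot M) (root M)"
    using orbit_image[of "rot M" "half_edges M" "root M" f "rot N"] M f by simp
  moreover have "opp M (rot M (root M)) \<in> orbit (rot M) (root M)
    \<longleftrightarrow> f (opp M (rot M (root M))) \<in> f ` orbit (rot M) (root M)"
    using inj[OF M(3)[OF r]] orbit_subset_perm_on[OF M(1,2)] by (auto simp: image_iff)
  ultimately show "opp M (rot M (root M)) \<in> orbit (rot M) (root M) \<longleftrightarrow> opp N (rot N (root N)) \<in> orbit (rot N) (root N)"
    using 1 by simp
qed

lemma codes_iso:
  assumes "codes M x" "codes N x"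
  shows "rmap_iso M N"
  using assms
proof (induction arbitrary: N)
  case (point M)
  then have "half_edges N = {root N}" "rot N (root N) = root N" "opp N (root N) = root N"
    by (auto elim: codes.cases)
  then show ?case
    unfolding rmap_iso_def using point by (intro exI[of _ "\<lambda>_. root N"]) (simp add: bij_betw_def)
next
  case (contract M M' x)
  from contract.prems obtain N' where "contracts N N'" "codes N' x"
    by cases auto
  then show ?case
    using contracts_iso_extend contract by blast
next
  case (split M M1 M2 x y)
  from split.prems obtain N1 N2 where "splits N N1 N2" "codes N1 x" "codes N2 y"
    by cases auto
  then show ?case
    using splits_iso_extend split by blast
qed

lemma iso_codes:
  assumes "codes M x" "codes N y" "rmap_iso M N"
  shows "x = y"
  using assms
proof (induction arbitrary: N y)
  case (point M)
  have M: "perm_on (rot M) (half_edges M)" "root M \<in> half_edges M"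
    "\<And>d. d \<in> half_edges M \<Longrightarrow> opp M d \<in> half_edges M"
    using point by (simp_all add: perm_on_def)
  have "rot N (root N) = root N"
    using iso_kind(1)[OF point(5) M] point(2) by simp
  with point(4) show ?case
    by cases (auto dest: contracts_kind(1) splits_kind(1))
next
  case (contract M M' x)
  note k = contracts_kind[OF contract.hyps(1)]
  have N: "rot N (root N) \<noteq> root N" "opp N (rot N (root N)) \<notin> orbit (rot N) (root N)"
    using iso_kind[OF contract.prems(2) k(3-5)] k(1,2) by simp_all
  from contract.prems(1) obtain N' y' where "y = Contract y'" "contracts N N'" "codes N' y'"
    by cases (use N splits_kind(2) in auto)
  then show ?case
    using contract.IH contracts_iso_restrict[OF contract.hyps(1) _ contract.prems(2)] by blast
next
  case (split M M1 M2 x1 x2)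
  note k = splits_kind[OF split.hyps(1)]
  have N: "rot N (root N) \<noteq> root N" "opp N (rot N (root N)) \<in> orbit (rot N) (root N)"
    using iso_kind[OF split.prems(2) k(3-5)] k(1,2) by simp_all
  from split.prems(1) obtain N1 N2 y1 y2 where "y = Split y1 y2" "splits N N1 N2" "codes N1 y1" "codes N2 y2"
    by cases (use N contracts_kind(2) in auto)
  then show ?case
    using split.IH splits_iso_restrict[OF split.hyps(1) _ split.prems(2)] by blast
qed

section \<open>Cubic maps and maps with one leg\<close>

text \<open>From a rooted map to a map with a leg: \<open>r\<close> is inserted at the root vertex
  just before the root half-edge \<open>q\<close>, so that the edge next to the leg is the root edge
  and \<open>q\<close> can be recovered as \<open>s0 r\<close>.\<close>

locale stub =
  fixes H :: "'a set" and s t :: "'a \<Rightarrow> 'a" and q r :: 'a and s0 t0 :: "'a \<Rightarrow> 'a"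
  assumes s: "perm_on s H"
    and t: "\<And>d. d \<in> H \<Longrightarrow> t d \<in> H" "\<And>d. d \<in> H \<Longrightarrow> t (t d) = d"
    and q: "q \<in> H"
    and new: "r \<notin> H"
    and s0: "s0 r = q" "\<And>d. d \<in> H \<Longrightarrow> s0 d = (if s d = q then r else s d)"
    and t0: "t0 r = r" "\<And>d. d \<in> H \<Longrightarrow> t0 d = t d"
begin

abbreviation "H0 \<equiv> insert r H"

lemma perm_on_s0: "perm_on s0 H0"
proof (rule perm_on_surjI)
  show "finite H0"
    using perm_onD(1)[OF s] by simp
  show "H0 \<subseteq> s0 ` H0"
  proof
    fix y assume "y \<in> H0"
    then consider "y = r" | "y = q" | "y \<in> H" "y \<noteq> q"
      by auto
    then show "y \<in> s0 ` H0"
    proof cases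
      case 1
      obtain x where "x \<in> H" "s x = q"
        using perm_on_preimage[OF s q] .
      then show ?thesis
        using 1 s0(2)[of x] by (auto simp: image_iff)
    next
      case 2
      then show ?thesis
        using s0(1) by auto
    next
      case 3
      obtain x where "x \<in> H" "s x = y"
        using perm_on_preimage[OF s 3(1)] .
      then have "x \<in> H0" "s0 x = y"
        using 3 s0(2)[of x] by simp_all
      then show ?thesis
        by blast
    qed
  qed
qed

lemma t0_H0: "d \<in> H0 \<Longrightarrow> t0 d \<in> H0" "d \<in> H0 \<Longrightarrow> t0 (t0 d) = d"
  using t t0 by auto

lemma perm_on_t0: "perm_on t0 H0"
  using t0_H0 perm_onD(1)[OF s] by (intro perm_on_involution) simp_all

lemma q_neq: "q \<noteq> r"
  using q new by auto

lemma s_skip: "d \<in> H \<Longrightarrow> s d = skip r s0 d"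
  using s0 perm_onD(2)[OF s, of d] new by (auto simp: skip_def)

lemma orbit_s:
  assumes x: "x \<in> H"
  shows "orbit s x = orbit s0 x - {r}"
proof -
  have "orbit s x = orbit (skip r s0) x"
    using x s_skip s by (intro orbit_cong_closed[of s H]) (simp_all add: perm_on_def)
  also have "\<dots> = orbit s0 x - {r}"
    using q_neq s0(1) by (intro orbit_skip[OF perm_on_s0 new _ x]) simp
  finally show ?thesis .
qed

lemma card_orbit_root: "card (orbit s0 r) = card (orbit s q) + 1"
proof -
  have r: "r \<in> orbit s0 r"
    by (rule self_in_orbit[OF perm_on_s0]) simp
  have "orbit s0 q = orbit s0 r"
    using self_in_orbit_step[OF r] s0 by simp
  then have "orbit s q = orbit s0 r - {r}"
    using orbit_s[OF q] by simp
  moreover have "finite (orbit s0 r)"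
    by (rule finite_orbit[OF r])
  ultimately show ?thesis
    using r card_Suc_Diff1 by fastforce
qed

lemma orbit_other:
  assumes "d \<in> H0" "d \<notin> orbit s0 r"
  shows "d \<in> H" "orbit s0 d = orbit s d"
proof -
  show d: "d \<in> H"
    using assms self_in_orbit[OF perm_on_s0, of r] by auto
  have "r \<notin> orbit s0 d"
    using assms orbit_eq[OF perm_on_s0, of d r] self_in_orbit[OF perm_on_s0, of d] by auto
  then show "orbit s0 d = orbit s d"
    using orbit_s[OF d] by simp
qed

text \<open>The leg juts into a single face; skipping it in that cycle restores the old face, which
  is not empty since \<open>r\<close> is followed by \<open>q\<close>.\<close>

lemma num_orbits_faces: "num_orbits (s0 \<circ> t0) H0 = num_orbits (s \<circ> t) H"
proof -
  have st: "(s \<circ> t) d = skip r (s0 \<circ> t0) d" if "d \<in> H" for d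
    using s_skip[OF t(1)[OF that]] t0 that by (simp add: skip_def)
  have "num_orbits (s \<circ> t) H = num_orbits (skip r (s0 \<circ> t0)) H"
    by (rule num_orbits_cong[OF _ st]) (use t(1) perm_onD(2)[OF s] in auto)
  also have "\<dots> = num_orbits (s0 \<circ> t0) H0"
    using perm_on_comp[OF perm_on_s0 perm_on_t0] new t0 s0 q_neq by (intro num_orbits_skip) simp_all
  finally show ?thesis
    by simp
qed

lemma connected_iff:
  "(\<forall>d\<in>H0. (r, d) \<in> conn H0 s0 t0) \<longleftrightarrow> (\<forall>d\<in>H. (q, d) \<in> conn H s t)"
proof
  assume L: "\<forall>d\<in>H0. (r, d) \<in> conn H0 s0 t0"
  define p where "p = id(r := q)"
  have p: "p d = d" if "d \<in> H" for d
    using that new by (auto simp: p_def)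
  have pr: "p r = q"
    by (simp add: p_def)
  show "\<forall>d\<in>H. (q, d) \<in> conn H s t"
  proof
    fix d assume d: "d \<in> H"
    have "(p r, p d) \<in> conn H s t"
    proof (rule conn_map[where p = p])
      show "(r, d) \<in> conn H0 s0 t0"
        using L d by simp
      fix e assume "e \<in> H0"
      then consider "e = r" | "e \<in> H"
        by auto
      note cases = this
      from cases show "(p e, p (t0 e)) \<in> conn H s t"
        by cases (simp_all add: t0 pr p t conn_step)
      from cases show "(p e, p (s0 e)) \<in> conn H s t"
      proof cases
        case 1
        then show ?thesis
          using s0 p q pr by simp
      next
        case 2
        then have "p (s0 e) = s e"
          using s0(2)[OF 2] p[OF perm_onD(2)[OF s 2]] pr by auto
        then show ?thesis
          using p[OF 2] conn_step(1)[OF 2] by simp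
      qed
    qed
    then show "(q, d) \<in> conn H s t"
      using pr p[OF d] by simp
  qed
next
  assume R: "\<forall>d\<in>H. (q, d) \<in> conn H s t"
  have rq: "(r, q) \<in> conn H0 s0 t0"
    using conn_step(1)[of r H0 s0 t0] s0 by simp
  have *: "(q, d) \<in> conn H0 s0 t0" if "d \<in> H" for d
  proof (rule conn_sub)
    show "(q, d) \<in> conn H s t"
      using R that by simp
    fix e assume e: "e \<in> H"
    show "(e, t e) \<in> conn H0 s0 t0"
      using e conn_step(2)[of e H0 t0 s0] by (simp add: t0)
    have es: "(e, s0 e) \<in> conn H0 s0 t0"
      using e conn_step(1)[of e H0 s0 t0] by simp
    show "(e, s e) \<in> conn H0 s0 t0"
    proof (cases "s e = q")
      case True
      then have "(e, r) \<in> conn H0 s0 t0"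
        using es s0(2)[OF e] by simp
      then show ?thesis
        using True rq conn_trans by metis
    next
      case False
      then show ?thesis
        using es s0(2)[OF e] by simp
    qed
  qed
  show "\<forall>d\<in>H0. (r, d) \<in> conn H0 s0 t0"
    using * rq by (auto intro: conn_trans)
qed

end

definition stub_of :: "'a rmap \<Rightarrow> 'a rmap \<Rightarrow> bool" where
  "stub_of M0 M \<longleftrightarrow> half_edges M0 = insert (root M0) (half_edges M) \<and>
     stub (half_edges M) (rot M) (opp M) (root M) (root M0) (rot M0) (opp M0)"

lemma stub_iso_extend:
  assumes "stub_of M0 M" "stub_of N0 N" "rmap_iso M N"
  shows "rmap_iso M0 N0"
proof -
  have HM: "half_edges M0 = insert (root M0) (half_edges M)"
    and HN: "half_edges N0 = insert (root N0) (half_edges N)"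
    using assms(1,2) by (simp_all add: stub_of_def)
  interpret m: stub "half_edges M" "rot M" "opp M" "root M" "root M0" "rot M0" "opp M0"
    using assms(1) by (simp add: stub_of_def)
  interpret n: stub "half_edges N" "rot N" "opp N" "root N" "root N0" "rot N0" "opp N0"
    using assms(2) by (simp add: stub_of_def)
  obtain f where f: "bij_betw f (half_edges M) (half_edges N)"
    "\<And>d. d \<in> half_edges M \<Longrightarrow> f (rot M d) = rot N (f d)"
    "\<And>d. d \<in> half_edges M \<Longrightarrow> f (opp M d) = opp N (f d)"
    "f (root M) = root N"
    using assms(3) unfolding rmap_iso_def by blast
  define g where "g = f(root M0 := root N0)"
  have g: "g d = f d" if "d \<in> half_edges M" for d
    using that m.new by (auto simp: g_def)
  have gr: "g (root M0) = root N0"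
    by (simp add: g_def)
  have f_in: "f d \<in> half_edges N" if "d \<in> half_edges M" for d
    using f(1) that by (rule bij_betw_apply)
  have inj: "f d = f d' \<longleftrightarrow> d = d'" if "d \<in> half_edges M" "d' \<in> half_edges M" for d d'
    using f(1) that by (meson bij_betw_def inj_onD)
  have "bij_betw g (half_edges M0) (half_edges N0)"
    unfolding HM HN g_def using f(1) m.new n.new by (rule bij_betw_insert)
  moreover have "g (rot M0 d) = rot N0 (g d) \<and> g (opp M0 d) = opp N0 (g d)" if "d \<in> half_edges M0" for d
  proof (cases "d = root M0")
    case True
    then show ?thesis
      using m.s0(1) n.s0(1) m.t0(1) n.t0(1) g[OF m.q] f(4) gr by simp
  next
    case False
    then have d: "d \<in> half_edges M"
      using that HM by simp
    have s: "rot M d \<in> half_edges M"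
      using perm_onD(2)[OF m.s d] .
    have "f (rot M d) = root N \<longleftrightarrow> rot M d = root M"
      using inj[OF s m.q] f(4) by simp
    then have "g (rot M0 d) = rot N0 (g d)"
      using m.s0(2)[OF d] n.s0(2)[OF f_in[OF d]] f(2)[OF d] g[OF d] g[OF s] gr by simp
    then show ?thesis
      using m.t0(2)[OF d] n.t0(2)[OF f_in[OF d]] f(3)[OF d] g[OF d] g[OF m.t(1)[OF d]] by simp
  qed
  ultimately show ?thesis
    unfolding rmap_iso_def using gr by blast
qed

lemma stub_iso_restrict:
  assumes "stub_of M0 M" "stub_of N0 N" "rmap_iso M0 N0"
  shows "rmap_iso M N"
proof -
  have HM: "half_edges M0 = insert (root M0) (half_edges M)"
    and HN: "half_edges N0 = insert (root N0) (half_edges N)"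
    using assms(1,2) by (simp_all add: stub_of_def)
  interpret m: stub "half_edges M" "rot M" "opp M" "root M" "root M0" "rot M0" "opp M0"
    using assms(1) by (simp add: stub_of_def)
  interpret n: stub "half_edges N" "rot N" "opp N" "root N" "root N0" "rot N0" "opp N0"
    using assms(2) by (simp add: stub_of_def)
  obtain f where f: "bij_betw f (half_edges M0) (half_edges N0)"
    "\<And>d. d \<in> half_edges M0 \<Longrightarrow> f (rot M0 d) = rot N0 (f d)"
    "\<And>d. d \<in> half_edges M0 \<Longrightarrow> f (opp M0 d) = opp N0 (f d)"
    "f (root M0) = root N0"
    using assms(3) unfolding rmap_iso_def by blast
  have inj: "f d = f d' \<longleftrightarrow> d = d'" if "d \<in> half_edges M0" "d' \<in> half_edges M0" for d d'
    using f(1) that by (meson bij_betw_def inj_onD)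
  have "bij_betw f (half_edges M0 - {root M0}) (half_edges N0 - {root N0})"
    using f(1,4) HM HN by (intro bij_betw_DiffI) (auto simp: bij_betw_def)
  moreover have "half_edges M0 - {root M0} = half_edges M" "half_edges N0 - {root N0} = half_edges N"
    using HM HN m.new n.new by auto
  ultimately have bij: "bij_betw f (half_edges M) (half_edges N)"
    by simp
  have fq: "f (root M) = root N"
    using f(2)[of "root M0"] f(4) m.s0(1) n.s0(1) HM by simp
  have "f (rot M d) = rot N (f d) \<and> f (opp M d) = opp N (f d)" if d: "d \<in> half_edges M" for d
  proof
    have d0: "d \<in> half_edges M0" "rot M0 d \<in> half_edges M0" "root M0 \<in> half_edges M0"
      using d HM perm_onD(2)[OF m.perm_on_s0, of d] by simp_all
    have fd: "f d \<in> half_edges N"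
      using bij d by (rule bij_betw_apply)
    show "f (opp M d) = opp N (f d)"
      using f(3)[OF d0(1)] m.t0(2)[OF d] n.t0(2)[OF fd] by simp
    have "f (rot M0 d) = root N0 \<longleftrightarrow> rot M0 d = root M0"
      using inj[OF d0(2,3)] f(4) by simp
    then show "f (rot M d) = rot N (f d)"
      using m.s_skip[OF d] n.s_skip[OF fd] f(2)[OF d0(1)] fq m.s0(1) n.s0(1) by (simp add: skip_def)
  qed
  then show ?thesis
    unfolding rmap_iso_def using bij fq by blast
qed

section \<open>Translation between planar cubic maps and maps with one leg\<close>

lemma permutes_perm_on: "f permutes H \<Longrightarrow> finite H \<Longrightarrow> perm_on f H"
  by (simp add: perm_on_def permutes_inj_on permutes_in_image Pi_iff)

lemma perm_on_permutes: "perm_on f H \<Longrightarrow> (\<And>d. d \<notin> H \<Longrightarrow> f d = d) \<Longrightarrow> f permutes H"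
  by (rule bij_imp_permutes) (simp_all add: bij_betw_def perm_on_surj, simp add: perm_on_def)

text \<open>\<open>adjacency\<close> connects vertices and \<open>conn\<close> connects half-edges.
  A vertex is a cycle of \<open>rot\<close>, hence contained in one class of \<open>conn\<close>,
  and conversely a \<open>rot\<close> step does not change the vertex.\<close>

lemma connected_map_iff:
  assumes s: "perm_on (rot M) (half_edges M)"
    and t: "\<And>d. d \<in> half_edges M \<Longrightarrow> opp M d \<in> half_edges M" "\<And>d. d \<in> half_edges M \<Longrightarrow> opp M (opp M d) = d"
    and q: "root M \<in> half_edges M"
  shows "connected_map M \<longleftrightarrow> (\<forall>d\<in>half_edges M. (root M, d) \<in> conn (half_edges M) (rot M) (opp M))"
proof
  assume L: "connected_map M"
  let ?C = "conn (half_edges M) (rot M) (opp M)"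
  have orb: "(d, e) \<in> ?C" if "d \<in> half_edges M" "e \<in> orbit (rot M) d" for d e
    using conn_orbit[OF that(2,1)] s conn_step(1)[of _ "half_edges M" "rot M" "opp M"]
    by (simp add: perm_on_def)
  have *: "\<forall>e\<in>X. (root M, e) \<in> ?C" if "(orbit (rot M) (root M), X) \<in> (adjacency M)\<^sup>*" for X
    using that
  proof induct
    case base
    then show ?case
      using orb[OF q] by blast
  next
    case (step X Y)
    then obtain d where d: "d \<in> half_edges M" "X = orbit (rot M) d" "Y = orbit (rot M) (opp M d)"
      unfolding adjacency_def by auto
    have "(root M, d) \<in> ?C"
      using step(3) self_in_orbit[OF s d(1)] d(2) by blast
    moreover have "(d, opp M d) \<in> ?C"
      using conn_step(2)[OF d(1)] .
    ultimately show ?case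
      using orb[OF t(1)[OF d(1)]] d(3) by (blast intro: conn_trans)
  qed
  show "\<forall>d\<in>half_edges M. (root M, d) \<in> ?C"
  proof
    fix d assume d: "d \<in> half_edges M"
    have "(orbit (rot M) (root M), orbit (rot M) d) \<in> (adjacency M)\<^sup>*"
      using L d q unfolding connected_map_def vertices_def by blast
    then show "(root M, d) \<in> ?C"
      using * self_in_orbit[OF s d] by blast
  qed
next
  assume R: "\<forall>d\<in>half_edges M. (root M, d) \<in> conn (half_edges M) (rot M) (opp M)"
  have *: "(orbit (rot M) x, orbit (rot M) y) \<in> (adjacency M)\<^sup>*"
    if "(x, y) \<in> conn (half_edges M) (rot M) (opp M)" for x y
    using that unfolding conn_def
  proof induct
    case (step y z)
    have "(orbit (rot M) y, orbit (rot M) z) \<in> (adjacency M)\<^sup>*"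
    proof -
      from step(2) consider "y \<in> half_edges M" "z = rot M y" | "z \<in> half_edges M" "y = rot M z"
        | "y \<in> half_edges M" "z = opp M y" | "z \<in> half_edges M" "y = opp M z"
        by (auto simp: link_def)
      then show ?thesis
      proof cases
        case 1
        then show ?thesis
          using self_in_orbit_step[OF self_in_orbit[OF s]] by simp
      next
        case 2
        then show ?thesis
          using self_in_orbit_step[OF self_in_orbit[OF s]] by simp
      next
        case 3
        then show ?thesis
          unfolding adjacency_def by blast
      next
        case 4
        then have "y \<in> half_edges M" "z = opp M y"
          using t by simp_all
        then show ?thesis
          unfolding adjacency_def by blast
      qed
    qed
    then show ?case
      using step(3) by simp
  qed simp
  have "(x, y) \<in> conn (half_edges M) (rot M) (opp M)" if "x \<in> half_edges M" "y \<in> half_edges M" for x y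
    using R that by (meson conn_sym conn_trans)
  then show "connected_map M"
    unfolding connected_map_def vertices_def using * by blast
qed

text \<open>With \<open>3 * (k + 1)\<close> edges there are \<open>2 * (k + 1)\<close> cubic
  vertices and, by Euler's formula, \<open>k + 3\<close> faces. One vertex receives the leg, which
  leaves \<open>2 * k + 1\<close> others.\<close>

lemma stub_leg_map:
  fixes M :: "nat rmap"
  assumes M: "M \<in> planar_cubic_maps (3 * Suc k)"
  obtains M0 where "stub_of M0 M" "leg_map 3 (2 * k + 1) M0"
proof -
  define s t q H where "s = rot M" and "t = opp M" and "q = root M" and "H = half_edges M"
  note defs = s_def t_def q_def H_def
  have "rooted_map M" and genus: "has_genus M 0" and cubic: "cubic M" and edges: "card (edges M) = 3 * Suc k"
    using M by (auto simp: planar_cubic_maps_def planar_map_def)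
  then have R: "finite H" "s permutes H" "t permutes H" "\<And>d. d \<in> H \<Longrightarrow> t d \<noteq> d"
    "\<And>d. d \<in> H \<Longrightarrow> t (t d) = d" "q \<in> H" "connected_map M"
    by (auto simp: rooted_map_def defs)
  have fs: "perm_on s H" and ft: "perm_on t H"
    using R by (auto intro: permutes_perm_on)
  have tH: "t d \<in> H" if "d \<in> H" for d
    using perm_onD(2)[OF ft that] .
  have conn: "\<forall>d\<in>H. (q, d) \<in> conn H s t"
    using connected_map_iff[of M] R(7) fs tH R(5,6) by (simp add: defs)
  have c3: "card (orbit s d) = 3" if "d \<in> H" for d
    using cubic that by (auto simp: cubic_def vertices_def defs)
  have c2: "card (orbit t d) = 2" if "d \<in> H" for d
    using card_opp_orbit R(4,5) that by metis
  have E: "num_orbits t H = 3 * Suc k"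
    using edges by (simp add: num_orbits_def edges_def defs)
  have "card H + 2 = card (orbit t q) + 2 * num_orbits t H"
    by (rule card_orbits[OF ft R(6) c2])
  then have cardH: "card H = 6 * Suc k"
    using c2[OF R(6)] E by simp
  have "card H + 3 = card (orbit s q) + 3 * num_orbits s H"
    by (rule card_orbits[OF fs R(6) c3])
  then have V: "num_orbits s H = 2 * Suc k"
    using c3[OF R(6)] cardH by simp
  have F: "num_orbits (s \<circ> t) H = k + 3"
    using genus E V by (simp add: has_genus_def vertices_def edges_def faces_def num_orbits_def defs)
  obtain r where r: "r \<notin> H"
    using ex_new_if_finite[OF infinite_UNIV_nat R(1)] by blast
  define s0 where "s0 d = (if d = r then q else if s d = q then r else s d)" for d
  define t0 where "t0 = t(r := r)"
  interpret stub H s t q r s0 t0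
    by unfold_locales (use fs tH R r in \<open>auto simp: s0_def t0_def\<close>)
  let ?M0 = "\<lparr>half_edges = insert r H, rot = s0, opp = t0, root = r\<rparr>"
  have "stub H s t q r s0 t0"
    by unfold_locales
  then have "stub_of ?M0 M"
    by (simp add: stub_of_def defs)
  moreover have "leg_map 3 (2 * k + 1) ?M0"
    unfolding leg_map_def rmap.select_convs
  proof (intro conjI)
    show "perm_on s0 H0" "r \<in> H0"
      using perm_on_s0 by auto
    show "\<forall>d\<in>H0. t0 d \<in> H0 \<and> t0 (t0 d) = d"
      using t0_H0 by blast
    show "\<forall>d\<in>H0. t0 d = d \<longleftrightarrow> d = r"
      using t0 R(4) new by auto
    show "\<forall>d\<in>H0. (r, d) \<in> conn H0 s0 t0"
      unfolding connected_iff by (rule conn)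
    show "card (orbit s0 r) = 3 + 1"
      using card_orbit_root c3[OF R(6)] by simp
    show "\<forall>d\<in>H0 - orbit s0 r. card (orbit s0 d) = 3"
      using orbit_other c3 by auto
    show "card H0 = 3 + 1 + 3 * (2 * k + 1)"
      using cardH R(1) r by simp
    show "2 * num_orbits (s0 \<circ> t0) H0 = 3 + (2 * k + 1) + 2"
      using num_orbits_faces F by simp
  qed
  ultimately show ?thesis
    by (rule that)
qed

lemma leg_map_stub:
  fixes M0 :: "nat rmap"
  assumes L: "leg_map 3 (2 * k + 1) M0"
  obtains M where "stub_of M0 M" "M \<in> planar_cubic_maps (3 * Suc k)"
proof -
  define s0 t0 r H where "s0 = rot M0" and "t0 = opp M0" and "r = root M0" and "H = half_edges M0 - {root M0}"
  define q where "q = s0 r"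
  note defs = s0_def t0_def r_def H_def
  have H0: "half_edges M0 = insert r H" and new: "r \<notin> H"
    using L by (auto simp: leg_map_def defs)
  note L = L[unfolded leg_map_def, folded s0_def t0_def r_def, unfolded H0]
  have f0: "perm_on s0 (insert r H)"
    and t0: "\<And>d. d \<in> insert r H \<Longrightarrow> t0 d \<in> insert r H" "\<And>d. d \<in> insert r H \<Longrightarrow> t0 (t0 d) = d"
      "\<And>d. d \<in> insert r H \<Longrightarrow> t0 d = d \<longleftrightarrow> d = r"
    and c: "card (orbit s0 r) = 4" "card (insert r H) = 6 * k + 7" "num_orbits (s0 \<circ> t0) (insert r H) = k + 3"
    and c3: "\<And>d. d \<in> insert r H - orbit s0 r \<Longrightarrow> card (orbit s0 d) = 3"
    and conn: "\<forall>d\<in>insert r H. (r, d) \<in> conn (insert r H) s0 t0"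
    using L by auto
  have fin: "finite H"
    using perm_onD(1)[OF f0] by simp
  have "q \<noteq> r"
    using c(1) orbit_eq_singleton_iff[of s0 r] by (auto simp: q_def)
  then have q: "q \<in> H"
    using perm_onD(2)[OF f0, of r] by (auto simp: q_def)
  \<comment> \<open>Off \<open>H\<close> both functions have to be the identity, as
    \<open>rooted_map\<close> asks for \<open>permutes\<close> and not only for a permutation of the
    carrier.\<close>
  define s where "s d = (if d \<in> H then skip r s0 d else d)" for d
  define t where "t d = (if d \<in> H then t0 d else d)" for d
  have fs: "perm_on s H"
    using perm_on_cong[OF perm_on_skip[OF f0 new], of s] by (simp add: s_def)
  have t0r: "t0 r = r"
    using t0(3)[of r] by simp
  have tH: "t d \<in> H" "t (t d) = d" "t d \<noteq> d" if "d \<in> H" for d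
  proof -
    have "t0 d \<noteq> r"
      using t0(2)[of d] t0r that new by auto
    then show "t d \<in> H" "t (t d) = d" "t d \<noteq> d"
      using that t0(1-3)[of d] new by (auto simp: t_def)
  qed
  have s0_s: "s0 d = (if s d = q then r else s d)" if d: "d \<in> H" for d
  proof -
    have "s0 d \<noteq> q"
      using perm_onD(3)[OF f0, of d r] d new by (auto simp: q_def)
    then show ?thesis
      using d by (simp add: s_def skip_def q_def)
  qed
  interpret stub H s t q r s0 t0
    by unfold_locales (use fs tH q new s0_s t0r in \<open>auto simp: q_def t_def\<close>)
  let ?M = "\<lparr>half_edges = H, rot = s, opp = t, root = q\<rparr>"
  have "stub H s t q r s0 t0"
    by unfold_locales
  then have stub: "stub_of M0 ?M"
    using H0 by (simp add: stub_of_def s0_def t0_def r_def)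
  have s_perm: "s permutes H"
    using fs by (rule perm_on_permutes) (simp add: s_def)
  have ft: "perm_on t H"
    using tH fin by (intro perm_on_involution)
  have t_perm: "t permutes H"
    using ft by (rule perm_on_permutes) (simp add: t_def)
  have "connected_map ?M"
    using connected_map_iff[of ?M] fs tH q connected_iff conn by simp
  then have rooted: "rooted_map ?M"
    unfolding rooted_map_def using fin s_perm t_perm tH q by simp
  have s3: "card (orbit s d) = 3" if d: "d \<in> H" for d
  proof (cases "d \<in> orbit s0 r")
    case False
    then show ?thesis
      using c3[of d] d orbit_other[of d] by simp
  next
    case True
    have "card (orbit s q) = 3"
      using card_orbit_root c(1) by simp
    moreover have "r \<in> orbit s0 r"
      using self_in_orbit[OF f0, of r] by simp
    then have "orbit s0 r = orbit s0 q"
      using self_in_orbit_step[of r s0] by (simp add: q_def)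
    then have "d \<in> orbit s q"
      using True orbit_s[OF q] d new by auto
    then have "orbit s d = orbit s q"
      by (rule orbit_eq[OF fs q])
    ultimately show ?thesis
      by simp
  qed
  have cardH: "card H = 6 * Suc k"
    using c(2) fin new by simp
  have t2: "card (orbit t d) = 2" if "d \<in> H" for d
    using card_opp_orbit tH(2,3) that by metis
  have "card H + 2 = card (orbit t q) + 2 * num_orbits t H"
    by (rule card_orbits[OF ft q t2])
  then have E: "num_orbits t H = 3 * Suc k"
    using t2[OF q] cardH by simp
  have "card H + 3 = card (orbit s q) + 3 * num_orbits s H"
    by (rule card_orbits[OF fs q s3])
  then have V: "num_orbits s H = 2 * Suc k"
    using s3[OF q] cardH by simp
  have F: "num_orbits (s \<circ> t) H = k + 3"
    using num_orbits_faces c(3) by simp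
  have "has_genus ?M 0"
    using E V F by (simp add: has_genus_def vertices_def edges_def faces_def num_orbits_def)
  then have "?M \<in> planar_cubic_maps (3 * Suc k)"
    using rooted s3 E by (simp add: planar_cubic_maps_def planar_map_def cubic_def vertices_def edges_def num_orbits_def)
  then show ?thesis
    by (rule that[OF stub])
qed

section \<open>Isomorphism classes and codes\<close>

lemma card_quotient:
  assumes "equiv A r" "\<And>x y. x \<in> A \<Longrightarrow> y \<in> A \<Longrightarrow> (x, y) \<in> r \<longleftrightarrow> h x = h y"
  shows "card (A // r) = card (h ` A)"
proof -
  have cl: "r `` {x} = {y \<in> A. h y = h x}" if x: "x \<in> A" for x
  proof (intro subset_antisym subsetI)
    fix y assume "y \<in> r `` {x}"
    then have y: "(x, y) \<in> r"
      by simp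
    then have "y \<in> A"
      using equiv_type[OF assms(1)] by blast
    then show "y \<in> {y \<in> A. h y = h x}"
      using y assms(2)[OF x, of y] by simp
  next
    fix y assume "y \<in> {y \<in> A. h y = h x}"
    then show "y \<in> r `` {x}"
      using assms(2)[OF x, of y] by simp
  qed
  have "bij_betw (\<lambda>y. {x \<in> A. h x = y}) (h ` A) (A // r)"
    unfolding bij_betw_def
  proof
    show "inj_on (\<lambda>y. {x \<in> A. h x = y}) (h ` A)"
      by (rule inj_onI) blast
    show "(\<lambda>y. {x \<in> A. h x = y}) ` h ` A = A // r"
      unfolding quotient_def image_image using cl by auto
  qed
  then show ?thesis
    by (rule bij_betw_same_card[symmetric])
qed

lemma T_codes: "T (Suc k) = card {x. shape 3 (2 * k + 1) x}"
proof -
  let ?A = "planar_cubic_maps (3 * Suc k)"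
  define R where "R M x \<longleftrightarrow> (\<exists>M0. stub_of M0 M \<and> codes M0 x \<and> shape 3 (2 * k + 1) x)" for M :: "nat rmap" and x
  \<comment> \<open>The choice is harmless: any two codes related to the same map by
    \<open>R\<close> are equal, because codes are isomorphism invariants.\<close>
  define h where "h M = (SOME x. R M x)" for M
  have h: "R M (h M)" if M: "M \<in> ?A" for M
  proof -
    obtain M0 where M0: "stub_of M0 M" "leg_map 3 (2 * k + 1) M0"
      using stub_leg_map[OF M] .
    then have "\<exists>x. R M x"
      using ex_code[OF M0(2)] unfolding R_def by blast
    then show ?thesis
      unfolding h_def by (rule someI_ex)
  qed
  have R: "rmap_iso M N \<longleftrightarrow> x = y" if MN: "R M x" "R N y" for M N x y
  proof -
    obtain M0 N0 where 0: "stub_of M0 M" "codes M0 x" "stub_of N0 N" "codes N0 y"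
      using MN unfolding R_def by blast
    have "rmap_iso M N \<longleftrightarrow> rmap_iso M0 N0"
      using stub_iso_extend[OF 0(1,3)] stub_iso_restrict[OF 0(1,3)] by blast
    also have "\<dots> \<longleftrightarrow> x = y"
      using codes_iso[OF 0(2), of N0] iso_codes[OF 0(2,4)] 0(4) by blast
    finally show ?thesis .
  qed
  have "card (?A // iso_rel ?A) = card (h ` ?A)"
    by (rule card_quotient[OF equiv_iso_rel]) (use R[OF h h] in \<open>simp add: iso_rel_def\<close>)
  also have "h ` ?A = {x. shape 3 (2 * k + 1) x}"
  proof
    show "h ` ?A \<subseteq> {x. shape 3 (2 * k + 1) x}"
      using h unfolding R_def by blast
    show "{x. shape 3 (2 * k + 1) x} \<subseteq> h ` ?A"
    proof
      fix x assume "x \<in> {x. shape 3 (2 * k + 1) x}"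
      then have x: "shape 3 (2 * k + 1) x"
        by simp
      then obtain M0 :: "nat rmap" where M0: "codes M0 x" "leg_map 3 (2 * k + 1) M0"
        using ex_map[OF x, of "{}"] by auto
      obtain M where M: "stub_of M0 M" "M \<in> ?A"
        using leg_map_stub[OF M0(2)] .
      then have "R M x"
        unfolding R_def using M0 x by blast
      then have "x = h M"
        using R[OF _ h[OF M(2)], of M x] rmap_iso_refl by blast
      then show "x \<in> h ` ?A"
        using M(2) by blast
    qed
  qed
  finally show ?thesis
    by (simp add: T_def)
qed

section \<open>Counting codes\<close>

text \<open>A contraction keeps \<open>p + n\<close> and a split adds 2. This is why
  \<open>t\<close> can mark half of the sum.\<close>

lemma shape_even: "shape p n x \<Longrightarrow> even (p + n)"
  by (induction rule: shape.induct) auto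

lemma shape_unique: "shape p n x \<Longrightarrow> shape q m x \<Longrightarrow> p = q \<and> n = m"
proof (induction arbitrary: q m rule: shape.induct)
  case point
  then show ?case
    by cases auto
next
  case (contract p n x)
  from contract.prems show ?case
    by cases (use contract.IH in force)
next
  case (split p n x q' m' y)
  from split.prems show ?case
    by cases (use split.IH in force)
qed

lemma finite_shape: "finite {x. shape p n x}"
\<comment> \<open>The measure is the number of half-edges without the leg. It exceeds that of the
  subtree by 2 for \<open>Contract\<close>, and that of both subtrees together by 2 for
  \<open>Split\<close>.\<close>
proof (induction "p + 3 * n" arbitrary: p n rule: less_induct)
  case less
  let ?S = "\<lambda>p n. {x. shape p n x}"
  let ?C = "if n = 0 then {} else Contract ` ?S (Suc p) (n - 1)"
  let ?P = "\<Union>i\<in>{..<p}. \<Union>j\<in>{..n}. if i + 2 \<le> p then (\<lambda>(x, y). Split x y) ` (?S i j \<times> ?S (p - 2 - i) (n - j)) else {}"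
  have "?S p n \<subseteq> {Point} \<union> ?C \<union> ?P"
  proof
    fix z assume "z \<in> ?S p n"
    then have "shape p n z"
      by simp
    then show "z \<in> {Point} \<union> ?C \<union> ?P"
    proof cases
      case (split p1 n1 x p2 n2 y)
      then have "Split x y \<in> (\<lambda>(x, y). Split x y) ` (?S p1 n1 \<times> ?S (p - 2 - p1) (n - n1))"
        by force
      moreover have "p1 \<in> {..<p}" "n1 \<in> {..n}" "p1 + 2 \<le> p"
        using split by auto
      ultimately have "z \<in> ?P"
        using split(3) by force
      then show ?thesis by blast
    qed auto
  qed
  moreover have "finite ?C"
    using less[of "Suc p" "n - 1"] by auto
  moreover have "finite ?P"
  proof (intro finite_UN_I)
    fix i j assume "i \<in> {..<p}" "j \<in> {..n}"
    then show "finite (if i + 2 \<le> p then (\<lambda>(x, y). Split x y) ` (?S i j \<times> ?S (p - 2 - i) (n - j)) else {})"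
      using less[of i j] less[of "p - 2 - i" "n - j"] by auto
  qed auto
  ultimately show ?case
    by (meson finite.emptyI finite.insertI finite_UnI finite_subset)
qed

section \<open>The recurrence for the numbers of codes\<close>

definition perim_codes :: "nat \<Rightarrow> nat \<Rightarrow> code set" where
  "perim_codes p k = {x. \<exists>n. p + n = 2 * k \<and> shape p n x}"

text \<open>The coefficient of \<open>y^p * t^k\<close> in the series \<open>F\<close>.\<close>

definition code_count :: "nat \<Rightarrow> nat \<Rightarrow> nat" where
  "code_count p k = card (perim_codes p k)"

lemma perim_codes_shape: "perim_codes p k = (if p \<le> 2 * k then {x. shape p (2 * k - p) x} else {})"
proof -
  have "p + n = 2 * k \<longleftrightarrow> p \<le> 2 * k \<and> n = 2 * k - p" for n
    by auto
  then show ?thesis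
    by (simp add: perim_codes_def)
qed

lemma finite_perim_codes: "finite (perim_codes p k)"
  by (simp add: perim_codes_shape finite_shape)

lemma perim_codes_unique: "x \<in> perim_codes p k \<Longrightarrow> x \<in> perim_codes q l \<Longrightarrow> p = q \<and> k = l"
proof -
  assume "x \<in> perim_codes p k" "x \<in> perim_codes q l"
  then obtain n m where "p + n = 2 * k" "shape p n x" "q + m = 2 * l" "shape q m x"
    unfolding perim_codes_def by blast
  moreover from this have "p = q \<and> n = m"
    by (intro shape_unique)
  ultimately show ?thesis
    by simp
qed

lemma ex_perim_codes: "shape p n x \<Longrightarrow> \<exists>k. p + n = 2 * k \<and> x \<in> perim_codes p k"
proof -
  assume x: "shape p n x"
  then obtain k where "p + n = 2 * k"
    using shape_even[OF x] by (elim evenE)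
  then show ?thesis
    using x unfolding perim_codes_def by blast
qed

lemma perim_codes_0: "perim_codes 0 k = (if k = 0 then {Point} else {})"
proof -
  have "shape 0 n x \<longleftrightarrow> n = 0 \<and> x = Point" for n x
  proof
    assume "shape 0 n x"
    then show "n = 0 \<and> x = Point"
      by cases auto
  qed (simp add: shape.point)
  then show ?thesis
    by (auto simp: perim_codes_def)
qed

lemma contract_perim_codes: "Contract x \<in> perim_codes (Suc p) k \<longleftrightarrow> x \<in> perim_codes (Suc (Suc p)) k"
proof
  assume "Contract x \<in> perim_codes (Suc p) k"
  then obtain n where n: "Suc p + n = 2 * k" "shape (Suc p) n (Contract x)"
    by (auto simp: perim_codes_def)
  from n(2) obtain m where "n = Suc m" "shape (Suc (Suc p)) m x"
    by cases auto
  then show "x \<in> perim_codes (Suc (Suc p)) k"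
    using n(1) by (auto simp: perim_codes_def)
next
  assume "x \<in> perim_codes (Suc (Suc p)) k"
  then obtain n where "Suc (Suc p) + n = 2 * k" "shape (Suc (Suc p)) n x"
    by (auto simp: perim_codes_def)
  then show "Contract x \<in> perim_codes (Suc p) k"
    using shape.contract[of p n x] by (auto simp: perim_codes_def intro!: exI[of _ "Suc n"])
qed

lemma split_perim_codes:
  "Split x y \<in> perim_codes p k \<longleftrightarrow> (\<exists>i j q l. p = i + q + 2 \<and> k = j + l + 1 \<and> x \<in> perim_codes i j \<and> y \<in> perim_codes q l)"
proof
  assume "Split x y \<in> perim_codes p k"
  then obtain n where n: "p + n = 2 * k" "shape p n (Split x y)"
    by (auto simp: perim_codes_def)
  from n(2) obtain i a q b where s: "p = i + q + 2" "n = a + b" "shape i a x" "shape q b y"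
    by cases auto
  obtain j l where "i + a = 2 * j" "x \<in> perim_codes i j" "q + b = 2 * l" "y \<in> perim_codes q l"
    using ex_perim_codes[OF s(3)] ex_perim_codes[OF s(4)] by blast
  moreover from this have "k = j + l + 1"
    using n(1) s(1,2) by linarith
  ultimately show "\<exists>i j q l. p = i + q + 2 \<and> k = j + l + 1 \<and> x \<in> perim_codes i j \<and> y \<in> perim_codes q l"
    using s(1) by blast
next
  assume "\<exists>i j q l. p = i + q + 2 \<and> k = j + l + 1 \<and> x \<in> perim_codes i j \<and> y \<in> perim_codes q l"
  then obtain i j q l a b where "p = i + q + 2" "k = j + l + 1"
    "i + a = 2 * j" "shape i a x" "q + b = 2 * l" "shape q b y"
    unfolding perim_codes_def by blast
  then show "Split x y \<in> perim_codes p k"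
    using shape.split[of i a x q b y] by (auto simp: perim_codes_def intro!: exI[of _ "a + b"])
qed

lemma Point_perim_codes: "Point \<in> perim_codes p k \<longleftrightarrow> p = 0 \<and> k = 0"
proof -
  have "shape p n Point \<longleftrightarrow> p = 0 \<and> n = 0" for n
  proof
    assume "shape p n Point"
    then show "p = 0 \<and> n = 0"
      by cases auto
  qed (simp add: shape.point)
  then show ?thesis
    unfolding perim_codes_def by simp arith
qed

lemma code_count_0: "code_count 0 k = (if k = 0 then 1 else 0)"
  by (simp add: code_count_def perim_codes_0)

lemma code_count_large: "2 * k < p \<Longrightarrow> code_count p k = 0"
  by (simp add: code_count_def perim_codes_shape)

text \<open>A \<open>Split\<close> needs root degree at least 2 for the loop and a
  \<open>Point\<close> has degree 0, so a code of degree 1 can only be a contraction.\<close>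

lemma code_count_1: "code_count 1 k = code_count 2 k"
proof -
  have "perim_codes 1 k = Contract ` perim_codes 2 k"
  proof (rule set_eqI)
    fix z
    show "z \<in> perim_codes 1 k \<longleftrightarrow> z \<in> Contract ` perim_codes 2 k"
      by (cases z) (auto simp: Point_perim_codes split_perim_codes contract_perim_codes[of _ 0, simplified] numeral_2_eq_2)
  qed
  then show ?thesis
    by (simp add: code_count_def card_image inj_on_def)
qed

text \<open>Undoing a contraction keeps \<open>k\<close>. A loop takes 2 from the degree, hence 1
  from \<open>k\<close>, and distributes the rest over the two parts, which gives the
  convolution.\<close>

lemma code_count_rec: "code_count (p + 2) (Suc k) = code_count (p + 3) (Suc k) + (\<Sum>j\<le>k. \<Sum>i\<le>p. code_count i j * code_count (p - i) (k - j))"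
proof -
  let ?S = "\<lambda>z. case z of (j, i) \<Rightarrow> (\<lambda>(x, y). Split x y) ` (perim_codes i j \<times> perim_codes (p - i) (k - j))"
  have "perim_codes (p + 2) (Suc k) = Contract ` perim_codes (p + 3) (Suc k) \<union> (\<Union>z\<in>{..k} \<times> {..p}. ?S z)"
  proof (rule set_eqI)
    fix z
    show "z \<in> perim_codes (p + 2) (Suc k) \<longleftrightarrow>
      z \<in> Contract ` perim_codes (p + 3) (Suc k) \<union> (\<Union>z\<in>{..k} \<times> {..p}. ?S z)"
    proof (cases z)
      case Point
      then show ?thesis
        by (auto simp: Point_perim_codes)
    next
      case (Contract x)
      then show ?thesis
        using contract_perim_codes[of x "Suc p" "Suc k"] by (auto simp: eval_nat_numeral)
    next
      case (Split x y)
      have "z \<in> perim_codes (p + 2) (Suc k) \<longleftrightarrow>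
        (\<exists>j\<le>k. \<exists>i\<le>p. x \<in> perim_codes i j \<and> y \<in> perim_codes (p - i) (k - j))"
        unfolding Split split_perim_codes
      proof safe
        fix i j q l assume "p + 2 = i + q + 2" "Suc k = j + l + 1" "x \<in> perim_codes i j" "y \<in> perim_codes q l"
        moreover from this have "q = p - i" "l = k - j" "j \<le> k" "i \<le> p"
          by auto
        ultimately show "\<exists>j\<le>k. \<exists>i\<le>p. x \<in> perim_codes i j \<and> y \<in> perim_codes (p - i) (k - j)"
          by blast
      next
        fix i j assume "j \<le> k" "i \<le> p" "x \<in> perim_codes i j" "y \<in> perim_codes (p - i) (k - j)"
        then show "\<exists>i j q l. p + 2 = i + q + 2 \<and> Suc k = j + l + 1 \<and> x \<in> perim_codes i j \<and> y \<in> perim_codes q l"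
          by (intro exI[of _ i] exI[of _ j] exI[of _ "p - i"] exI[of _ "k - j"]) auto
      qed
      also have "\<dots> \<longleftrightarrow> z \<in> (\<Union>z\<in>{..k} \<times> {..p}. ?S z)"
        unfolding Split by force
      finally show ?thesis
        using Split by auto
    qed
  qed
  moreover have "Contract ` perim_codes (p + 3) (Suc k) \<inter> (\<Union>z\<in>{..k} \<times> {..p}. ?S z) = {}"
    by auto
  moreover have fin: "finite (?S z)" for z
    using finite_perim_codes by (cases z) auto
  moreover have "card (\<Union>z\<in>{..k} \<times> {..p}. ?S z) = (\<Sum>z\<in>{..k} \<times> {..p}. card (?S z))"
  proof (rule card_UN_disjoint)
    show "\<forall>z\<in>{..k} \<times> {..p}. \<forall>z'\<in>{..k} \<times> {..p}. z \<noteq> z' \<longrightarrow> ?S z \<inter> ?S z' = {}"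
      using perim_codes_unique by fastforce
  qed (use fin in auto)
  moreover have "card (?S (j, i)) = code_count i j * code_count (p - i) (k - j)" for i j
    by (simp add: card_image inj_on_def code_count_def card_cartesian_product)
  moreover have "finite (Contract ` perim_codes (p + 3) (Suc k))" "finite (\<Union>z\<in>{..k} \<times> {..p}. ?S z)"
    using finite_perim_codes fin by auto
  ultimately show ?thesis
    unfolding code_count_def[of "p + 2"]
    by (simp add: card_Un_disjoint card_image inj_on_def sum.cartesian_product code_count_def[of "p + 3"] case_prod_unfold)
qed

text \<open>For \<open>n = 0\<close> the only code is \<open>Contract (Split Point Point)\<close>, a
  vertex with the leg joined to a cubic vertex with a loop; it accounts for the convention that
  \<open>T 0\<close> is 1.\<close>

lemma T_eq_code_count: "T n = code_count 1 (Suc n)"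
proof (cases n)
  case 0
  have "code_count 2 1 = 1"
    using code_count_rec[of 0 0] code_count_large[of 1 3] by (simp add: code_count_0 numeral_2_eq_2)
  then show ?thesis
    using code_count_1[of 1] 0 by (simp add: T_def)
next
  case (Suc k)
  \<comment> \<open>For degree 2 both sides of the loop have degree 0, so both are points and
    \<open>k\<close> would have to vanish on both sides. Hence beyond the smallest case only
    contractions remain and degree 2 agrees with degree 3.\<close>
  have "(\<Sum>j\<le>Suc k. \<Sum>i\<le>0. code_count i j * code_count (0 - i) (Suc k - j)) = 0"
    by (auto simp: code_count_0)
  then have "code_count (0 + 2) (Suc n) = code_count (0 + 3) (Suc n)"
    unfolding Suc code_count_rec by simp
  then have "code_count 1 (Suc n) = code_count 3 (Suc n)"
    unfolding code_count_1 by (simp only: add_0)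
  also have "perim_codes 3 (Suc n) = {x. shape 3 (2 * k + 1) x}"
    using Suc by (simp add: perim_codes_shape eval_nat_numeral)
  then have "code_count 3 (Suc n) = T n"
    by (simp add: code_count_def T_codes Suc)
  finally show ?thesis ..
qed

section \<open>The quadratic method\<close>

unbundle fps_syntax

section \<open>Power series in \<open>t\<close> whose coefficients are polynomials in
  \<open>y\<close>\<close>

definition Y :: "int poly fps" where
  "Y = fps_const [:0, 1:]"

abbreviation X :: "int poly fps" where
  "X \<equiv> fps_X"

definition dy :: "int poly fps \<Rightarrow> int poly fps" where
  "dy f = Abs_fps (\<lambda>k. pderiv (f $ k))"

lemma pderiv_sum: "pderiv (sum f A) = (\<Sum>i\<in>A. pderiv (f i))"
  by (induction A rule: infinite_finite_induct) (simp_all add: pderiv_add)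

lemma dy_add: "dy (f + g) = dy f + dy g"
  by (simp add: dy_def fps_eq_iff pderiv_add)

lemma dy_diff: "dy (f - g) = dy f - dy g"
  by (simp add: dy_def fps_eq_iff pderiv_diff)

lemma dy_mult: "dy (f * g) = f * dy g + g * dy f"
proof (rule fps_ext)
  fix n
  have "(\<Sum>i=0..n. g $ (n - i) * pderiv (f $ i)) = (\<Sum>i=0..n. g $ i * pderiv (f $ (n - i)))"
    by (rule sum.reindex_bij_witness[of _ "\<lambda>i. n - i" "\<lambda>i. n - i"]) auto
  then show "dy (f * g) $ n = (f * dy g + g * dy f) $ n"
    by (simp add: dy_def fps_mult_nth pderiv_sum pderiv_mult sum.distrib)
qed

lemma dy_y: "dy Y = 1"
  by (rule fps_ext) (simp add: dy_def Y_def pderiv_pCons)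

lemma fps_deriv_y: "fps_deriv Y = 0"
  by (simp add: Y_def)

lemma dy_t: "dy X = 0"
  by (rule fps_ext) (simp add: dy_def fps_X_def)

definition embed :: "int fps \<Rightarrow> int poly fps" where
  "embed f = Abs_fps (\<lambda>k. [:f $ k:])"

lemma embed_nth [simp]: "embed f $ k = [:f $ k:]"
  by (simp add: embed_def)

lemma embed_add: "embed (f + g) = embed f + embed g"
  by (simp add: fps_eq_iff)

lemma embed_diff: "embed (f - g) = embed f - embed g"
  by (simp add: fps_eq_iff)

lemma embed_mult: "embed (f * g) = embed f * embed g"
proof (rule fps_ext)
  fix n
  have "[:sum h A:] = (\<Sum>i\<in>A. [:h i:])" for h :: "nat \<Rightarrow> int" and A
  proof (induction A rule: infinite_finite_induct)
    case (insert x F)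
    have "[:sum h (insert x F):] = [:h x:] + [:sum h F:]"
      unfolding sum.insert[OF insert.hyps] by simp
    then show ?case
      unfolding insert.IH sum.insert[OF insert.hyps] .
  qed simp_all
  then show "embed (f * g) $ n = (embed f * embed g) $ n"
    by (simp add: fps_mult_nth mult.commute)
qed

lemma embed_1: "embed 1 = 1"
  by (simp add: fps_eq_iff)

lemma embed_numeral: "embed (numeral n) = numeral n"
  by (simp add: fps_eq_iff numeral_fps_const fps_const_def flip: numeral_poly)

lemma embed_X: "embed fps_X = X"
  by (simp add: fps_eq_iff fps_X_def)

lemma embed_deriv: "embed (fps_deriv f) = fps_deriv (embed f)"
  by (simp add: fps_eq_iff of_nat_poly)

lemma embed_power: "embed (f ^ n) = embed f ^ n"
  by (induction n) (simp_all add: embed_1 embed_mult)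

lemma dy_embed: "dy (embed f) = 0"
  by (simp add: dy_def fps_eq_iff)

text \<open>
  The lowest coefficient of \<open>c\<close> vanishes because \<open>Y = 1\<close> is a root of \<open>r\<close> modulo \<open>X\<close>.
\<close>

lemma kernel_dvd:
  assumes r0: "r $ 0 = [:1, -1:]" and dvd: "r dvd embed c * Y ^ m"
  shows "c = 0"
proof -
  obtain g where g: "embed c * Y ^ m = r * g"
    using dvd by (elim dvdE)
  \<comment> \<open>Both series are treated together: once the lower coefficients of
    \<open>g\<close> vanish, only the constant term of \<open>r\<close> contributes to the
    product.\<close>
  have "c $ k = 0 \<and> g $ k = 0" for k
  proof (induction k rule: less_induct)
    case (less k)
    have "(r * g) $ k = (\<Sum>i=0..k. r $ i * g $ (k - i))"
      by (simp add: fps_mult_nth)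
    also have "\<dots> = (\<Sum>i=0..k. if i = 0 then r $ 0 * g $ k else 0)"
      using less by (intro sum.cong) auto
    also have "\<dots> = [:1, -1:] * g $ k"
      by (simp add: r0)
    finally have 1: "[:c $ k:] * [:0, 1:] ^ m = [:1, -1:] * g $ k"
      using arg_cong[OF g, of "\<lambda>f. f $ k"] by (simp add: Y_def fps_const_power)
    have "poly ([:c $ k:] * [:0, 1:] ^ m) 1 = poly ([:1, -1:] * g $ k) 1"
      unfolding 1 ..
    then have "c $ k = 0"
      by simp
    moreover from this have "[:1, -1:] * g $ k = 0"
      using 1 by simp
    then have "g $ k = 0"
      unfolding mult_eq_0_iff by simp
    ultimately show ?case ..
  qed
  then show ?thesis
    by (simp add: fps_eq_iff)
qed

text \<open>
  The quadratic method: the discriminant \<open>r * r\<close> of the functional equation and both its partial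
  derivatives are divisible by \<open>r\<close>, and the three polynomials combine to a multiple of
  \<open>e\<^sup>2 - u'\<close> that is a monomial in \<open>Y\<close>.
\<close>

lemma quadratic_method:
  assumes r0: "r $ 0 = [:1, -1:]"
    and sq: "r * r = (1 - Y) ^ 2 + 4 * X * Y ^ 3 - 4 * X * (1 - embed u) * Y ^ 4"
  shows "fps_deriv u = (1 - 2 * u + 6 * fps_X * fps_deriv u) ^ 2"
proof -
  define U where "U = embed u"
  define V where "V = embed (fps_deriv u)"
  define E where "E = 1 - 2 * U + 6 * X * V"
  have dU: "fps_deriv U = V"
    by (simp add: U_def V_def embed_deriv)
  have dyU: "dy U = 0"
    by (simp add: U_def dy_embed)
  \<comment> \<open>Powers are written out as binary products, so that the product rule for
    \<open>dy\<close> applies throughout.\<close>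
  define p where "p = (1 - Y) * (1 - Y) + 4 * (X * (Y * (Y * Y))) - 4 * (X * ((1 - U) * (Y * (Y * (Y * Y)))))"
  have p: "p = r * r"
    unfolding sq p_def U_def by (simp add: power2_eq_square power3_eq_cube power4_eq_xxxx mult.assoc)
  have dy_num: "dy (numeral n) = 0" "dy 1 = 0" for n
    using dy_embed[of "numeral n"] dy_embed[of 1] by (simp_all add: embed_numeral embed_1)
  have "fps_deriv p = 4 * Y ^ 3 - 4 * (1 - U) * Y ^ 4 + 4 * X * V * Y ^ 4"
    unfolding p_def by (simp add: dU fps_deriv_y algebra_simps power2_eq_square power3_eq_cube power4_eq_xxxx)
  moreover have "fps_deriv p = r * (2 * fps_deriv r)"
    unfolding p by (simp add: mult.commute mult.left_commute)
  ultimately have pt: "4 * Y ^ 3 - 4 * (1 - U) * Y ^ 4 + 4 * X * V * Y ^ 4 = r * (2 * fps_deriv r)"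
    by (simp only:)
  have "dy p = - 2 * (1 - Y) + 12 * X * Y ^ 2 - 16 * X * (1 - U) * Y ^ 3"
    unfolding p_def dy_add dy_diff dy_mult dy_y dy_t dyU dy_num
    by (simp add: algebra_simps power2_eq_square power3_eq_cube)
  moreover have "dy p = r * (2 * dy r)"
    unfolding p dy_mult by (simp add: mult.commute mult.left_commute)
  ultimately have py: "- 2 * (1 - Y) + 12 * X * Y ^ 2 - 16 * X * (1 - U) * Y ^ 3 = r * (2 * dy r)"
    by (simp only:)
  have p': "(1 - Y) ^ 2 + 4 * X * Y ^ 3 - 4 * X * (1 - U) * Y ^ 4 = r * r"
    using sq by (simp add: U_def)
  \<comment> \<open>Modulo \<open>r\<close> this yields \<open>2 * X * Y^2 * E = Y - 1\<close>, up
    to the factor \<open>4 * X * Y^2\<close>. The weight of the \<open>X\<close>-derivative creates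
    the term \<open>6 * X * V\<close> of \<open>E\<close>; the other two weights cancel the terms
    with \<open>Y^5\<close> and adjust those with \<open>U\<close> to
    \<open>- 2 * U\<close>.\<close>
  define w where "w = r * ((2 * X * Y ^ 2 - 4 * X * Y) * (2 * dy r) + 12 * X ^ 2 * (2 * fps_deriv r) - 8 * X * Y * r)"
  have w: "w = 2 * (4 * X ^ 2 * Y ^ 4 * E - 2 * X * Y ^ 2 * (Y - 1))"
  proof -
    have "w = (2 * X * Y ^ 2 - 4 * X * Y) * (r * (2 * dy r)) + 12 * X ^ 2 * (r * (2 * fps_deriv r)) - 8 * X * Y * (r * r)"
      unfolding w_def by (simp add: algebra_simps)
    also have "\<dots> = 2 * (4 * X ^ 2 * Y ^ 4 * E - 2 * X * Y ^ 2 * (Y - 1))"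
      unfolding p'[symmetric] pt[symmetric] py[symmetric] E_def by algebra
    finally show ?thesis .
  qed
  \<comment> \<open>\<open>X\<close> times the \<open>X\<close>-derivative minus the discriminant
    eliminates \<open>U\<close>. Modulo \<open>r\<close> it says that
    \<open>4 * X^2 * Y^4 * V\<close> is \<open>(1 - Y)^2\<close>.\<close>
  define v where "v = r * (X * (2 * fps_deriv r) - r)"
  have v: "v = 4 * X ^ 2 * V * Y ^ 4 - (1 - Y) ^ 2"
  proof -
    have "v = X * (r * (2 * fps_deriv r)) - r * r"
      unfolding v_def by (simp add: algebra_simps)
    also have "\<dots> = 4 * X ^ 2 * V * Y ^ 4 - (1 - Y) ^ 2"
      unfolding p'[symmetric] pt[symmetric] by algebra
    finally show ?thesis .
  qed
  \<comment> \<open>Squaring the relation from \<open>w\<close> and comparing it with the one from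
    \<open>v\<close> eliminates \<open>Y - 1\<close>; the second factor of \<open>w\<close> is the
    conjugate that forms the difference of squares.\<close>
  have "32 * X ^ 4 * (E ^ 2 - V) * Y ^ 8 =
      w * (4 * X ^ 2 * Y ^ 4 * E + 2 * X * Y ^ 2 * (Y - 1)) - 8 * X ^ 2 * Y ^ 4 * v"
    unfolding w v by algebra
  moreover have "r dvd w" "r dvd v"
    unfolding w_def v_def by simp_all
  ultimately have "r dvd 32 * X ^ 4 * (E ^ 2 - V) * Y ^ 8"
    by simp
  moreover have "32 * X ^ 4 * (E ^ 2 - V) =
      embed (32 * fps_X ^ 4 * ((1 - 2 * u + 6 * fps_X * fps_deriv u) ^ 2 - fps_deriv u))"
    by (simp only: embed_add embed_diff embed_mult embed_power embed_numeral embed_X embed_1 E_def U_def V_def)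
  ultimately have "32 * fps_X ^ 4 * ((1 - 2 * u + 6 * fps_X * fps_deriv u) ^ 2 - fps_deriv u) = 0"
    using kernel_dvd[OF r0] by metis
  then show ?thesis
    by simp
qed

section \<open>The functional equation, the differential equation and the recurrence\<close>

context
  fixes b :: "nat \<Rightarrow> nat \<Rightarrow> int"
  assumes b_0: "\<And>k. b 0 k = (if k = 0 then 1 else 0)"
    and b_large: "\<And>p k. 2 * k < p \<Longrightarrow> b p k = 0"
    and b_1: "\<And>k. b 1 k = b 2 k"
    and b_rec: "\<And>p k. b (p + 2) (Suc k) = b (p + 3) (Suc k) + (\<Sum>j\<le>k. \<Sum>i\<le>p. b i j * b (p - i) (k - j))"
begin

text \<open>By \<open>b_large\<close> the cut at \<open>2 * k\<close> loses nothing, and every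
  coefficient is a polynomial in \<open>y\<close>.\<close>

definition genfun :: "int poly fps" where
  "genfun = Abs_fps (\<lambda>k. \<Sum>p\<le>2 * k. monom (b p k) p)"

lemma coeff_genfun: "coeff (genfun $ k) p = b p k"
  using b_large[where p = p and k = k] by (auto simp: genfun_def coeff_sum not_le)

lemma coeff_genfun_square:
  "coeff ((genfun * genfun) $ k) p = (\<Sum>j\<le>k. \<Sum>i\<le>p. b i j * b (p - i) (k - j))"
  by (simp add: fps_mult_nth coeff_sum coeff_mult coeff_genfun atLeast0AtMost)

text \<open>The factor \<open>1 - Y\<close> takes differences of neighbouring values of
  \<open>p\<close>. From \<open>p = 3\<close> on these are given by \<open>b_rec\<close>, whose
  convolution is shifted by \<open>X * Y^3\<close>; at \<open>p = 2\<close> the difference vanishes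
  by \<open>b_1\<close>, and at \<open>p = 1\<close> the unknown series remains on the
  right.\<close>

lemma functional_equation:
  "X * Y ^ 3 * (genfun * genfun) + (1 - Y) * genfun = 1 - Y + Y * embed (Abs_fps (b 1))"
proof (rule fps_ext, rule poly_eqI)
  fix k p
  have y3: "X * Y ^ 3 * (genfun * genfun) = X * (fps_const (monom 1 3) * (genfun * genfun))"
    by (simp add: Y_def fps_const_power monom_altdef mult.assoc)
  have lhs: "coeff ((X * Y ^ 3 * (genfun * genfun) + (1 - Y) * genfun) $ k) p =
    (if k = 0 \<or> p < 3 then 0 else coeff ((genfun * genfun) $ (k - 1)) (p - 3)) +
    b p k - (if p = 0 then 0 else b (p - 1) k)"
  proof -
    have 1: "(X * (fps_const (monom 1 3) * f)) $ k = (if k = 0 then 0 else monom 1 3 * f $ (k - 1))" for f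
      by simp
    have 2: "((1 - Y) * f) $ k = f $ k - pCons 0 (f $ k)" for f
      by (simp add: left_diff_distrib Y_def)
    show ?thesis
      unfolding y3 fps_add_nth 1 2 coeff_add coeff_diff
      by (auto simp: coeff_monom_mult coeff_genfun coeff_pCons split: nat.split)
  qed
  have rhs: "coeff ((1 - Y + Y * embed (Abs_fps (b 1))) $ k) p =
    (if k = 0 \<and> p = 0 then 1 else 0) - (if k = 0 \<and> p = 1 then 1 else 0) + (if p = 1 then b 1 k else 0)"
    by (auto simp: Y_def coeff_pCons split: nat.split)
  have "p = 0 \<or> p = 1 \<or> p = 2 \<or> (k = 0 \<and> p \<ge> 3) \<or> (\<exists>k' q. k = Suc k' \<and> p = q + 3)"
  proof (cases "p \<ge> 3")
    case True
    then have "p = (p - 3) + 3"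
      by simp
    then show ?thesis
      using True by (cases k) blast+
  qed linarith
  then consider "p = 0" | "p = 1" | "p = 2" | "k = 0" "p \<ge> 3" | k' q where "k = Suc k'" "p = q + 3"
    by blast
  then show "coeff ((X * Y ^ 3 * (genfun * genfun) + (1 - Y) * genfun) $ k) p =
    coeff ((1 - Y + Y * embed (Abs_fps (b 1))) $ k) p"
  proof cases
    case 1
    then show ?thesis
      unfolding lhs rhs by (simp add: b_0)
  next
    case 2
    then show ?thesis
      unfolding lhs rhs by (simp add: b_0)
  next
    case 3
    then show ?thesis
      unfolding lhs rhs using b_1[of k] by simp
  next
    case 4
    then show ?thesis
      unfolding lhs rhs using b_large[where p = p and k = 0] b_large[where p = "p - 1" and k = 0] by simp
  next
    case 5
    then show ?thesis
      unfolding lhs rhs using b_rec[of q k'] by (simp add: coeff_genfun_square)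
  qed
qed

lemma ode:
  defines "u \<equiv> Abs_fps (b 1)"
  shows "fps_deriv u = (1 - 2 * u + 6 * fps_X * fps_deriv u) ^ 2"
proof (rule quadratic_method)
  \<comment> \<open>The derivative of the left side of the functional equation with respect to
    \<open>genfun\<close>. Its square is the discriminant, as in completing the square.\<close>
  let ?r = "1 - Y + 2 * X * Y ^ 3 * genfun"
  show "?r $ 0 = [:1, -1:]"
    by (simp add: Y_def numeral_fps_const mult.assoc one_pCons)
  have "?r * ?r = (1 - Y) ^ 2 + 4 * X * Y ^ 3 * (X * Y ^ 3 * (genfun * genfun) + (1 - Y) * genfun)"
    by (simp add: algebra_simps power2_eq_square)
  also have "\<dots> = (1 - Y) ^ 2 + 4 * X * Y ^ 3 - 4 * X * (1 - embed u) * Y ^ 4"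
    unfolding functional_equation u_def[symmetric] by (simp add: algebra_simps eval_nat_numeral)
  finally show "?r * ?r = (1 - Y) ^ 2 + 4 * X * Y ^ 3 - 4 * X * (1 - embed u) * Y ^ 4" .
qed

lemma b_1_recurrence:
  assumes "n \<ge> 1"
  shows "(int n + 1) * b 1 (Suc n) = 4 * (3 * int n - 1) * b 1 n +
    4 * (\<Sum>(i, j)\<in>{(i, j). i + j + 2 = n}. (3 * int i + 2) * (3 * int j + 2) * b 1 (Suc i) * b 1 (Suc j))"
proof -
  define u where "u = Abs_fps (b 1)"
  define e where "e = 1 - 2 * u + 6 * fps_X * fps_deriv u"
  have b10: "b 1 0 = 0"
    by (rule b_large) simp
  have e0: "e $ 0 = 1"
    by (simp add: e_def u_def b10[simplified] mult.assoc numeral_fps_const)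
  \<comment> \<open>The differential equation reads \<open>u' = e^2\<close>. These coefficients are
    the source of the factors \<open>3 * n - 1\<close> and, after an index shift,
    \<open>3 * i + 2\<close>.\<close>
  have e: "e $ i = 2 * (3 * int i - 1) * b 1 i" if "i \<ge> 1" for i
    using that by (simp add: e_def u_def mult.assoc numeral_fps_const algebra_simps)
  have "(int n + 1) * b 1 (Suc n) = fps_deriv u $ n"
    by (simp add: u_def)
  also have "\<dots> = (\<Sum>i=0..n. e $ i * e $ (n - i))"
    using ode unfolding u_def[symmetric] e_def[symmetric] by (simp add: power2_eq_square fps_mult_nth)
  \<comment> \<open>The two end terms use \<open>e $ 0 = 1\<close> and give the linear term of the
    recurrence; \<open>n \<ge> 1\<close> keeps them distinct.\<close>
  also have "\<dots> = 2 * e $ n + (\<Sum>i=1..<n. e $ i * e $ (n - i))"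
  proof -
    have "{0..n} = {0, n} \<union> {1..<n}"
      using assms by auto
    then show ?thesis
      using assms by (simp add: sum.union_disjoint e0)
  qed
  also have "(\<Sum>i=1..<n. e $ i * e $ (n - i)) =
    (\<Sum>(i, j)\<in>{(i, j). i + j + 2 = n}. e $ Suc i * e $ Suc j)"
    by (rule sum.reindex_bij_witness[of _ "\<lambda>(i, j). Suc i" "\<lambda>i. (i - 1, n - i - 1)"]) (auto simp: Suc_diff_Suc)
  also have "\<dots> = 4 * (\<Sum>(i, j)\<in>{(i, j). i + j + 2 = n}.
      (3 * int i + 2) * (3 * int j + 2) * b 1 (Suc i) * b 1 (Suc j))"
    unfolding sum_distrib_left by (intro sum.cong) (auto simp: e algebra_simps)
  finally show ?thesis
    using e[OF assms] by simp
qed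

end

theorem corollary1:
  fixes n :: nat
  assumes "n \<ge> 1"
  shows "(int n + 1) * int (T n) =
           4 * (3 * int n - 1) * int (T (n - 1)) +
           4 * (\<Sum>(i, j)\<in>{(i, j). i + j + 2 = n}.
                  (3 * int i + 2) * (3 * int j + 2) * int (T i) * int (T j))"
proof -
  have T: "T (n - 1) = code_count 1 n"
    using assms by (simp add: T_eq_code_count)
  show ?thesis
    unfolding T unfolding T_eq_code_count
  proof (rule b_1_recurrence[of "\<lambda>p k. int (code_count p k)"])
    show "int (code_count p k) = 0" if "2 * k < p" for p k
      using code_count_large[OF that] by simp
    show "int (code_count (p + 2) (Suc k)) = int (code_count (p + 3) (Suc k)) +
      (\<Sum>j\<le>k. \<Sum>i\<le>p. int (code_count i j) * int (code_count (p - i) (k - j)))" for p k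
      unfolding code_count_rec by simp
  qed (simp_all only: code_count_0 code_count_1 assms, simp)
qed

end
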